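(* Let $n\ge 3$ be an integer, let $G=D_{2n}=\langle a,b: a^n=b^2=1,\ b^{-1}ab=a^{-1}\rangle$ be the dihedral group of order $2n$, and let $S\subseteq G\setminus\{1_G\}$ be conjugation-closed. Write $S=S_0\cup S_1$ with $S_0=S\cap\langle a\rangle$ and $S_1=S\cap b\langle a\rangle$. Assume that the Cayley graph $\Gamma=\mathrm{Cay}(G,S)$ is connected. When $4\mid n$, set $P:=\{d: d\mid n,\ v_2(\tfrac nd)=2\}\setminus\{\tfrac n4\}$. Then $\Gamma$ admits perfect state transfer if and only if $n$ is even and one of the following holds. (1) $8\mid n$, and there exist $E\subseteq P$, $F\subseteq\{d: d\mid n,\ v_2(\tfrac nd)\ge 3\}$ and $\xi\in\{\tfrac n4,\tfrac n2\}$ such that $$S_0=\bigcup_{d\in D}G_n(d),\qquad D=F\cup E\cup 2E\cup 4E\cup\{\xi\}.$$ (In this case the only restriction on $S_1$ is that it is nonempty.) (2) $n\equiv 4\pmod 8$, and there exists $E\subseteq P$ such that either (2a) $S_1=b\langle a\rangle$ and, for some $\xi\in\{\tfrac n4,\tfrac n2\}$, $$S_0=\bigcup_{d\in D}G_n(d),\qquad D=E\cup 2E\cup 4E\cup\{\xi\};$$ or (2b) $S_1\in\{b\langle a^2\rangle,\ ba\langle a^2\rangle\}$ and there exists $\rho\in\{0,1\}$, with $E\neq\emptyset$ or $\rho=1$, such that $$S_0=\bigcup_{d\in D}G_n(d),\qquad D=E\cup 2(P\setminus E)\cup 4(P\setminus E)\cup\rho\{\tfrac n4,\tfrac n2\}.$$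 (3) $n\equiv 2\pmod 4$ and $S=G\setminus\{1_G,a^{n/2}\}$. Moreover, if $\Gamma$ admits perfect state transfer between distinct vertices $g$ and $g'$, then $g'=ga^{n/2}$, and the minimum time at which perfect state transfer occurs is $\frac{\pi}{2}$.
   Context: For a group $G$ and an inverse-closed set $S\subseteq G\setminus\{1_G\}$, $\mathrm{Cay}(G,S)$ is the simple undirected graph with vertex set $G$ in which $x,y$ are adjacent iff $yx^{-1}\in S$. (In $D_{2n}$ every conjugation-closed set is inverse-closed.) $S$ is conjugation-closed if $g^{-1}Sg=S$ for all $g\in G$. For a graph with adjacency matrix $A$, put $H(t)=\exp(-\mathrm{i}tA)$ for $t\ge 0$. The graph admits perfect state transfer between distinct vertices $u,v$ at time $t$ if $|H(t)_{u,v}|=1$; it admits perfect state transfer if this holds for some distinct $u,v$ and some $t\ge 0$. For a positive divisor $d$ of $n$ with $d<n$, $G_n(d)=\{a^k:\ 1\le k<n,\ \gcd(k,n)=d\}$. $v_2$ denotes the $2$-adic exponential valuation. For a set $X$ of integers and an integer $k\geq 1$, $kX=\{kx:x\in X\}$; exception: for $\rho\in\{0,1\}$ the expression $\rho\{\tfrac n4,\tfrac n2\}$ means the set $\{\tfrac n4,\tfrac n2\}$ if $\rho=1$ and the empty set if $\rho=0$. *)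

theory Defs
  imports
    Complex_Main
    "HOL-Computational_Algebra.Primes"
    "HOL-Algebra.Generated_Groups"
    "Graph_Theory.Graph_Theory"
begin

section \<open>Dihedral groups\<close>

text \<open>
  \<open>G\<close> is \<open>D\<^bsub>2n\<^esub> = \<langle>a, b : a\<^sup>n = b\<^sup>2 = 1, b\<^sup>-\<^sup>1ab = a\<^sup>-\<^sup>1\<rangle>\<close> with distinguished generators
  \<open>a\<close> and \<open>b\<close>. For \<open>n > 0\<close> the presented group has order \<open>2n\<close>, so a group generated by such
  \<open>a\<close> and \<open>b\<close> is the presented group, with no further relations, iff its order is \<open>2n\<close>.
\<close>

locale dihedral = group G for G (structure) +
  fixes n :: nat and a b
  assumes a_closed: "a \<in> carrier G"
    and b_closed: "b \<in> carrier G"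
    and a_pow_n: "a [^] n = \<one>"
    and b_pow_2: "b [^] (2::nat) = \<one>"
    and b_conj_a: "inv b \<otimes> a \<otimes> b = inv a"
    and generated: "generate G {a, b} = carrier G"
    and order_G: "order G = 2 * n"

definition conj_closed :: "('a, 'b) monoid_scheme \<Rightarrow> 'a set \<Rightarrow> bool" where
  "conj_closed G S \<longleftrightarrow>
     (\<forall>g \<in> carrier G. (\<lambda>s. inv\<^bsub>G\<^esub> g \<otimes>\<^bsub>G\<^esub> s \<otimes>\<^bsub>G\<^esub> g) ` S = S)"

definition gcd_powers :: "('a, 'b) monoid_scheme \<Rightarrow> 'a \<Rightarrow> nat \<Rightarrow> nat \<Rightarrow> 'a set" where
  "gcd_powers G a n d = {a [^]\<^bsub>G\<^esub> k | k::nat. 1 \<le> k \<and> k < n \<and> gcd k n = d}"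

text \<open>The set written \<open>P\<close>; it is meant for \<open>4 dvd n\<close> only, so that \<open>n div 4\<close> is exact.\<close>

definition val2_divisors :: "nat \<Rightarrow> nat set" where
  "val2_divisors n = {d. d dvd n \<and> multiplicity 2 (n div d) = 2} - {n div 4}"

section \<open>Cayley graphs\<close>

text \<open>
  An undirected edge is represented by the two arcs joining its ends; see \<open>pair_graph_Cay\<close>.
\<close>

definition Cay :: "('a, 'b) monoid_scheme \<Rightarrow> 'a set \<Rightarrow> 'a pair_pre_digraph" where
  "Cay G S = \<lparr> pverts = carrier G,
     parcs = {(x, y). x \<in> carrier G \<and> y \<in> carrier G \<and> y \<otimes>\<^bsub>G\<^esub> inv\<^bsub>G\<^esub> x \<in> S} \<rparr>"

lemma pair_graph_Cay:
  assumes "group G" and "finite (carrier G)" and "S \<subseteq> carrier G - {\<one>\<^bsub>G\<^esub>}"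
    and inverse_closed: "\<And>s. s \<in> S \<Longrightarrow> inv\<^bsub>G\<^esub> s \<in> S"
  shows "pair_graph (Cay G S)"
proof -
  interpret group G by fact
  have "finite (parcs (Cay G S))"
    by (rule finite_subset[of _ "carrier G \<times> carrier G"]) (auto simp: Cay_def assms)
  moreover have "x \<otimes>\<^bsub>G\<^esub> inv\<^bsub>G\<^esub> y \<in> S"
    if "x \<in> carrier G" "y \<in> carrier G" "y \<otimes>\<^bsub>G\<^esub> inv\<^bsub>G\<^esub> x \<in> S" for x y
    using inverse_closed[OF that(3)] that by (simp add: inv_mult_group)
  ultimately show ?thesis
    using assms
    by unfold_locales (auto simp: Cay_def symmetric_def sym_def)
qed

section \<open>Perfect state transfer\<close>

text \<open>
  Matrices are indexed by a finite vertex set \<open>V\<close> and represented as functions on pairs of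
  vertices; only the entries in \<open>V\<close> are meaningful.
\<close>

type_synonym 'v vmat = "'v \<Rightarrow> 'v \<Rightarrow> complex"

primrec vmat_pow :: "'v set \<Rightarrow> 'v vmat \<Rightarrow> nat \<Rightarrow> 'v vmat" where
  "vmat_pow V M 0 = (\<lambda>u v. if u = v then 1 else 0)"
| "vmat_pow V M (Suc k) = (\<lambda>u v. \<Sum>w\<in>V. M u w * vmat_pow V M k w v)"

definition vmat_exp :: "'v set \<Rightarrow> 'v vmat \<Rightarrow> 'v vmat" where
  "vmat_exp V M = (\<lambda>u v. \<Sum>k. vmat_pow V M k u v / fact k)"

lemma summable_vmat_exp:
  assumes "finite V" "u \<in> V"
  shows "summable (\<lambda>k. vmat_pow V M k u v / fact k)"
proof -
  define c where "c = (\<Sum>x\<in>V. \<Sum>w\<in>V. norm (M x w))"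
  have row: "(\<Sum>w\<in>V. norm (M x w)) \<le> c" if "x \<in> V" for x
    unfolding c_def using assms(1) that
    by (intro member_le_sum) (auto intro: sum_nonneg)
  have c0: "0 \<le> c" by (auto simp: c_def intro!: sum_nonneg)
  have bound: "norm (vmat_pow V M k x v) \<le> c ^ k" if "x \<in> V" for k x
    using that
  proof (induction k arbitrary: x)
    case (Suc k)
    have "norm (vmat_pow V M (Suc k) x v) \<le> (\<Sum>w\<in>V. norm (M x w) * c ^ k)"
      using Suc.IH
      by (auto simp: norm_mult intro!: order_trans[OF norm_sum] sum_mono mult_left_mono)
    also have "\<dots> = (\<Sum>w\<in>V. norm (M x w)) * c ^ k"
      by (simp add: sum_distrib_right)
    also have "\<dots> \<le> c * c ^ k"
      using row[OF Suc.prems] c0 by (intro mult_right_mono) auto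
    finally show ?case by simp
  qed auto
  have "summable (\<lambda>k. c ^ k / fact k)"
    using summable_exp[of c] by (simp add: field_simps)
  then show ?thesis
    by (rule summable_comparison_test')
       (use bound[OF assms(2)] in \<open>auto simp: norm_divide intro!: divide_right_mono\<close>)
qed

definition adj_matrix :: "'v pair_pre_digraph \<Rightarrow> 'v vmat" where
  "adj_matrix X = (\<lambda>u v. if (u, v) \<in> parcs X then 1 else 0)"

definition transition_matrix :: "'v pair_pre_digraph \<Rightarrow> real \<Rightarrow> 'v vmat" where
  "transition_matrix X t =
     vmat_exp (pverts X) (\<lambda>u v. - \<i> * of_real t * adj_matrix X u v)"

definition pst_at :: "'v pair_pre_digraph \<Rightarrow> 'v \<Rightarrow> 'v \<Rightarrow> real \<Rightarrow> bool" where
  "pst_at X u v t \<longleftrightarrow> u \<in> pverts X \<and> v \<in> pverts X \<and> u \<noteq> v \<and> 0 \<le> t \<and>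
     norm (transition_matrix X t u v) = 1"

definition admits_pst_between :: "'v pair_pre_digraph \<Rightarrow> 'v \<Rightarrow> 'v \<Rightarrow> bool" where
  "admits_pst_between X u v \<longleftrightarrow> (\<exists>t. pst_at X u v t)"

definition admits_pst :: "'v pair_pre_digraph \<Rightarrow> bool" where
  "admits_pst X \<longleftrightarrow> (\<exists>u v. admits_pst_between X u v)"

end

theory Submission
  imports Defs "Jordan_Normal_Form.Char_Poly" "HOL-Number_Theory.Residues"
begin

text \<open>
Write \<open>c\<close> and \<open>s\<close> for the indicator functions of the exponents \<open>k\<close> with \<open>a\<^sup>k \<in> S\<close> and
\<open>b a\<^sup>k \<in> S\<close>. Closure of \<open>S\<close> under conjugation by \<open>b\<close> makes both functions even, and this is all
that is needed to turn \<open>Cay G S\<close> into a Cayley graph of the abelian group \<open>\<int>/n \<times> \<int>/2\<close>, with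
\<open>a\<^sup>i\<close> and \<open>b a\<^sup>i\<close> in the places of \<open>(i, 0)\<close> and \<open>(i, 1)\<close>. Characters diagonalise it, with
eigenvalues \<open>\<lambda>(h, \<sigma>) = c\<^sup>*(h) + \<sigma> s\<^sup>*(h)\<close>, where \<open>\<^sup>*\<close> is the Fourier transform on \<open>\<int>/n\<close> and
\<open>\<sigma> = \<plusminus>1\<close>. Closure under conjugation by \<open>a\<close> gives \<open>s\<close> the period 2, so that \<open>s\<^sup>*(h) = 0\<close> unless
\<open>n\<close> divides \<open>2h\<close>. An entry of the transition matrix is an average of \<open>2n\<close> numbers of modulus 1,
and it has modulus 1 iff they coincide. Comparing them at \<open>h = 1\<close> and \<open>h = -1\<close> leaves only the
pairs \<open>(g, g a\<^bsup>n/2\<^esup>)\<close> with \<open>n\<close> even, and for these transfer at time \<open>t\<close> means that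
\<open>exp (\<i>t(\<lambda>(h, \<sigma>) - \<lambda>(0, 1))) = (-1)\<^sup>h\<close> for all \<open>h\<close> and \<open>\<sigma>\<close>
(\<open>pst_at_iff_phase_alignment\<close>).

Such an alignment forces \<open>t = \<pi>x/y\<close> with \<open>x/y\<close> a fraction in lowest terms and all eigenvalues to
be integers. An integral spectrum makes \<open>c\<close> a function of \<open>gcd(k, n)\<close>, which is So's theorem on
integral circulant graphs (\<open>integral_spectrum_imp_gcd_invariant\<close>). What remains is a statement about
\<open>f = c - s\<close>: modulo \<open>2y\<close>, its spectrum has one value \<open>K\<close> at even and the value \<open>K + y\<close> at odd
frequencies. Averaging the spectrum over a coset of frequencies localises it at one prime \<open>p\<close>
(\<open>coset_inversion\<close>); by gcd-invariance nearly all terms cancel, and the difference of the values of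
\<open>f\<close> at \<open>k\<close> and \<open>k + n/p\<close> survives as a congruence. For \<open>p = 2\<close> these congruences give
\<open>y \<equiv> 2 (mod 4)\<close> together with a list of relations between values of \<open>f\<close> at divisors of \<open>n\<close>
which differ by factors 2 and 4 (\<open>half_profile\<close> for \<open>n \<equiv> 2 (mod 4)\<close>, \<open>quarter_profile\<close> for
\<open>4 | n\<close>). An odd prime \<open>p | y\<close> would identify the values of \<open>f\<close> at \<open>n/2\<close> and \<open>n/(2p)\<close>, and for
\<open>4 | n\<close> also those at \<open>n/4\<close> and \<open>n/(4p)\<close>, which the same relations exclude. Hence \<open>y = 2\<close> and
\<open>t \<ge> \<pi>/2\<close>.

Conversely, the relations say that \<open>f\<close>, after a correction at \<open>0\<close> and \<open>n/2\<close>, has a Fourier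
transform that is constant modulo 4. As \<open>s\<^sup>*\<close> takes even values, this is alignment at \<open>t = \<pi>/2\<close>
(\<open>pst_profile_imp_phase_alignment\<close>).

Finally, the relations are rewritten as descriptions of \<open>S\<close>. For \<open>n \<equiv> 2 (mod 4)\<close> the
divisibility of \<open>|S\<^sub>1|\<close> by \<open>y\<close> puts all reflections into \<open>S\<close>, and the relations determine \<open>c\<close>. For
\<open>4 | n\<close>, \<open>s\<close> takes equal values at the divisors compared, and the relations say the
same about \<open>c\<close>, unless \<open>n \<equiv> 4 (mod 8)\<close> and \<open>S\<^sub>1\<close> is one of the two classes of reflections; there
the values of \<open>s\<close> differ, and complements appear. Connectedness enters by making \<open>S\<^sub>1\<close>
nonempty and by excluding \<open>E = {}\<close> and \<open>\<rho> = 0\<close> in that last case.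
\<close>

section \<open>Roots of unity and periodic sums\<close>

definition rou :: "nat \<Rightarrow> int \<Rightarrow> complex" where
  "rou n k = cis (2 * pi * of_int k / of_nat n)"

lemma rou_0 [simp]: "rou n 0 = 1"
  by (simp add: rou_def)

lemma rou_add: "rou n (j + k) = rou n j * rou n k"
  by (simp add: rou_def cis_mult add_divide_distrib distrib_left)

lemma rou_power: "rou n k ^ j = rou n (int j * k)"
  by (simp add: rou_def DeMoivre algebra_simps)

lemma cnj_rou: "cnj (rou n k) = rou n (- k)"
  by (simp add: rou_def cis_cnj)

lemma norm_rou [simp]: "norm (rou n k) = 1"
  by (simp add: rou_def)

lemma rou_eq_1_iff:
  assumes "n > 0"
  shows "rou n k = 1 \<longleftrightarrow> int n dvd k"
proof
  assume "rou n k = 1"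
  then have "cis (2 * pi * of_int k / of_nat n) = cis 0"
    by (simp add: rou_def)
  then have "cos (2 * pi * of_int k / of_nat n) = 1"
    by (metis cis.simps(1) cis_zero one_complex.simps(1))
  then obtain z :: int where "2 * pi * of_int k / of_nat n = of_int z * 2 * pi"
    using cos_one_2pi_int by auto
  then have "of_int k = (of_int z * of_nat n :: real)"
    using assms by (simp add: field_simps)
  then have "k = z * int n"
    by (metis of_int_eq_iff of_int_mult of_int_of_nat_eq)
  then show "int n dvd k" by simp
next
  assume "int n dvd k"
  then obtain z where "k = int n * z" ..
  then have "2 * pi * of_int k / of_nat n = 2 * pi * of_int z"
    using assms by simp
  then show "rou n k = 1"
    by (simp add: rou_def cis_multiple_2pi)
qed

lemma rou_cong:
  assumes "n > 0" "int n dvd j - k"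
  shows "rou n j = rou n k"
proof -
  have "rou n j = rou n (j - k) * rou n k"
    by (simp flip: rou_add)
  also have "rou n (j - k) = 1"
    using assms rou_eq_1_iff by blast
  finally show ?thesis by simp
qed

lemma rou_scale:
  assumes "N > 0"
  shows "rou (N * m) (int N * k) = rou m k"
  using assms by (simp add: rou_def mult.assoc)

definition periodic :: "nat \<Rightarrow> (int \<Rightarrow> 'a) \<Rightarrow> bool" where
  "periodic n g \<longleftrightarrow> (\<forall>k. g (k + int n) = g k)"

lemma periodic_mult:
  assumes "periodic n g"
  shows "g (k + int n * z) = g k"
proof -
  have nat: "g (j + int n * int l) = g j" for j l
  proof (induction l)
    case (Suc l)
    have "g (j + int n * int (Suc l)) = g ((j + int n * int l) + int n)"
      by (simp add: algebra_simps)
    then show ?case using assms Suc by (simp add: periodic_def)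
  qed simp
  show ?thesis
  proof (cases "z \<ge> 0")
    case True
    then show ?thesis using nat[of k "nat z"] by simp
  next
    case False
    then show ?thesis using nat[of "k + int n * z" "nat (- z)"] by simp
  qed
qed

lemma periodic_cong:
  assumes "periodic n g" "int n dvd j - k"
  shows "g j = g k"
proof -
  from assms(2) obtain z where "j - k = int n * z" ..
  then have "j = k + int n * z" by simp
  then show ?thesis using periodic_mult[OF assms(1)] by simp
qed

lemma periodicI_cong:
  assumes "\<And>j k. int n dvd j - k \<Longrightarrow> g j = g k"
  shows "periodic n g"
  unfolding periodic_def by (auto intro!: assms)

text \<open>
Shifting and negating residues are changes of residue system, so the reindexings below are
instances of this one.
\<close>

lemma sum_periodic_reindex:
  fixes g :: "int \<Rightarrow> 'a :: comm_monoid_add"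
  assumes "n > 0" "periodic n g"
    and inj: "\<And>i j. i \<in> A \<Longrightarrow> j \<in> A \<Longrightarrow> int n dvd f i - f j \<Longrightarrow> i = j"
    and surj: "\<And>k. \<exists>i\<in>A. int n dvd f i - k"
  shows "(\<Sum>i\<in>A. g (f i)) = (\<Sum>k\<in>{0..<int n}. g k)"
proof (rule sum.reindex_bij_betw[of "\<lambda>i. f i mod int n" A "{0..<int n}" g, THEN trans[rotated]])
  show "bij_betw (\<lambda>i. f i mod int n) A {0..<int n}"
  proof (rule bij_betwI')
    show "f i mod int n = f j mod int n \<longleftrightarrow> i = j" if "i \<in> A" "j \<in> A" for i j
      using inj[OF that] by (auto simp: mod_eq_dvd_iff)
    show "f i mod int n \<in> {0..<int n}" for i
      using assms(1) by simp
    show "\<exists>i\<in>A. k = f i mod int n" if "k \<in> {0..<int n}" for k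
      using surj[of k] that by (metis atLeastLessThan_iff mod_eq_dvd_iff mod_pos_pos_trivial)
  qed
  show "(\<Sum>i\<in>A. g (f i)) = (\<Sum>i\<in>A. g (f i mod int n))"
    by (intro sum.cong refl periodic_cong[OF assms(2)]) (simp add: mod_eq_dvd_iff[symmetric])
qed

lemma sum_periodic_shift:
  fixes g :: "int \<Rightarrow> 'a :: comm_monoid_add"
  assumes "n > 0" "periodic n g"
  shows "(\<Sum>k\<in>{0..<int n}. g (k + d)) = (\<Sum>k\<in>{0..<int n}. g k)"
proof (rule sum_periodic_reindex[OF assms])
  show "i = j" if "i \<in> {0..<int n}" "j \<in> {0..<int n}" "int n dvd (i + d) - (j + d)" for i j
  proof -
    have "i mod int n = j mod int n" using that(3) by (simp add: mod_eq_dvd_iff)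
    then show ?thesis using that by simp
  qed
  show "\<exists>i\<in>{0..<int n}. int n dvd (i + d) - k" for k
    using assms(1) by (intro bexI[of _ "(k - d) mod int n"])
      (auto simp: mod_eq_dvd_iff[symmetric] mod_simps)
qed

lemma sum_periodic_uminus:
  fixes g :: "int \<Rightarrow> 'a :: comm_monoid_add"
  assumes "n > 0" "periodic n g"
  shows "(\<Sum>k\<in>{0..<int n}. g (- k)) = (\<Sum>k\<in>{0..<int n}. g k)"
proof (rule sum_periodic_reindex[OF assms])
  show "i = j" if "i \<in> {0..<int n}" "j \<in> {0..<int n}" "int n dvd - i - - j" for i j
  proof -
    have "j mod int n = i mod int n" using that(3) by (simp add: mod_eq_dvd_iff)
    then show ?thesis using that by simp
  qed
  show "\<exists>i\<in>{0..<int n}. int n dvd - i - k" for k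
    using assms(1) by (intro bexI[of _ "(- k) mod int n"])
      (auto simp: mod_eq_dvd_iff[symmetric] mod_simps)
qed

lemma sum_rou:
  assumes "n > 0"
  shows "(\<Sum>k\<in>{0..<int n}. rou n (h * k)) = (if int n dvd h then of_nat n else 0)"
proof (cases "int n dvd h")
  case True
  then have "rou n (h * k) = 1" for k
    using assms by (simp add: rou_eq_1_iff)
  then show ?thesis using True by simp
next
  case False
  let ?s = "\<Sum>k\<in>{0..<int n}. rou n (h * k)"
  have "periodic n (\<lambda>k. rou n (h * k))"
    by (rule periodicI_cong) (auto intro!: rou_cong assms simp flip: right_diff_distrib)
  then have "?s = (\<Sum>k\<in>{0..<int n}. rou n (h * (k + 1)))"
    using sum_periodic_shift[OF assms, of "\<lambda>k. rou n (h * k)" 1] by simp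
  also have "\<dots> = rou n h * ?s"
    by (simp add: rou_add distrib_left sum_distrib_left mult.commute)
  finally have "(1 - rou n h) * ?s = 0" by (simp add: algebra_simps)
  moreover have "rou n h \<noteq> 1" using False assms by (simp add: rou_eq_1_iff)
  ultimately show ?thesis using False by auto
qed

section \<open>Cyclotomic integers\<close>

text \<open>
The ring \<open>\<int>[\<omega>]\<close>, where \<open>\<omega>\<close> is \<open>rou n 1\<close>. It is described as the lattice spanned by the powers of
\<open>\<omega>\<close> because this is the form on which integer matrices act.
\<close>

definition cyc_int :: "nat \<Rightarrow> complex set" where
  "cyc_int n = range (\<lambda>d :: int \<Rightarrow> int. \<Sum>k\<in>{0..<int n}. of_int (d k) * rou n k)"

lemma cyc_intI:
  "x = (\<Sum>k\<in>{0..<int n}. of_int (d k) * rou n k) \<Longrightarrow> x \<in> cyc_int n"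
  unfolding cyc_int_def by blast

lemma cyc_int_0 [simp]: "0 \<in> cyc_int n"
  unfolding cyc_int_def by (rule range_eqI[of _ _ "\<lambda>_. 0"]) simp

lemma cyc_int_add:
  assumes "x \<in> cyc_int n" "y \<in> cyc_int n"
  shows "x + y \<in> cyc_int n"
proof -
  from assms obtain d e where "x = (\<Sum>k\<in>{0..<int n}. of_int (d k) * rou n k)"
    "y = (\<Sum>k\<in>{0..<int n}. of_int (e k) * rou n k)"
    by (auto simp: cyc_int_def)
  then have "x + y = (\<Sum>k\<in>{0..<int n}. of_int (d k + e k) * rou n k)"
    by (simp add: sum.distrib algebra_simps)
  then show ?thesis by (rule cyc_intI)
qed

lemma cyc_int_of_int_mult:
  assumes "x \<in> cyc_int n"
  shows "of_int z * x \<in> cyc_int n"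
proof -
  from assms obtain d where "x = (\<Sum>k\<in>{0..<int n}. of_int (d k) * rou n k)"
    by (auto simp: cyc_int_def)
  then have "of_int z * x = (\<Sum>k\<in>{0..<int n}. of_int (z * d k) * rou n k)"
    by (simp add: sum_distrib_left algebra_simps)
  then show ?thesis by (rule cyc_intI)
qed

lemma cyc_int_sum:
  assumes "\<And>i. i \<in> A \<Longrightarrow> f i \<in> cyc_int n"
  shows "sum f A \<in> cyc_int n"
  using assms by (induction A rule: infinite_finite_induct) (auto intro: cyc_int_add)

lemma cyc_int_rou:
  assumes "n > 0"
  shows "rou n k \<in> cyc_int n"
proof -
  have "rou n k = rou n (k mod int n)"
    using assms by (intro rou_cong) (simp_all add: mod_eq_dvd_iff[symmetric])
  also have "\<dots> = (\<Sum>j\<in>{0..<int n}. of_int (if j = k mod int n then 1 else 0) * rou n j)"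
    using assms by (simp add: if_distrib[of of_int] if_distrib[of "\<lambda>x. x * _"] sum.delta cong: if_cong)
  finally show ?thesis by (rule cyc_intI)
qed

lemma cyc_int_of_int:
  assumes "n > 0"
  shows "of_int z \<in> cyc_int n"
  using cyc_int_of_int_mult[OF cyc_int_rou[OF assms, of 0], of z] by simp

lemma cyc_int_mult:
  assumes n: "n > 0" and "x \<in> cyc_int n" "y \<in> cyc_int n"
  shows "x * y \<in> cyc_int n"
proof -
  from assms obtain d e where "x = (\<Sum>k\<in>{0..<int n}. of_int (d k) * rou n k)"
    "y = (\<Sum>k\<in>{0..<int n}. of_int (e k) * rou n k)"
    by (auto simp: cyc_int_def)
  then have "x * y = (\<Sum>j\<in>{0..<int n}. \<Sum>k\<in>{0..<int n}. of_int (d j * e k) * rou n (j + k))"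
    by (simp add: sum_product rou_add mult_ac)
  then show ?thesis
    by (simp only:) (intro cyc_int_sum cyc_int_of_int_mult cyc_int_rou n)
qed

lemma cyc_int_power:
  assumes "n > 0" "x \<in> cyc_int n"
  shows "x ^ j \<in> cyc_int n"
  using assms cyc_int_of_int[OF assms(1), of 1] by (induction j) (auto intro: cyc_int_mult)

text \<open>
Multiplication by \<open>z = \<Sum>\<^sub>k d\<^sub>k \<omega>\<^sup>k\<close> acts on the vector \<open>(1, \<omega>, \<omega>\<^sup>2, \<dots>)\<close> as the circulant integer
matrix of the coefficients \<open>d\<^sub>k\<close>. So \<open>z\<close> is an eigenvalue of that matrix, and a root of its
characteristic polynomial, which is monic with integer coefficients.
\<close>

lemma algebraic_int_cyc_int:
  assumes n: "n > 0" and "z \<in> cyc_int n"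
  shows "algebraic_int z"
proof -
  from assms obtain d where d: "z = (\<Sum>k\<in>{0..<int n}. of_int (d k) * rou n k)"
    by (auto simp: cyc_int_def)
  define A :: "int mat" where "A = mat n n (\<lambda>(i, j). d ((int j - int i) mod int n))"
  define v where "v = vec n (\<lambda>i. rou n (int i))"
  let ?A = "map_mat of_int A :: complex mat"
  have A: "A \<in> carrier_mat n n" "?A \<in> carrier_mat n n" by (simp_all add: A_def)
  have "?A *\<^sub>v v = z \<cdot>\<^sub>v v"
  proof (rule eq_vecI)
    fix i assume "i < dim_vec (z \<cdot>\<^sub>v v)"
    then have i: "i < n" by (simp add: v_def)
    have "(?A *\<^sub>v v) $ i = (\<Sum>j\<in>{0..<n}. of_int (d ((int j - int i) mod int n)) * rou n (int j))"
      using i by (simp add: A_def v_def scalar_prod_def)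
    also have "\<dots> = (\<Sum>j\<in>int ` {0..<n}. of_int (d ((j - int i) mod int n)) * rou n j)"
      by (simp add: sum.reindex)
    also have "int ` {0..<n} = {0..<int n}"
      using image_int_atLeastLessThan[of 0 n] by simp
    also have "(\<Sum>j\<in>{0..<int n}. of_int (d ((j - int i) mod int n)) * rou n j)
      = (\<Sum>j\<in>{0..<int n}. of_int (d (((j + int i) - int i) mod int n)) * rou n (j + int i))"
    proof (rule sum_periodic_shift[symmetric, OF n])
      show "periodic n (\<lambda>j. of_int (d ((j - int i) mod int n)) * rou n j)"
        by (rule periodicI_cong)
          (auto intro!: arg_cong2[of _ _ _ _ "(*)"] arg_cong[of _ _ d] rou_cong n
             simp: mod_eq_dvd_iff)
    qed
    also have "\<dots> = z * rou n (int i)"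
      unfolding d sum_distrib_right by (intro sum.cong refl) (simp add: rou_add)
    finally show "(?A *\<^sub>v v) $ i = (z \<cdot>\<^sub>v v) $ i"
      using i by (simp add: v_def)
  qed (simp add: A_def v_def)
  moreover have "v \<noteq> 0\<^sub>v n"
  proof
    assume "v = 0\<^sub>v n"
    then have "v $ 0 = 0\<^sub>v n $ 0" by simp
    then show False using n by (simp add: v_def)
  qed
  ultimately have "eigenvalue ?A z"
    using A unfolding eigenvalue_def eigenvector_def by (intro exI[of _ v]) (auto simp: v_def)
  then have root: "poly (of_int_poly (char_poly A)) z = 0"
    using eigenvalue_root_char_poly[OF A(2)] of_int_hom.char_poly_hom[OF A(1)] by metis
  have "lead_coeff (char_poly A) = 1"
    using degree_monic_char_poly[OF A(1)] by simp
  then show ?thesis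
    using root unfolding algebraic_int_altdef_ipoly by blast
qed

text \<open>
The quotient \<open>v/q\<close> is rational and an algebraic integer, hence an integer. Every congruence that
is found in \<open>\<int>[\<omega>]\<close> descends to \<open>\<int>\<close> through this lemma.
\<close>

lemma dvd_of_int_eq_cyc_int:
  assumes n: "n > 0" and "z \<in> cyc_int n" and eq: "of_int v = of_int q * z" and q: "q \<noteq> 0"
  shows "q dvd v"
proof -
  have z: "z = of_int v / of_int q" using eq q by simp
  then have "z \<in> \<rat>" by simp
  then have "z \<in> \<int>"
    using rational_algebraic_int_is_int algebraic_int_cyc_int assms(1,2) by blast
  then obtain w where "z = of_int w" by (rule Ints_cases)
  then have "(of_int v :: complex) = of_int (q * w)" using eq by simp
  then have "v = q * w" using of_int_eq_iff by blast
  then show ?thesis by simp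
qed

section \<open>The Fourier transform and its localisation\<close>

text \<open>
With \<open>c\<close> the indicator function of a connection set, these are the eigenvalues of the circulant
graph.
\<close>

definition ft :: "nat \<Rightarrow> (int \<Rightarrow> int) \<Rightarrow> int \<Rightarrow> complex" where
  "ft n c h = (\<Sum>k\<in>{0..<int n}. of_int (c k) * rou n (h * k))"

lemma cyc_int_ft:
  assumes "n > 0"
  shows "ft n c h \<in> cyc_int n"
  unfolding ft_def by (intro cyc_int_sum cyc_int_of_int_mult cyc_int_rou assms)

lemma periodic_ft_summand:
  assumes "n > 0" "periodic n c"
  shows "periodic n (\<lambda>k. of_int (c k) * rou n (h * k))"
proof (rule periodicI_cong)
  fix j k assume *: "int n dvd j - k"
  then have "int n dvd h * j - h * k" by (simp flip: right_diff_distrib)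
  then show "of_int (c j) * rou n (h * j) = of_int (c k) * rou n (h * k)"
    using rou_cong[OF assms(1)] periodic_cong[OF assms(2) *] by simp
qed

lemma ft_shift:
  assumes "n > 0" "periodic n c"
  shows "(\<Sum>j\<in>{0..<int n}. of_int (c (k + j)) * rou n (h * j)) = ft n c h * rou n (- h * k)"
proof -
  have "ft n c h = (\<Sum>j\<in>{0..<int n}. of_int (c (j + k)) * rou n (h * (j + k)))"
    unfolding ft_def by (rule sum_periodic_shift[symmetric, OF assms(1) periodic_ft_summand[OF assms]])
  then have "ft n c h * rou n (- h * k)
    = (\<Sum>j\<in>{0..<int n}. of_int (c (j + k)) * rou n (h * (j + k)) * rou n (- h * k))"
    by (simp add: sum_distrib_right)
  also have "\<dots> = (\<Sum>j\<in>{0..<int n}. of_int (c (k + j)) * rou n (h * j))"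
    by (intro sum.cong refl) (simp add: mult.assoc add.commute distrib_left flip: rou_add)
  finally show ?thesis by simp
qed

text \<open>
The sum over \<open>l\<close> of the characters with frequency \<open>N l\<close> vanishes off the multiples of \<open>m\<close>. For
\<open>N = 1\<close> this is Fourier inversion. For \<open>N\<close> the full power of a prime \<open>p\<close> in \<open>n\<close>, the price of
the inversion is a factor \<open>m\<close> that is prime to \<open>p\<close>, and can be cancelled in congruences modulo
powers of \<open>p\<close>.
\<close>

lemma coset_inversion:
  assumes "N > 0" "m > 0" and c: "periodic (N * m) c"
  shows "(\<Sum>l\<in>{0..<int m}. ft (N * m) c (h + int N * l) * rou (N * m) (- (h + int N * l) * k))
    = of_nat m * (\<Sum>j | j \<in> {0..<int (N * m)} \<and> int m dvd j. of_int (c (k + j)) * rou (N * m) (h * j))"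
    (is "?L = _")
proof -
  have n: "N * m > 0" using assms by simp
  have split: "rou (N * m) ((h + int N * l) * j) = rou (N * m) (h * j) * rou m (j * l)" for l j
    using rou_add[of "N * m" "h * j" "int N * (j * l)"] rou_scale[OF assms(1), of m "j * l"]
    by (simp add: algebra_simps)
  have "?L = (\<Sum>l\<in>{0..<int m}. \<Sum>j\<in>{0..<int (N * m)}.
      of_int (c (k + j)) * rou (N * m) (h * j) * rou m (j * l))"
    unfolding ft_shift[OF n c, symmetric] by (simp add: split mult.assoc)
  also have "\<dots> = (\<Sum>j\<in>{0..<int (N * m)}. of_int (c (k + j)) * rou (N * m) (h * j) *
      (\<Sum>l\<in>{0..<int m}. rou m (j * l)))"
    by (subst sum.swap) (simp add: sum_distrib_left)
  also have "\<dots> = (\<Sum>j\<in>{0..<int (N * m)}. if int m dvd j then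
      of_nat m * (of_int (c (k + j)) * rou (N * m) (h * j)) else 0)"
    by (intro sum.cong refl) (simp add: sum_rou[OF assms(2)])
  also have "\<dots> = of_nat m * (\<Sum>j | j \<in> {0..<int (N * m)} \<and> int m dvd j.
      of_int (c (k + j)) * rou (N * m) (h * j))"
    by (subst sum.inter_filter[symmetric]) (simp_all add: sum_distrib_left)
  finally show ?thesis .
qed

lemma ft_inversion:
  assumes "n > 0" "periodic n c"
  shows "(\<Sum>h\<in>{0..<int n}. ft n c h * rou n (- h * k)) = of_nat n * of_int (c k)"
proof -
  have "{j. j \<in> {0..<int n} \<and> int n dvd j} = {0}"
    using assms(1) by (auto dest: zdvd_imp_le)
  then show ?thesis
    using coset_inversion[of 1 n c 0 k] assms by simp
qed

section \<open>Integral spectra of circulant graphs\<close>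

text \<open>
Frobenius modulo \<open>p\<close>, in the form of an identity in \<open>\<int>[\<omega>]\<close>.
\<close>

lemma freshman_add:
  assumes n: "n > 0" and p: "prime (p :: nat)" and x: "x \<in> cyc_int n" and y: "y \<in> cyc_int n"
  obtains z where "z \<in> cyc_int n" "(x + y) ^ p = x ^ p + y ^ p + of_nat p * z"
proof -
  define z where "z = (\<Sum>k\<in>{1..<p}. of_int (int ((p choose k) div p)) * (x ^ k * y ^ (p - k)))"
  have "z \<in> cyc_int n"
    unfolding z_def by (intro cyc_int_sum cyc_int_of_int_mult cyc_int_mult cyc_int_power n x y)
  have mid: "of_nat (p choose k) * x ^ k * y ^ (p - k) =
      of_nat p * (of_int (int ((p choose k) div p)) * (x ^ k * y ^ (p - k)))" if "k \<in> {1..<p}" for k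
  proof -
    have "p dvd p choose k" using that p by (intro dvd_choose_prime) auto
    then have "p choose k = p * ((p choose k) div p)" by simp
    then have "(of_nat (p choose k) :: complex) = of_nat p * of_nat ((p choose k) div p)"
      by (metis of_nat_mult)
    then show ?thesis by simp
  qed
  have "p > 0" using p by (simp add: prime_gt_0_nat)
  then have "{..p} = insert 0 (insert p {1..<p})" by auto
  then have "(x + y) ^ p = y ^ p + (x ^ p + (\<Sum>k\<in>{1..<p}. of_nat (p choose k) * x ^ k * y ^ (p - k)))"
    using \<open>p > 0\<close> by (simp add: binomial_ring)
  also have "(\<Sum>k\<in>{1..<p}. of_nat (p choose k) * x ^ k * y ^ (p - k)) = of_nat p * z"
    unfolding z_def sum_distrib_left by (intro sum.cong refl mid)
  finally show ?thesis using that \<open>z \<in> cyc_int n\<close> by (simp add: add_ac)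
qed

lemma freshman_sum:
  assumes n: "n > 0" and p: "prime (p :: nat)" and "finite A"
    and f: "\<And>i. i \<in> A \<Longrightarrow> f i \<in> cyc_int n"
  shows "\<exists>z\<in>cyc_int n. (\<Sum>i\<in>A. f i) ^ p = (\<Sum>i\<in>A. f i ^ p) + of_nat p * z"
  using assms(3) f
proof (induction A rule: finite_induct)
  case empty
  then show ?case using p by (auto intro!: bexI[of _ 0] simp: prime_gt_0_nat)
next
  case (insert i A)
  then obtain z where z: "z \<in> cyc_int n" "(\<Sum>i\<in>A. f i) ^ p = (\<Sum>i\<in>A. f i ^ p) + of_nat p * z"
    by auto
  have "sum f A \<in> cyc_int n" "f i \<in> cyc_int n"
    using insert.prems by (auto intro: cyc_int_sum)
  then obtain w where "w \<in> cyc_int n" "(f i + sum f A) ^ p = f i ^ p + sum f A ^ p + of_nat p * w"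
    using freshman_add[OF n p] by blast
  then show ?case
    using z insert.hyps by (intro bexI[of _ "z + w"]) (auto simp: algebra_simps intro: cyc_int_add)
qed

lemma prime_dvd_power_diff_self:
  assumes p: "prime (p :: nat)"
  shows "int p dvd a ^ p - a"
proof -
  define b where "b = nat (a mod int p)"
  have p0: "p > 0" using p by (simp add: prime_gt_0_nat)
  have ab: "[a = int b] (mod int p)"
    using p0 by (simp add: b_def cong_def)
  have "[b ^ p = b] (mod p)"
  proof (cases "p dvd b")
    case True
    then have "p dvd b ^ p" using p0 by (meson dvd_power dvd_trans)
    then show ?thesis using True by (metis cong_0_iff cong_sym cong_trans)
  next
    case False
    then have "[b * b ^ (p - 1) = b * 1] (mod p)"
      using fermat_theorem[OF p] cong_scalar_left by blast
    then show ?thesis using p0 by (simp flip: power_Suc)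
  qed
  then have "[int b ^ p = int b] (mod int p)"
    by (metis cong_int_iff of_nat_power)
  then have "[a ^ p = a] (mod int p)"
    using ab by (meson cong_pow cong_sym cong_trans)
  then show ?thesis by (simp add: cong_iff_dvd_diff)
qed

text \<open>
Frobenius takes the place of the Galois group. By inversion \<open>n c(k)\<close> is a combination of the
\<open>\<omega>\<^bsup>-hk\<^esup>\<close> with integer coefficients. Its \<open>p\<close>-th power is, modulo \<open>p\<close>, the same combination of the
\<open>\<omega>\<^bsup>-hpk\<^esup>\<close>, that is \<open>n c(pk)\<close>. So \<open>p\<close> divides \<open>c(k) - c(pk)\<close>, and this difference is \<open>-1\<close>, \<open>0\<close>
or \<open>1\<close>.
\<close>

lemma integral_spectrum_prime_multiple:
  assumes n: "n > 0" and c: "periodic n c" "\<And>k. c k \<in> {0, 1}"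
    and int: "\<And>h. ft n c h \<in> \<int>" and p: "prime (p :: nat)" "\<not> p dvd n"
  shows "c (int p * k) = c k"
proof -
  from int have "\<exists>F. \<forall>h. ft n c h = of_int (F h)"
    by (auto intro!: choice elim: Ints_cases)
  then obtain F where F: "\<And>h. ft n c h = of_int (F h)" by blast
  define y where "y = (\<Sum>h\<in>{0..<int n}. ft n c h * rou n (- h * k))"
  have y: "y = of_int (int n * c k)"
    unfolding y_def ft_inversion[OF n c(1)] by simp
  have "\<exists>z\<in>cyc_int n. y ^ p = (\<Sum>h\<in>{0..<int n}. (ft n c h * rou n (- h * k)) ^ p) + of_nat p * z"
    unfolding y_def by (intro freshman_sum n p cyc_int_mult cyc_int_ft cyc_int_rou) auto
  then obtain z where z: "z \<in> cyc_int n"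
    "y ^ p = (\<Sum>h\<in>{0..<int n}. (ft n c h * rou n (- h * k)) ^ p) + of_nat p * z" by blast
  \<comment> \<open>The coefficients of \<open>w\<close> are the quotients in Fermat's little theorem for the eigenvalues.\<close>
  define w where "w = (\<Sum>h\<in>{0..<int n}. of_int ((F h ^ p - F h) div int p) * rou n (- h * (int p * k)))"
  have "w \<in> cyc_int n"
    unfolding w_def by (intro cyc_int_sum cyc_int_of_int_mult cyc_int_rou n)
  have "(ft n c h * rou n (- h * k)) ^ p = ft n c h * rou n (- h * (int p * k)) +
      of_nat p * (of_int ((F h ^ p - F h) div int p) * rou n (- h * (int p * k)))" for h
  proof -
    have "F h ^ p = F h + int p * ((F h ^ p - F h) div int p)"
      using prime_dvd_power_diff_self[OF p(1), of "F h"] by simp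
    then have "(of_int (F h) :: complex) ^ p = of_int (F h) + of_nat p * of_int ((F h ^ p - F h) div int p)"
      by (metis of_int_add of_int_mult of_int_of_nat_eq of_int_power)
    then show ?thesis
      by (simp add: F power_mult_distrib rou_power algebra_simps)
  qed
  then have "(\<Sum>h\<in>{0..<int n}. (ft n c h * rou n (- h * k)) ^ p) =
      of_int (int n * c (int p * k)) + of_nat p * w"
    by (simp only: sum.distrib ft_inversion[OF n c(1)] w_def sum_distrib_left[symmetric])
      simp
  then have "of_int ((int n * c k) ^ p - int n * c (int p * k)) = of_int (int p) * (w + z)"
    using z(2) y by (simp add: algebra_simps)
  then have "int p dvd (int n * c k) ^ p - int n * c (int p * k)"
    using p by (intro dvd_of_int_eq_cyc_int[OF n cyc_int_add[OF \<open>w \<in> cyc_int n\<close> z(1)]]) auto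
  then have "int p dvd ((int n * c k) ^ p - int n * c (int p * k)) - ((int n * c k) ^ p - int n * c k)"
    by (rule dvd_diff[OF _ prime_dvd_power_diff_self[OF p(1)]])
  then have "int p dvd int n * (c k - c (int p * k))"
    by (simp add: algebra_simps)
  moreover have "\<not> int p dvd int n" using p by simp
  ultimately have "int p dvd c k - c (int p * k)"
    using p(1) by (simp add: prime_dvd_mult_iff)
  moreover have "\<bar>c k - c (int p * k)\<bar> \<le> 1"
    using c(2)[of k] c(2)[of "int p * k"] by auto
  moreover have "int p > 1" using prime_gt_1_nat[OF p(1)] by simp
  ultimately show ?thesis
    using dvd_imp_le_int[of "c k - c (int p * k)" "int p"] by linarith
qed

lemma integral_spectrum_unit_multiple:
  assumes n: "n > 0" and c: "periodic n c" "\<And>k. c k \<in> {0, 1}"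
    and int: "\<And>h. ft n c h \<in> \<int>" and "u > 0" "coprime u n"
  shows "c (int u * k) = c k"
  using assms(5,6)
proof (induction u arbitrary: k rule: less_induct)
  case (less u)
  show ?case
  proof (cases "u = 1")
    case False
    then obtain p where p: "prime p" "p dvd u" using prime_factor_nat by blast
    then obtain v where v: "u = p * v" by blast
    have "\<not> p dvd n"
      using coprime_common_divisor[OF less.prems(2) p(2)] p(1) not_prime_unit by blast
    moreover have "v < u" "v > 0" "coprime v n"
      using v less.prems p(1) prime_gt_1_nat[OF p(1)] by auto
    ultimately show ?thesis
      using less.IH[of v k] integral_spectrum_prime_multiple[OF n c int p(1), of "int v * k"] v
      by (simp add: mult.assoc)
  qed simp
qed

text \<open>
Add to \<open>u\<close> the product of \<open>n'\<close> and of those primes that divide \<open>n\<close> but not \<open>u\<close>. Then every prime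
divisor of \<open>n\<close> divides exactly one of the two summands.
\<close>

lemma coprime_lift:
  fixes u n' n :: nat
  assumes "n > 0" "n' dvd n" "coprime u n'"
  obtains v where "v > 0" "coprime v n" "[v = u] (mod n')"
proof -
  define s where "s = \<Prod>{p. prime p \<and> p dvd n \<and> \<not> p dvd u}"
  have fin: "finite {p. prime p \<and> p dvd n \<and> \<not> p dvd u}"
    using assms(1) by (auto intro: finite_subset[OF _ finite_divisors_nat])
  have "n' > 0" using assms by (auto intro: Nat.gr0I)
  have "s > 0" unfolding s_def by (intro prod_pos) (auto simp: prime_gt_0_nat)
  have "coprime (u + n' * s) n"
  proof (rule ccontr)
    assume "\<not> coprime (u + n' * s) n"
    then obtain p where p: "prime p" "p dvd u + n' * s" "p dvd n"
      by (metis coprime_iff_gcd_eq_1 gcd_greatest_iff prime_factor_nat)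
    show False
    proof (cases "p dvd u")
      case True
      then have "p dvd n' * s" using p(2) by (simp add: dvd_add_right_iff)
      moreover have "\<not> p dvd n'"
        using coprime_common_divisor[OF assms(3) True] p(1) not_prime_unit by blast
      moreover have "\<not> p dvd s"
      proof
        assume "p dvd s"
        then obtain q where q: "prime q" "\<not> q dvd u" "p dvd q"
          unfolding s_def using prime_dvd_prod_iff[OF fin p(1)] by auto
        then have "p = q" using p(1) by (simp add: primes_dvd_imp_eq)
        then show False using True q by simp
      qed
      ultimately show False using p(1) by (simp add: prime_dvd_mult_iff)
    next
      case False
      then have "p dvd s" unfolding s_def using p fin by (intro dvd_prodI) auto
      then have "p dvd u" using p(2) by (simp add: dvd_add_left_iff)
      then show False using False by simp
    qed
  qed
  moreover have "u + n' * s > 0" using \<open>n' > 0\<close> \<open>s > 0\<close> by simp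
  moreover have "[u + n' * s = u] (mod n')" by (simp add: cong_def)
  ultimately show ?thesis by (intro that)
qed

lemma gcd_eq_imp_unit_multiple:
  fixes j k :: int
  assumes "n > 0" and eq: "gcd j (int n) = gcd k (int n)"
  obtains u where "u > 0" "coprime u n" "int n dvd int u * k - j"
proof -
  define g where "g = nat (gcd k (int n))"
  have g: "int g = gcd k (int n)" "g > 0" using assms(1) by (auto simp: g_def)
  define n' where "n' = n div g"
  have "int g dvd int n" using g by simp
  then have n: "n = g * n'" unfolding n'_def by simp
  then have n'0: "n' > 0" using assms(1) by simp
  from g obtain k' where k': "k = int g * k'" by (metis gcd_dvd1 dvdE)
  from g eq obtain j' where j': "j = int g * j'" by (metis gcd_dvd1 dvdE)
  have "gcd k (int n) = int g * gcd k' (int n')"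
    using gcd_mult_left[of "int g" k' "int n'"] by (simp add: k' n)
  then have "int g * gcd k' (int n') = int g * 1" using g(1) eq by (simp only: mult_1_right)
  then have cop_k: "coprime k' (int n')"
    using g(2) by (simp only: mult_left_cancel coprime_iff_gcd_eq_1)
  have "gcd j (int n) = int g * gcd j' (int n')"
    using gcd_mult_left[of "int g" j' "int n'"] by (simp add: j' n)
  then have "int g * gcd j' (int n') = int g * 1" using g(1) eq by (simp only: mult_1_right)
  then have cop_j: "coprime j' (int n')"
    using g(2) by (simp only: mult_left_cancel coprime_iff_gcd_eq_1)
  from cop_k obtain i where i: "[k' * i = 1] (mod int n')" using cong_solve_coprime_int by blast
  then have "coprime i (int n')"
    by (metis coprime_iff_invertible_int mult.commute)
  define u where "u = nat ((i * j') mod int n')"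
  have u: "[int u = i * j'] (mod int n')" using n'0 by (simp add: u_def cong_def)
  have "coprime (int u) (int n')"
    using cong_imp_coprime[OF cong_sym[OF u]] \<open>coprime i (int n')\<close> cop_j by simp
  then have "coprime u n'" by simp
  then obtain v where v: "v > 0" "coprime v n" "[v = u] (mod n')"
    using coprime_lift[OF assms(1), of n' u] n by auto
  have "[int v = i * j'] (mod int n')"
    using v(3) u by (meson cong_int_iff cong_trans)
  then have "[int v * k' = i * j' * k'] (mod int n')" by (rule cong_scalar_right)
  also have "i * j' * k' = (k' * i) * j'" by (simp add: mult_ac)
  also have "[(k' * i) * j' = 1 * j'] (mod int n')" using i by (rule cong_scalar_right)
  finally have "int n' dvd int v * k' - j'" by (simp add: cong_iff_dvd_diff)
  then have "int g * int n' dvd int g * (int v * k' - j')" by (intro mult_dvd_mono) auto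
  then have "int n dvd int v * k - j"
    by (simp add: n k' j' algebra_simps)
  then show ?thesis using v that by blast
qed

definition gcd_invariant :: "nat \<Rightarrow> (int \<Rightarrow> 'a) \<Rightarrow> bool" where
  "gcd_invariant n x \<longleftrightarrow> (\<forall>j k. gcd j (int n) = gcd k (int n) \<longrightarrow> x j = x k)"

lemma gcd_invariantD:
  "gcd_invariant n x \<Longrightarrow> gcd j (int n) = gcd k (int n) \<Longrightarrow> x j = x k"
  unfolding gcd_invariant_def by blast

lemma gcd_invariant_imp_periodic:
  assumes "gcd_invariant n x"
  shows "periodic n x"
  unfolding periodic_def by (auto intro!: gcd_invariantD[OF assms])

text \<open>
The substantial half of So's theorem: the units modulo \<open>n\<close>, being products of primes, preserve
\<open>c\<close>, and their orbits on \<open>\<int>/n\<close> are the sets of residues with a given gcd with \<open>n\<close>.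
\<close>

theorem integral_spectrum_imp_gcd_invariant:
  assumes n: "n > 0" and c: "periodic n c" "\<And>k. c k \<in> {0, 1}"
    and int: "\<And>h. ft n c h \<in> \<int>"
  shows "gcd_invariant n c"
  unfolding gcd_invariant_def
proof (intro allI impI)
  fix j k assume "gcd j (int n) = gcd k (int n)"
  then obtain u where u: "u > 0" "coprime u n" "int n dvd int u * k - j"
    using gcd_eq_imp_unit_multiple[OF n] by blast
  have "c j = c (int u * k)"
    using periodic_cong[OF c(1) u(3)] by simp
  then show "c j = c k"
    using integral_spectrum_unit_multiple[OF n c int u(1,2)] by simp
qed

lemma multiples_below:
  "{k. k \<in> {0..<int (d * e)} \<and> int d dvd k} = (*) (int d) ` {0..<int e}" if "d > 0"
  using that by (auto simp: image_iff zero_le_mult_iff elim!: dvdE)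

lemma sum_rou_multiples:
  assumes "d > 0" "e > 0"
  shows "(\<Sum>k | k \<in> {0..<int (d * e)} \<and> int d dvd k. rou (d * e) (h * k)) =
    (if int e dvd h then of_nat e else 0)"
proof -
  have "(\<Sum>k | k \<in> {0..<int (d * e)} \<and> int d dvd k. rou (d * e) (h * k)) =
    (\<Sum>i\<in>{0..<int e}. rou (d * e) (h * (int d * i)))"
    unfolding multiples_below[OF assms(1)] using assms by (simp add: sum.reindex inj_on_def)
  also have "\<dots> = (\<Sum>i\<in>{0..<int e}. rou e (h * i))"
    by (intro sum.cong refl, subst mult.left_commute, rule rou_scale[OF assms(1)])
  also have "\<dots> = (if int e dvd h then of_nat e else 0)" by (rule sum_rou[OF assms(2)])
  finally show ?thesis .
qed

text \<open>
These are Ramanujan's sums. Those of all divisors that are multiples of \<open>d\<close> add up to a geometric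
sum, which is \<open>0\<close> or \<open>n/d\<close>, so that integrality descends from the larger divisors to \<open>d\<close>.
\<close>

lemma ramanujan_sum_Ints:
  assumes "n > 0" "d dvd n"
  shows "(\<Sum>k | k \<in> {0..<int n} \<and> gcd k (int n) = int d. rou n (h * k)) \<in> \<int>"
  using assms(2)
proof (induction "n - d" arbitrary: d rule: less_induct)
  case less
  define R where "R = (\<lambda>d. \<Sum>k | k \<in> {0..<int n} \<and> gcd k (int n) = int d. rou n (h * k))"
  define E where "E = {d'. d' dvd n \<and> d dvd d'}"
  have "finite E" unfolding E_def using assms(1)
    by (auto intro: finite_subset[OF _ finite_divisors_nat])
  from less.prems obtain e where e: "n = d * e" ..
  with assms(1) have pos: "d > 0" "e > 0" by auto
  have un: "{k. k \<in> {0..<int n} \<and> int d dvd k}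
    = (\<Union>d'\<in>E. {k. k \<in> {0..<int n} \<and> gcd k (int n) = int d'})"
  proof (intro equalityI subsetI)
    fix k assume k: "k \<in> {k. k \<in> {0..<int n} \<and> int d dvd k}"
    then have "int d dvd int (nat (gcd k (int n)))" using less.prems by simp
    moreover have "int (nat (gcd k (int n))) dvd int n" by simp
    ultimately have "nat (gcd k (int n)) \<in> E"
      unfolding E_def by (simp only: of_nat_dvd_iff mem_Collect_eq)
    then show "k \<in> (\<Union>d'\<in>E. {k. k \<in> {0..<int n} \<and> gcd k (int n) = int d'})"
      using k by (auto intro!: bexI[of _ "nat (gcd k (int n))"])
  next
    fix k assume "k \<in> (\<Union>d'\<in>E. {k. k \<in> {0..<int n} \<and> gcd k (int n) = int d'})"
    then obtain d' where "d' \<in> E" "k \<in> {0..<int n}" "gcd k (int n) = int d'" by blast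
    then show "k \<in> {k. k \<in> {0..<int n} \<and> int d dvd k}"
      unfolding E_def by (metis (mono_tags, lifting) dvd_trans gcd_dvd1 int_dvd_int_iff mem_Collect_eq)
  qed
  have "(\<Sum>k | k \<in> {0..<int n} \<and> int d dvd k. rou n (h * k)) = (\<Sum>d'\<in>E. R d')"
    unfolding un R_def by (rule sum.UNION_disjoint) (use \<open>finite E\<close> in \<open>auto intro: finite_subset[of _ "{0..<int n}"]\<close>)
  also have "\<dots> = R d + (\<Sum>d'\<in>E - {d}. R d')"
    using \<open>finite E\<close> less.prems by (intro sum.remove) (auto simp: E_def)
  finally have "R d = (\<Sum>k | k \<in> {0..<int n} \<and> int d dvd k. rou n (h * k)) - (\<Sum>d'\<in>E - {d}. R d')"
    by (simp only: add_diff_cancel_right')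
  also have "\<dots> = (if int e dvd h then of_nat e else 0) - (\<Sum>d'\<in>E - {d}. R d')"
    unfolding e sum_rou_multiples[OF pos] ..
  also have "\<dots> \<in> \<int>"
  proof (intro Ints_diff Ints_sum)
    fix d' assume d': "d' \<in> E - {d}"
    then have "d' > 0" "d' \<le> n" "d \<le> d'" "d' \<noteq> d"
      using assms(1) by (auto simp: E_def dvd_imp_le dvd_pos_nat)
    then show "R d' \<in> \<int>"
      unfolding R_def using d' by (intro less.hyps) (auto simp: E_def)
  qed auto
  finally show ?case unfolding R_def .
qed

theorem gcd_invariant_imp_integral_spectrum:
  assumes n: "n > 0" and c: "gcd_invariant n c"
  shows "ft n c h \<in> \<int>"
proof -
  have fin: "finite {d. d dvd n}" using n by simp
  have "ft n c h = (\<Sum>k\<in>(\<Union>d\<in>{d. d dvd n}. {k. k \<in> {0..<int n} \<and> gcd k (int n) = int d}).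
      of_int (c k) * rou n (h * k))"
    unfolding ft_def
  proof (rule sum.cong[OF _ refl], intro equalityI subsetI)
    fix k assume "k \<in> {0..<int n}"
    moreover have "int (nat (gcd k (int n))) dvd int n" by simp
    then have "nat (gcd k (int n)) dvd n" by (simp only: of_nat_dvd_iff)
    ultimately show "k \<in> (\<Union>d\<in>{d. d dvd n}. {k. k \<in> {0..<int n} \<and> gcd k (int n) = int d})"
      by (auto intro!: bexI[of _ "nat (gcd k (int n))"])
  qed auto
  also have "\<dots> = (\<Sum>d | d dvd n. \<Sum>k | k \<in> {0..<int n} \<and> gcd k (int n) = int d.
      of_int (c k) * rou n (h * k))"
    by (rule sum.UNION_disjoint) (use fin in \<open>auto intro: finite_subset[of _ "{0..<int n}"]\<close>)
  also have "\<dots> = (\<Sum>d | d dvd n. of_int (c (int d)) *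
      (\<Sum>k | k \<in> {0..<int n} \<and> gcd k (int n) = int d. rou n (h * k)))"
    unfolding sum_distrib_left
  proof (intro sum.cong refl)
    fix d k assume "d \<in> {d. d dvd n}" "k \<in> {k. k \<in> {0..<int n} \<and> gcd k (int n) = int d}"
    then have "gcd k (int n) = gcd (int d) (int n)" by simp
    then show "of_int (c k) * rou n (h * k) = of_int (c (int d)) * rou n (h * k)"
      using gcd_invariantD[OF c] by metis
  qed
  also have "\<dots> \<in> \<int>"
    by (intro Ints_sum Ints_mult Ints_of_int ramanujan_sum_Ints n) simp
  finally show ?thesis .
qed

section \<open>Congruences from a coset of frequencies\<close>

lemma gcd_eqI_divisors:
  assumes "\<And>d. d dvd n \<Longrightarrow> int d dvd j \<longleftrightarrow> int d dvd k"
  shows "gcd j (int n) = gcd k (int n)"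
proof -
  have *: "gcd j (int n) dvd gcd k (int n)"
    if "\<And>d. d dvd n \<Longrightarrow> int d dvd j \<longleftrightarrow> int d dvd k" for j k
  proof -
    have "int (nat (gcd j (int n))) dvd int n" by simp
    then have "nat (gcd j (int n)) dvd n" by (simp only: of_nat_dvd_iff)
    then have "int (nat (gcd j (int n))) dvd k"
      using that[of "nat (gcd j (int n))"] by simp
    then show ?thesis by simp
  qed
  show ?thesis
    by (rule zdvd_antisym_nonneg) (use * assms in auto)
qed

lemma dvd_prime_power_mult_cases:
  assumes "prime (p :: nat)" "d dvd p ^ b * m"
  shows "p ^ Suc r dvd d \<or> d dvd p ^ r * m"
proof -
  obtain x y where d: "d = x * y" "x dvd p ^ b" "y dvd m"
    using assms(2) division_decomp by blast
  then obtain i where i: "x = p ^ i"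
    using assms(1) divides_primepow_nat by blast
  show ?thesis
  proof (cases "i \<le> r")
    case True
    then show ?thesis using d i by (simp add: mult_dvd_mono le_imp_power_dvd)
  next
    case False
    then have "p ^ Suc r dvd x" unfolding i by (intro le_imp_power_dvd) simp
    then show ?thesis using d by simp
  qed
qed

text \<open>
By the previous lemma a divisor of \<open>p\<^sup>b m\<close> either divides the shift \<open>p\<^sup>r m\<close>, or is a multiple
of \<open>p\<^sup>r\<close> and then divides neither \<open>k\<close> nor the shifted number.
\<close>

lemma gcd_shift:
  assumes "prime (p :: nat)" "\<not> int (p ^ r) dvd k"
  shows "gcd (k + int (p ^ r * m)) (int (p ^ b * m)) = gcd k (int (p ^ b * m))"
proof (rule gcd_eqI_divisors)
  fix d assume "d dvd p ^ b * m"
  then consider "p ^ Suc r dvd d" | "d dvd p ^ r * m"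
    using dvd_prime_power_mult_cases[OF assms(1)] by blast
  then show "int d dvd k + int (p ^ r * m) \<longleftrightarrow> int d dvd k"
  proof cases
    case 1
    then have "int (p ^ Suc r) dvd int d" by (simp only: of_nat_dvd_iff)
    then have r: "int (p ^ r) dvd int d" by (metis dvd_trans le_imp_power_dvd lessI less_imp_le of_nat_dvd_iff)
    then have "\<not> int d dvd k" using assms(2) dvd_trans by blast
    moreover have "\<not> int d dvd k + int (p ^ r * m)"
    proof
      assume "int d dvd k + int (p ^ r * m)"
      then have "int (p ^ r) dvd k + int (p ^ r * m)" using r dvd_trans by blast
      then show False using assms(2) by (simp add: dvd_add_left_iff)
    qed
    ultimately show ?thesis by blast
  next
    case 2
    then have "int d dvd int (p ^ r * m)" by (simp only: of_nat_dvd_iff)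
    then show ?thesis by (simp only: dvd_add_left_iff)
  qed
qed

text \<open>
The offset changes nothing at the primes dividing \<open>M\<close>, and it alone determines the power of \<open>p\<close>.
\<close>

lemma gcd_offset:
  assumes p: "prime (p :: nat)" and "r < b" and M: "coprime p M"
    and i: "\<not> int p dvd i"
  shows "gcd (int (p ^ b) * k + int (p ^ r * M) * i) (int (p ^ b * M)) = int (p ^ r) * gcd k (int M)"
proof -
  define s where "s = b - Suc r"
  have b: "b = r + Suc s" using assms(2) by (simp add: s_def)
  let ?c = "int (p ^ Suc s) * k + int M * i"
  have "coprime (int p) (int M)" using M by simp
  then have "\<not> int p dvd int M * i"
    using i p by (metis coprime_dvd_mult_right_iff)
  then have "\<not> int p dvd ?c"
    by (simp add: dvd_add_right_iff)
  then have cop: "coprime ?c (int (p ^ Suc s))"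
    using p by (simp add: coprime_commute prime_imp_coprime)
  have "gcd (int (p ^ b) * k + int (p ^ r * M) * i) (int (p ^ b * M)) =
      gcd (int (p ^ r) * ?c) (int (p ^ r) * (int (p ^ Suc s) * int M))"
    by (simp add: b power_add algebra_simps)
  also have "\<dots> = int (p ^ r) * gcd ?c (int (p ^ Suc s) * int M)"
    by (simp only: gcd_mult_left) simp
  also have "gcd ?c (int (p ^ Suc s) * int M) = gcd ?c (int M)"
    using cop by (simp add: gcd_mult_right_left_cancel)
  also have "\<dots> = gcd (int (p ^ Suc s) * k) (int M)"
    by (metis gcd_add_mult gcd.commute add.commute mult.commute)
  also have "\<dots> = gcd k (int M)"
    using M by (intro gcd_mult_left_left_cancel) (simp add: coprime_commute)
  finally show ?thesis .
qed

text \<open>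
Shifting by \<open>p\<^sup>r m\<close> permutes the positions \<open>j\<close> that are dropped on the right. By \<open>gcd_shift\<close> it
preserves \<open>x\<close> there, while it multiplies the character by a constant different from 1. So these
terms add up to 0.
\<close>

lemma coset_sum_eliminate:
  assumes p: "prime (p :: nat)" "coprime p m" "m > 0" and r: "r \<le> b"
    and x: "gcd_invariant (p ^ b * m) x" and k: "int (p ^ b) dvd k"
    and h: "rou (p ^ b * m) (h * int (p ^ r * m)) \<noteq> 1"
  shows "(\<Sum>j | j \<in> {0..<int (p ^ b * m)} \<and> int m dvd j. of_int (x (k + j)) * rou (p ^ b * m) (h * j))
    = (\<Sum>j | j \<in> {0..<int (p ^ b * m)} \<and> int (p ^ r * m) dvd j. of_int (x (k + j)) * rou (p ^ b * m) (h * j))"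
proof -
  let ?f = "\<lambda>j. of_int (x (k + j)) * rou (p ^ b * m) (h * j)"
  let ?J = "{j. j \<in> {0..<int (p ^ b * m)} \<and> int m dvd j}"
  let ?K = "{j. j \<in> {0..<int (p ^ b * m)} \<and> int (p ^ r * m) dvd j}"
  define n where "n = p ^ b * m"
  define s where "s = p ^ r * m"
  have n: "n > 0" using p by (simp add: n_def prime_gt_0_nat)
  have dvd: "m dvd s" "s dvd n"
    using r by (simp_all add: s_def n_def le_imp_power_dvd mult_dvd_mono)
  have mono: "int u dvd i \<longleftrightarrow> int u dvd j" if "u dvd n" "int n dvd i - j" for u i j
  proof -
    have "int u dvd i - j" using that by (meson dvd_trans of_nat_dvd_iff)
    then show ?thesis by (metis dvd_diff_commute dvd_diffD dvd_diffD1 diff_add_cancel dvd_add_right_iff)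
  qed
  define g where "g = (\<lambda>j. if int m dvd j \<and> \<not> int s dvd j then ?f j else 0)"
  have x_per: "periodic n x" using gcd_invariant_imp_periodic[OF x] by (simp add: n_def)
  have g_per: "periodic n g"
  proof (rule periodicI_cong)
    fix i j assume ij: "int n dvd i - j"
    then have "x (k + i) = x (k + j)" by (intro periodic_cong[OF x_per]) simp
    moreover have "rou n (h * i) = rou n (h * j)"
      using ij n by (intro rou_cong) (simp_all flip: right_diff_distrib)
    moreover have "int m dvd i \<longleftrightarrow> int m dvd j" "int s dvd i \<longleftrightarrow> int s dvd j"
      using mono[OF _ ij] dvd dvd_trans by blast+
    ultimately show "g i = g j" by (simp add: g_def n_def)
  qed
  have step: "g (j + int s) = rou n (h * int s) * g j" for j
  proof (cases "int m dvd j \<and> \<not> int s dvd j")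
    case True
    have "\<not> int (p ^ r) dvd k + j"
    proof
      assume "int (p ^ r) dvd k + j"
      moreover have "int (p ^ r) dvd k"
        using k r by (meson dvd_trans le_imp_power_dvd of_nat_dvd_iff)
      ultimately have "int (p ^ r) dvd j" by (simp add: dvd_add_right_iff)
      moreover have "coprime (int (p ^ r)) (int m)" using p by simp
      ultimately have "int (p ^ r) * int m dvd j" using True divides_mult by blast
      then show False using True by (simp add: s_def)
    qed
    then have "x (k + j + int s) = x (k + j)"
      unfolding s_def by (intro gcd_invariantD[OF x] gcd_shift p)
    then show ?thesis
      using True dvd(1) by (simp add: g_def n_def add.assoc distrib_left rou_add dvd_add_left_iff)
  next
    case False
    have "\<not> (int m dvd j + int s \<and> \<not> int s dvd j + int s)"
      using False dvd(1) by (simp add: dvd_add_left_iff)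
    then show ?thesis using False by (simp only: g_def if_False mult_zero_right)
  qed
  have "sum g {0..<int n} = (\<Sum>j\<in>{0..<int n}. g (j + int s))"
    by (rule sum_periodic_shift[OF n g_per, symmetric])
  also have "\<dots> = rou n (h * int s) * sum g {0..<int n}"
    by (simp only: step sum_distrib_left)
  finally have "(1 - rou n (h * int s)) * sum g {0..<int n} = 0" by (simp add: algebra_simps)
  then have "sum g {0..<int n} = 0" using h by (simp add: n_def s_def)
  moreover have "sum g {0..<int n} = sum ?f {j \<in> {0..<int n}. int m dvd j \<and> \<not> int s dvd j}"
    unfolding g_def by (rule sum.inter_filter[symmetric]) simp
  ultimately have z: "sum ?f {j \<in> {0..<int n}. int m dvd j \<and> \<not> int s dvd j} = 0" by simp
  have "?J = {j \<in> {0..<int n}. int m dvd j \<and> \<not> int s dvd j} \<union> ?K"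
    using dvd(1) unfolding n_def s_def by (auto intro: dvd_trans)
  moreover have "sum ?f ({j \<in> {0..<int n}. int m dvd j \<and> \<not> int s dvd j} \<union> ?K) =
     sum ?f {j \<in> {0..<int n}. int m dvd j \<and> \<not> int s dvd j} + sum ?f ?K"
    by (intro sum.union_disjoint)
      (auto intro: finite_subset[of _ "{0..<int n}"] simp: n_def s_def)
  ultimately show ?thesis using z by simp
qed

text \<open>
The constant part \<open>A\<close> of the spectrum contributes a geometric sum, which is \<open>m\<close> if \<open>n | k\<close> and
\<open>0\<close> otherwise. The factor \<open>m\<close> on both sides is then cancelled modulo \<open>q\<close>.
\<close>

lemma coset_congruence:
  assumes N: "N > 0" and m: "m > 0" "coprime N m" and x: "periodic (N * m) x"
    and k: "int N dvd k" and q: "coprime (int m) q" "q \<noteq> 0"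
    and spec: "\<And>l. \<exists>z. ft (N * m) x (h + int N * l) = of_int (A + q * z)"
    and y: "(\<Sum>j | j \<in> {0..<int (N * m)} \<and> int m dvd j. of_int (x (k + j)) * rou (N * m) (h * j)) = of_int y"
  shows "q dvd y - (if int (N * m) dvd k then A else 0)"
proof -
  have n: "N * m > 0" using N m by simp
  from spec obtain z where z: "\<And>l. ft (N * m) x (h + int N * l) = of_int (A + q * z l)"
    by metis
  define \<delta> :: int where "\<delta> = (if int (N * m) dvd k then 1 else 0)"
  define Z where "Z = (\<Sum>l\<in>{0..<int m}. of_int (z l) * rou (N * m) (- (h + int N * l) * k))"
  have "rou (N * m) (- (h + int N * l) * k) = rou (N * m) (- h * k) * rou m (- k * l)" for l
    using rou_add[of "N * m" "- h * k" "int N * (- k * l)"] rou_scale[OF N, of m "- k * l"]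
    by (simp add: algebra_simps)
  then have "(\<Sum>l\<in>{0..<int m}. rou (N * m) (- (h + int N * l) * k))
      = rou (N * m) (- h * k) * (\<Sum>l\<in>{0..<int m}. rou m (- k * l))"
    by (simp only: sum_distrib_left)
  also have "(\<Sum>l\<in>{0..<int m}. rou m (- k * l)) = (if int m dvd k then of_nat m else 0)"
    using sum_rou[OF m(1), of "- k"] by simp
  also have "rou (N * m) (- h * k) * (if int m dvd k then of_nat m else 0) = of_int (int m * \<delta>)"
  proof (cases "int m dvd k")
    case True
    have "coprime (int N) (int m)" using m by simp
    then have "int N * int m dvd k" using True k divides_mult by blast
    then have "int (N * m) dvd k" by simp
    moreover from this have "rou (N * m) (- h * k) = 1" using n rou_eq_1_iff by auto
    ultimately show ?thesis using True by (simp add: \<delta>_def)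
  next
    case False
    then have "\<not> int (N * m) dvd k" by (metis dvd_mult_right of_nat_mult)
    then show ?thesis using False by (simp add: \<delta>_def)
  qed
  finally have geo: "(\<Sum>l\<in>{0..<int m}. rou (N * m) (- (h + int N * l) * k)) = of_int (int m * \<delta>)" .
  have "of_nat m * of_int y = (\<Sum>l\<in>{0..<int m}. of_int (A + q * z l) * rou (N * m) (- (h + int N * l) * k))"
    using coset_inversion[OF N m(1) x, of h k] unfolding y z by simp
  also have "\<dots> = of_int A * (\<Sum>l\<in>{0..<int m}. rou (N * m) (- (h + int N * l) * k)) + of_int q * Z"
    unfolding Z_def sum_distrib_left sum.distrib[symmetric]
    by (intro sum.cong refl) (simp add: algebra_simps)
  finally have "of_int (int m * (y - A * \<delta>)) = of_int q * Z"
    unfolding geo by (simp add: algebra_simps)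
  moreover have "Z \<in> cyc_int (N * m)"
    unfolding Z_def by (intro cyc_int_sum cyc_int_of_int_mult cyc_int_rou n)
  ultimately have "q dvd int m * (y - A * \<delta>)"
    using q(2) by (intro dvd_of_int_eq_cyc_int[OF n])
  then have "q dvd y - A * \<delta>"
    using q(1) by (simp add: coprime_dvd_mult_right_iff coprime_commute)
  then show ?thesis by (auto simp: \<delta>_def split: if_splits)
qed

lemma sum_int_singleton_split:
  fixes f :: "int \<Rightarrow> 'a :: comm_monoid_add"
  assumes "e > 0"
  shows "sum f {0..<int e} = f 0 + sum f {1..<int e}"
proof -
  have "{0..<int e} = insert 0 {1..<int e}" using assms by auto
  then show ?thesis by simp
qed

text \<open>
Take the frequencies that are 1 modulo the full power of \<open>p\<close>. After elimination the positions
\<open>k + i n/p\<close> remain. By \<open>gcd_offset\<close> the function \<open>x\<close> has a single value at those with \<open>0 < i < p\<close>,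
and the characters there are the nontrivial \<open>p\<close>-th roots of unity, with sum \<open>-1\<close>.
\<close>

lemma spectral_congruence_prime:
  assumes p: "prime (p :: nat)" "coprime p m" "m > 0" and n: "n = p ^ Suc r * m"
    and x: "gcd_invariant n x" and g: "g dvd m" and q: "coprime (int m) q" "q \<noteq> 0"
    and spec: "\<And>l. \<exists>z. ft n x (1 + int (p ^ Suc r) * l) = of_int (A + q * z)"
  shows "q dvd x (int (p ^ Suc r * g)) - x (int (p ^ r * g)) - (if g = m then A else 0)"
proof -
  define s where "s = p ^ r * m"
  define k where "k = int (p ^ Suc r * g)"
  have p0: "p > 1" using p prime_gt_1_nat by blast
  have n0: "n > 0" "s > 0" using p0 p(3) by (simp_all add: n s_def)
  have ns: "n = s * p" by (simp add: n s_def mult_ac)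
  have rou_s: "rou n (int s * i) = rou p i" for i
    unfolding ns using n0 by (intro rou_scale)
  have "rou p 1 \<noteq> 1" using p0 rou_eq_1_iff[of p 1] by auto
  then have h: "rou n (1 * int s) \<noteq> 1" using rou_s[of 1] by simp
  have x_off: "x (k + int s * i) = x (int (p ^ r * g))" if "i \<in> {1..<int p}" for i
  proof (rule gcd_invariantD[OF x])
    have "\<not> int p dvd i" using that zdvd_not_zless by auto
    then have "gcd (k + int s * i) (int n) = int (p ^ r * g)"
      using gcd_offset[OF p(1) _ p(2), of r "Suc r" i "int g"] gcd_nat.absorb1[OF g]
      by (simp add: k_def s_def n algebra_simps)
    moreover have "p ^ r * g dvd n"
      using g n by (simp add: mult_dvd_mono)
    then have "gcd (p ^ r * g) n = p ^ r * g" by (rule gcd_nat.absorb1)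
    then have "gcd (int (p ^ r * g)) (int n) = int (p ^ r * g)" by (metis gcd_int_int_eq)
    ultimately show "gcd (k + int s * i) (int n) = gcd (int (p ^ r * g)) (int n)" by simp
  qed
  have "(\<Sum>j | j \<in> {0..<int n} \<and> int m dvd j. of_int (x (k + j)) * rou n (1 * j))
      = (\<Sum>j | j \<in> {0..<int n} \<and> int s dvd j. of_int (x (k + j)) * rou n (1 * j))"
    unfolding n s_def using x p h by (intro coset_sum_eliminate) (auto simp: n s_def k_def)
  also have "\<dots> = (\<Sum>i\<in>{0..<int p}. of_int (x (k + int s * i)) * rou p i)"
    unfolding ns multiples_below[OF n0(2)] using n0(2)
    by (simp add: sum.reindex inj_on_def rou_s flip: ns)
  also have "\<dots> = of_int (x k) + (\<Sum>i\<in>{1..<int p}. of_int (x (k + int s * i)) * rou p i)"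
    using p0 by (subst sum_int_singleton_split) auto
  also have "(\<Sum>i\<in>{1..<int p}. of_int (x (k + int s * i)) * rou p i) =
      of_int (x (int (p ^ r * g))) * (\<Sum>i\<in>{1..<int p}. rou p i)"
    unfolding sum_distrib_left by (intro sum.cong refl) (simp add: x_off)
  also have "(\<Sum>i\<in>{1..<int p}. rou p i) = -1"
    using sum_rou[of p 1] p0 sum_int_singleton_split[of p "rou p"]
    by (simp add: eq_neg_iff_add_eq_0 add.commute)
  finally have "(\<Sum>j | j \<in> {0..<int n} \<and> int m dvd j. of_int (x (k + j)) * rou n (1 * j))
      = of_int (x k - x (int (p ^ r * g)))" by simp
  then have "q dvd (x k - x (int (p ^ r * g))) - (if int (p ^ Suc r * m) dvd k then A else 0)"
    using p p0 x spec q unfolding n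
    by (intro coset_congruence) (auto simp: k_def gcd_invariant_imp_periodic)
  moreover have "int (p ^ Suc r * m) dvd k \<longleftrightarrow> g = m"
  proof -
    have "int (p ^ Suc r * m) dvd k \<longleftrightarrow> m dvd g"
      unfolding k_def of_nat_dvd_iff using p0 by simp
    then show ?thesis using g by (auto intro: dvd_antisym)
  qed
  ultimately show ?thesis by (simp add: k_def)
qed

text \<open>
Take the frequencies that are 2 modulo the full power of 2. After elimination the positions
\<open>k\<close>, \<open>k + n/4\<close>, \<open>k + n/2\<close> and \<open>k + 3n/4\<close> remain, and the character there is \<open>1, -1, 1, -1\<close>.
\<close>

lemma spectral_congruence_quarter:
  assumes m: "odd m" and n: "n = 2 ^ Suc (Suc r) * m"
    and x: "gcd_invariant n x" and g: "g dvd m" and q: "coprime (int m) q" "q \<noteq> 0"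
    and spec: "\<And>l. \<exists>z. ft n x (2 + int (2 ^ Suc (Suc r)) * l) = of_int (A + q * z)"
  shows "q dvd x (int (2 ^ Suc (Suc r) * g)) + x (int (2 ^ Suc r * g)) - 2 * x (int (2 ^ r * g))
    - (if g = m then A else 0)"
proof -
  define s where "s = 2 ^ r * m"
  define k where "k = int (2 ^ Suc (Suc r) * g)"
  have m0: "m > 0" using m by (auto intro: Nat.gr0I)
  have cop: "coprime 2 m" using m by simp
  have n0: "n > 0" "s > 0" using m0 by (simp_all add: n s_def)
  have ns: "n = s * 4" by (simp add: n s_def)
  have rou_s: "rou n (2 * (int s * i)) = rou 2 i" for i
  proof -
    have "rou n (2 * (int s * i)) = rou ((2 * s) * 2) (int (2 * s) * i)"
      by (simp add: ns mult_ac)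
    also have "\<dots> = rou 2 i" using n0 by (intro rou_scale) simp
    finally show ?thesis .
  qed
  have rou2: "rou 2 1 = -1" "rou 2 2 = 1" "rou 2 3 = -1"
  proof -
    show "rou 2 1 = -1" by (simp add: rou_def)
    then show "rou 2 2 = 1" "rou 2 3 = -1"
      using rou_add[of 2 1 1] rou_add[of 2 2 1] by simp_all
  qed
  then have h: "rou n (2 * int s) \<noteq> 1" using rou_s[of 1] by simp
  have div: "gcd (int (2 ^ t * g)) (int n) = int (2 ^ t * g)" if "t \<le> Suc (Suc r)" for t
  proof -
    have "2 ^ t * g dvd n"
      using g that unfolding n by (intro mult_dvd_mono le_imp_power_dvd)
    then have "gcd (2 ^ t * g) n = 2 ^ t * g" by (rule gcd_nat.absorb1)
    then show ?thesis by (metis gcd_int_int_eq)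
  qed
  have x_off: "x (k + int (2 ^ t * m) * i) = x (int (2 ^ t * g))"
    if "t < Suc (Suc r)" "odd i" for t i
  proof (rule gcd_invariantD[OF x])
    have "gcd (k + int (2 ^ t * m) * i) (int n) = int (2 ^ t * g)"
      using gcd_offset[OF two_is_prime_nat that(1) cop, of i "int g"] that(2) gcd_nat.absorb1[OF g]
      by (simp add: k_def n algebra_simps)
    then show "gcd (k + int (2 ^ t * m) * i) (int n) = gcd (int (2 ^ t * g)) (int n)"
      using div that by simp
  qed
  have "(\<Sum>j | j \<in> {0..<int n} \<and> int m dvd j. of_int (x (k + j)) * rou n (2 * j))
      = (\<Sum>j | j \<in> {0..<int n} \<and> int s dvd j. of_int (x (k + j)) * rou n (2 * j))"
    unfolding n s_def using x m0 cop h
    by (intro coset_sum_eliminate) (auto simp: n s_def k_def)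
  also have "\<dots> = (\<Sum>i\<in>{0..<int 4}. of_int (x (k + int s * i)) * rou 2 i)"
    unfolding ns multiples_below[OF n0(2)] using n0(2)
    by (simp add: sum.reindex inj_on_def rou_s flip: ns)
  also have "{0..<int 4} = {0, 1, 2, 3}" by auto
  also have "(\<Sum>i\<in>{0, 1, 2, 3}. of_int (x (k + int s * i)) * rou 2 i) =
    of_int (x k - x (k + int s * 1) + x (k + int s * 2) - x (k + int s * 3))"
    by (simp add: rou2)
  also have "x (k + int s * 1) = x (int (2 ^ r * g))"
    using x_off[of r 1] by (simp add: s_def)
  also have "x (k + int s * 3) = x (int (2 ^ r * g))"
    using x_off[of r 3] by (simp add: s_def)
  also have "x (k + int s * 2) = x (int (2 ^ Suc r * g))"
    using x_off[of "Suc r" 1] by (simp add: s_def mult_ac)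
  finally have "(\<Sum>j | j \<in> {0..<int n} \<and> int m dvd j. of_int (x (k + j)) * rou n (2 * j))
      = of_int (x k + x (int (2 ^ Suc r * g)) - 2 * x (int (2 ^ r * g)))"
    by simp
  then have "q dvd (x k + x (int (2 ^ Suc r * g)) - 2 * x (int (2 ^ r * g)))
      - (if int (2 ^ Suc (Suc r) * m) dvd k then A else 0)"
    using m0 x spec q unfolding n
    by (intro coset_congruence[where h = 2])
      (auto simp: k_def gcd_invariant_imp_periodic m simp del: power_Suc)
  moreover have "int (2 ^ Suc (Suc r) * m) dvd k \<longleftrightarrow> g = m"
  proof -
    have "int (2 ^ Suc (Suc r) * m) dvd k \<longleftrightarrow> m dvd g"
      unfolding k_def of_nat_dvd_iff by simp
    then show ?thesis using g by (auto intro: dvd_antisym)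
  qed
  ultimately show ?thesis by (simp add: k_def)
qed

text \<open>
For \<open>n \<equiv> 2 (mod 4)\<close> there is no position \<open>n/4\<close>, and the even frequencies take over the role of
those that are 2 modulo 4.
\<close>

lemma spectral_congruence_half:
  assumes m: "odd m" and n: "n = 2 * m"
    and x: "gcd_invariant n x" and g: "g dvd m" and q: "coprime (int m) q" "q \<noteq> 0"
    and spec: "\<And>l. \<exists>z. ft n x (2 * l) = of_int (A + q * z)"
  shows "q dvd x (int (2 * g)) + x (int g) - (if g = m then A else 0)"
proof -
  define k where "k = int (2 * g)"
  have m0: "m > 0" using m by (auto intro: Nat.gr0I)
  have cop: "coprime 2 m" using m by simp
  have "gcd (int (2 ^ 1 * g) + int (2 ^ 0 * m) * 1) (int (2 ^ 1 * m)) = int (2 ^ 0 * g)"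
    using gcd_offset[OF two_is_prime_nat _ cop, of 0 1 1 "int g"] gcd_nat.absorb1[OF g]
    by (simp add: algebra_simps)
  moreover have "g dvd n" using g n by simp
  then have "gcd (int g) (int n) = int g" by (metis gcd_int_int_eq gcd_nat.absorb1)
  ultimately have x_off: "x (k + int m) = x (int g)"
    by (intro gcd_invariantD[OF x]) (simp add: n k_def)
  have "(\<Sum>j | j \<in> {0..<int (2 * m)} \<and> int m dvd j. of_int (x (k + j)) * rou (2 * m) (0 * j))
     = (\<Sum>j | j \<in> {0..<int (m * 2)} \<and> int m dvd j. of_int (x (k + j)))"
    by (simp add: mult.commute)
  also have "\<dots> = (\<Sum>i\<in>{0..<int 2}. of_int (x (k + int m * i)))"
    unfolding multiples_below[OF m0] using m0 by (simp add: sum.reindex inj_on_def)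
  also have "{0..<int 2} = {0, 1}" by auto
  also have "(\<Sum>i\<in>{0, 1}. of_int (x (k + int m * i))) = of_int (x k + x (int g))"
    using x_off by simp
  finally have "q dvd (x k + x (int g)) - (if int (2 * m) dvd k then A else 0)"
    using m0 cop x spec q unfolding n
    by (intro coset_congruence[where h = 0 and x = x]) (auto simp: k_def gcd_invariant_imp_periodic)
  moreover have "int (2 * m) dvd k \<longleftrightarrow> g = m"
  proof -
    have "int (2 * m) dvd k \<longleftrightarrow> m dvd g"
      unfolding k_def of_nat_dvd_iff by simp
    then show ?thesis using g by (auto intro: dvd_antisym)
  qed
  ultimately show ?thesis by (simp add: k_def)
qed

section \<open>Alternating spectra: necessary relations\<close>

text \<open>
What an alignment of phases at time \<open>\<pi>x/y\<close> says about the integer spectrum of \<open>x\<close>.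
\<close>

definition alternating_spectrum :: "nat \<Rightarrow> (int \<Rightarrow> int) \<Rightarrow> int \<Rightarrow> int \<Rightarrow> bool" where
  "alternating_spectrum n x K y \<longleftrightarrow>
     (\<forall>h. \<exists>z. ft n x h = of_int (K + (if odd h then y else 0) + 2 * y * z))"

text \<open>
The relations that an alternating spectrum imposes on a function of \<open>gcd(k, n)\<close>, where \<open>n = 2m\<close>
with \<open>m\<close> odd. The positions are the divisors \<open>g\<close> and \<open>2g\<close> of \<open>n\<close>; the position \<open>n/2\<close> is \<open>g = m\<close>.
\<close>

definition half_profile :: "nat \<Rightarrow> (int \<Rightarrow> int) \<Rightarrow> bool" where
  "half_profile m x \<longleftrightarrow> odd (x (int m)) \<and>
     (\<forall>g. g dvd m \<and> g \<noteq> m \<longrightarrow> x (int g) = 0 \<and> x (int (2 * g)) = 0)"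

text \<open>
The same for \<open>n = 2\<^bsup>r+2\<^esup> m\<close> with \<open>m\<close> odd. The positions are the divisors \<open>2\<^sup>r g\<close>, \<open>2\<^bsup>r+1\<^esup> g\<close>
and \<open>2\<^bsup>r+2\<^esup> g\<close>; those with \<open>g = m\<close> are \<open>n/4\<close>, \<open>n/2\<close> and \<open>n\<close>. No relation involves lower powers
of 2.
\<close>

definition quarter_profile :: "nat \<Rightarrow> nat \<Rightarrow> (int \<Rightarrow> int) \<Rightarrow> bool" where
  "quarter_profile r m x \<longleftrightarrow> odd (x (int (2 ^ r * m)) - x (int (2 ^ Suc r * m))) \<and>
     (\<forall>g. g dvd m \<and> g \<noteq> m \<longrightarrow> x (int (2 ^ Suc (Suc r) * g)) = x (int (2 ^ Suc r * g)) \<and>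
        even (x (int (2 ^ Suc (Suc r) * g)) - x (int (2 ^ r * g))))"

text \<open>
The factor \<open>m\<close> in the coset congruences can only be cancelled modulo powers of 2, hence the
restriction to the 2-part of \<open>y\<close>.
\<close>

lemma alternating_spectrum_two_part:
  assumes "alternating_spectrum n x K y" "y > 0"
  obtains e w where "alternating_spectrum n x K (2 ^ e)" "y = 2 ^ e * w" "odd w"
proof -
  obtain w where w: "y = 2 ^ multiplicity 2 y * w" "\<not> 2 dvd w"
    using multiplicity_decompose'[of y 2] assms(2) by auto
  define e where "e = multiplicity 2 y"
  from w(2) obtain v where v: "w = 2 * v + 1" by (auto elim: oddE)
  have yv: "y = 2 ^ e * (2 * v + 1)" using w(1) v by (simp add: e_def)
  have "alternating_spectrum n x K (2 ^ e)"
    unfolding alternating_spectrum_def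
  proof
    fix h
    obtain z where z: "ft n x h = of_int (K + (if odd h then y else 0) + 2 * y * z)"
      using assms(1) unfolding alternating_spectrum_def by blast
    have "K + (if odd h then y else 0) + 2 * y * z =
      K + (if odd h then 2 ^ e else 0) + 2 * 2 ^ e * ((if odd h then v else 0) + w * z)"
      unfolding yv v by (simp add: algebra_simps)
    then show "\<exists>z. ft n x h = of_int (K + (if odd h then 2 ^ e else 0) + 2 * 2 ^ e * z)"
      using z by metis
  qed
  then show ?thesis using that w e_def by auto
qed

lemma alternating_spectrum_odd:
  assumes "alternating_spectrum n x K y" "odd h"
  shows "\<exists>z. ft n x h = of_int (K + y + 2 * y * z)"
  using assms unfolding alternating_spectrum_def by (metis (full_types))

lemma alternating_spectrum_even:
  assumes "alternating_spectrum n x K y" "even h"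
  shows "\<exists>z. ft n x h = of_int (K + 2 * y * z)"
  using assms unfolding alternating_spectrum_def by (metis (full_types) add_0_right)

text \<open>
For \<open>e = 0\<close> parity is violated; for \<open>e \<ge> 2\<close> the hypotheses force \<open>d = 0\<close>, which is absurd.
\<close>

lemma two_power_dvd_double_imp:
  fixes d :: int
  assumes "2 ^ Suc e dvd 2 * d - 2 ^ e" and "e \<ge> 2 \<Longrightarrow> \<bar>d\<bar> \<le> 1"
  shows "e = 1 \<and> odd d"
proof -
  consider "e = 0" | "e = 1" | "e \<ge> 2" by linarith
  then show ?thesis
  proof cases
    case 1
    then have "(2::int) dvd 2 * d - 1" using assms(1) by simp
    then show ?thesis by presburger
  next
    case 2
    then have "(4::int) dvd 2 * d - 2" using assms(1) by simp
    then have "odd d" by presburger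
    then show ?thesis using 2 by simp
  next
    case 3
    have "(2::int) ^ Suc 1 dvd 2 ^ e" using 3 by (intro le_imp_power_dvd) simp
    then have "(4::int) dvd 2 ^ e" by simp
    moreover have "(2::int) ^ Suc 1 dvd 2 ^ Suc e" using 3 by (intro le_imp_power_dvd) simp
    then have "(4::int) dvd 2 * d - 2 ^ e" using assms(1) dvd_trans by auto
    ultimately have "(4::int) dvd 2 * d" by (simp add: dvd_diff_left_iff)
    then have "d = 0" using assms(2)[OF 3] by presburger
    then have "(2::int) ^ Suc e dvd 2 ^ e" using assms(1) by simp
    then show ?thesis by (simp add: power_dvd_imp_le)
  qed
qed

lemma coprime_two_power: "odd m \<Longrightarrow> coprime (int m) (2 ^ e)"
  by simp

text \<open>
The congruences for odd and even frequencies involve the same unknown constant \<open>K\<close>, and only for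
\<open>g = m\<close>. There their difference determines \<open>e\<close>. For \<open>g \<noteq> m\<close> they are congruences modulo 4
between integers of absolute value at most 2.
\<close>

theorem alternating_spectrum_imp_half_profile:
  assumes m: "odd m" and n: "n = 2 * m" and x: "gcd_invariant n x" "\<And>k. \<bar>x k\<bar> \<le> 1"
    and alt: "alternating_spectrum n x K y" "y > 0"
  shows "y mod 4 = 2 \<and> half_profile m x"
proof -
  obtain e w where e: "alternating_spectrum n x K (2 ^ e)" and y: "y = 2 ^ e * w" "odd w"
    using alternating_spectrum_two_part[OF alt] .
  have m0: "m > 0" using m by (auto intro: Nat.gr0I)
  have minus: "2 ^ Suc e dvd x (int (2 * g)) - x (int g) - (if g = m then K + 2 ^ e else 0)"
    if "g dvd m" for g
  proof -
    have "2 ^ Suc e dvd x (int (2 ^ Suc 0 * g)) - x (int (2 ^ 0 * g)) - (if g = m then K + 2 ^ e else 0)"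
    proof (rule spectral_congruence_prime)
      show "\<exists>z. ft n x (1 + int (2 ^ Suc 0) * l) = of_int (K + 2 ^ e + 2 ^ Suc e * z)" for l
        using alternating_spectrum_odd[OF e, of "1 + 2 * l"] by simp
    qed (use m m0 n x that coprime_two_power[OF m, of "Suc e"] in auto)
    then show ?thesis by simp
  qed
  have plus: "2 ^ Suc e dvd x (int (2 * g)) + x (int g) - (if g = m then K else 0)"
    if "g dvd m" for g
  proof (rule spectral_congruence_half)
    show "\<exists>z. ft n x (2 * l) = of_int (K + 2 ^ Suc e * z)" for l
      using alternating_spectrum_even[OF e, of "2 * l"] by simp
  qed (use m m0 n x that coprime_two_power[OF m, of "Suc e"] in auto)
  have "2 ^ Suc e dvd x (int (2 * m)) - x (int m) - (K + 2 ^ e)"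
    "2 ^ Suc e dvd x (int (2 * m)) + x (int m) - K"
    using minus[of m] plus[of m] by simp_all
  then have "2 ^ Suc e dvd (x (int (2 * m)) - x (int m) - (K + 2 ^ e)) - (x (int (2 * m)) + x (int m) - K)"
    by (rule dvd_diff)
  also have "(x (int (2 * m)) - x (int m) - (K + 2 ^ e)) - (x (int (2 * m)) + x (int m) - K)
      = 2 * (- x (int m)) - 2 ^ e" by simp
  finally have "2 ^ Suc e dvd 2 * (- x (int m)) - 2 ^ e" .
  then have e1: "e = 1" and "odd (- x (int m))"
    using two_power_dvd_double_imp[of e "- x (int m)"] x(2)[of "int m"] by auto
  then have "odd (x (int m))" by simp
  moreover have "x (int g) = 0 \<and> x (int (2 * g)) = 0" if "g dvd m" "g \<noteq> m" for g
  proof -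
    have "4 dvd x (int (2 * g)) - x (int g)" "4 dvd x (int (2 * g)) + x (int g)"
      using minus[OF that(1)] plus[OF that(1)] that(2) e1 by simp_all
    then show ?thesis using x(2)[of "int g"] x(2)[of "int (2 * g)"] by presburger
  qed
  moreover have "y = 2 * w" using y e1 by simp
  then have "y mod 4 = 2" using y(2) by presburger
  ultimately show ?thesis unfolding half_profile_def by blast
qed

text \<open>
As in the previous theorem, with the frequencies that are 2 modulo 4 in place of the even ones. A
difference of two values of \<open>x\<close> can be as large as 2, and then \<open>e = 2\<close> is not excluded by
arithmetic, whence the hypothesis \<open>small\<close>.
\<close>

theorem alternating_spectrum_imp_quarter_profile:
  assumes m: "odd m" and n: "n = 2 ^ Suc (Suc r) * m" and x: "gcd_invariant n x" "\<And>k. \<bar>x k\<bar> \<le> 1"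
    and alt: "alternating_spectrum n x K y" "y > 0"
    and small: "4 dvd y \<Longrightarrow> \<bar>x (int (2 ^ r * m)) - x (int (2 ^ Suc r * m))\<bar> \<le> 1"
  shows "y mod 4 = 2 \<and> quarter_profile r m x"
proof -
  obtain e w where e: "alternating_spectrum n x K (2 ^ e)" and y: "y = 2 ^ e * w" "odd w"
    using alternating_spectrum_two_part[OF alt] .
  have m0: "m > 0" using m by (auto intro: Nat.gr0I)
  have minus: "2 ^ Suc e dvd x (int (2 ^ Suc (Suc r) * g)) - x (int (2 ^ Suc r * g))
      - (if g = m then K + 2 ^ e else 0)" if "g dvd m" for g
  proof (rule spectral_congruence_prime)
    show "\<exists>z. ft n x (1 + int (2 ^ Suc (Suc r)) * l) = of_int (K + 2 ^ e + 2 ^ Suc e * z)" for l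
      using alternating_spectrum_odd[OF e, of "1 + int (2 ^ Suc (Suc r)) * l"] by simp
  qed (use m m0 n x that coprime_two_power[OF m, of "Suc e"] in auto)
  have plus: "2 ^ Suc e dvd x (int (2 ^ Suc (Suc r) * g)) + x (int (2 ^ Suc r * g))
      - 2 * x (int (2 ^ r * g)) - (if g = m then K else 0)" if "g dvd m" for g
  proof (rule spectral_congruence_quarter)
    show "\<exists>z. ft n x (2 + int (2 ^ Suc (Suc r)) * l) = of_int (K + 2 ^ Suc e * z)" for l
      using alternating_spectrum_even[OF e, of "2 + int (2 ^ Suc (Suc r)) * l"] by simp
  qed (use m m0 n x that coprime_two_power[OF m, of "Suc e"] in auto)
  define d where "d = x (int (2 ^ r * m)) - x (int (2 ^ Suc r * m))"
  have "2 ^ Suc e dvd x (int (2 ^ Suc (Suc r) * m)) - x (int (2 ^ Suc r * m)) - (K + 2 ^ e)"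
    "2 ^ Suc e dvd x (int (2 ^ Suc (Suc r) * m)) + x (int (2 ^ Suc r * m)) - 2 * x (int (2 ^ r * m)) - K"
    using minus[of m] plus[of m] by simp_all
  then have "2 ^ Suc e dvd (x (int (2 ^ Suc (Suc r) * m)) - x (int (2 ^ Suc r * m)) - (K + 2 ^ e))
      - (x (int (2 ^ Suc (Suc r) * m)) + x (int (2 ^ Suc r * m)) - 2 * x (int (2 ^ r * m)) - K)"
    by (rule dvd_diff)
  also have "(x (int (2 ^ Suc (Suc r) * m)) - x (int (2 ^ Suc r * m)) - (K + 2 ^ e))
      - (x (int (2 ^ Suc (Suc r) * m)) + x (int (2 ^ Suc r * m)) - 2 * x (int (2 ^ r * m)) - K)
      = 2 * d - 2 ^ e" by (simp add: d_def)
  finally have "2 ^ Suc e dvd 2 * d - 2 ^ e" .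
  moreover have "\<bar>d\<bar> \<le> 1" if "e \<ge> 2"
  proof -
    have "(2::int) ^ 2 dvd 2 ^ e" using that by (rule le_imp_power_dvd)
    then have "4 dvd y" using y by simp
    then show ?thesis using small d_def by simp
  qed
  ultimately have e1: "e = 1" and "odd d"
    using two_power_dvd_double_imp[of e d] by auto
  moreover have "x (int (2 ^ Suc (Suc r) * g)) = x (int (2 ^ Suc r * g)) \<and>
      even (x (int (2 ^ Suc (Suc r) * g)) - x (int (2 ^ r * g)))" if "g dvd m" "g \<noteq> m" for g
  proof -
    have "4 dvd x (int (2 ^ Suc (Suc r) * g)) - x (int (2 ^ Suc r * g))"
      "4 dvd x (int (2 ^ Suc (Suc r) * g)) + x (int (2 ^ Suc r * g)) - 2 * x (int (2 ^ r * g))"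
      using minus[OF that(1)] plus[OF that(1)] that(2) e1 by simp_all
    then show ?thesis
      using x(2)[of "int (2 ^ Suc (Suc r) * g)"] x(2)[of "int (2 ^ Suc r * g)"] by presburger
  qed
  moreover have "y = 2 * w" using y e1 by simp
  then have "y mod 4 = 2" using y(2) by presburger
  ultimately show ?thesis unfolding quarter_profile_def d_def by blast
qed

text \<open>
Modulo \<open>p\<close> the spectrum is constant, so \<open>spectral_congruence_prime\<close> compares \<open>x\<close> at two divisors
that differ by a factor \<open>p\<close>, and \<open>p > 2\<close> turns the congruence into an equality.
\<close>

lemma alternating_spectrum_odd_prime:
  assumes p: "prime (p :: nat)" "p \<noteq> 2" "int p dvd y" "p dvd n" "n > 0"
    and x: "gcd_invariant n x" "\<And>k. \<bar>x k\<bar> \<le> 1"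
    and alt: "alternating_spectrum n x K y" and u: "u dvd n" "u \<noteq> n" "\<not> p dvd n div u"
  shows "p dvd u \<and> x (int u) = x (int (u div p))"
proof -
  define b where "b = multiplicity p n"
  obtain M where M: "n = p ^ b * M" "\<not> p dvd M"
    using multiplicity_decompose'[of n p] p b_def by (metis less_irrefl not_prime_unit)
  have "b > 0" using M p(4) by (auto intro: Nat.gr0I)
  then obtain r where r: "b = Suc r" using gr0_implies_Suc by blast
  have cop: "coprime p M" using M p by (simp add: prime_imp_coprime)
  from u(1) obtain v where v: "n = u * v" ..
  then have nv: "n div u = v" using p(5) by auto
  have "coprime (p ^ b) v" using u(3) nv p(1) by (simp add: prime_imp_coprime)
  then have "p ^ b dvd u"
    using M v by (metis coprime_dvd_mult_left_iff dvd_triv_left)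
  then obtain g where g: "u = p ^ Suc r * g" unfolding r ..
  have p0: "p > 2" using p prime_ge_2_nat[of p] by linarith
  have gM: "g dvd M" "g \<noteq> M"
    using M v u(2) g r p0 by auto
  have "int p dvd x (int (p ^ Suc r * g)) - x (int (p ^ r * g)) - (if g = M then K else 0)"
  proof (rule spectral_congruence_prime[OF p(1) cop])
    show "\<exists>z. ft n x (1 + int (p ^ Suc r) * l) = of_int (K + int p * z)" for l
    proof -
      obtain z where "ft n x (1 + int (p ^ Suc r) * l) =
          of_int (K + (if odd (1 + int (p ^ Suc r) * l) then y else 0) + 2 * y * z)"
        using alt unfolding alternating_spectrum_def by blast
      moreover from p(3) obtain c where "y = int p * c" ..
      then have "K + (if odd h then y else 0) + 2 * y * z =
          K + int p * ((if odd h then c else 0) + 2 * c * z)" for h :: int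
        by (simp add: algebra_simps)
      ultimately show ?thesis by metis
    qed
    show "coprime (int M) (int p)" using cop by (simp add: coprime_commute)
  qed (use M p x(1) r gM in auto)
  then have "int p dvd x (int u) - x (int (p ^ r * g))" using gM(2) g by simp
  moreover have "\<bar>x (int u) - x (int (p ^ r * g))\<bar> < int p"
    using x(2)[of "int u"] x(2)[of "int (p ^ r * g)"] p0 by linarith
  ultimately have "x (int u) = x (int (p ^ r * g))"
    using zdvd_not_zless by (metis abs_dvd_iff dvd_abs_iff dvd_imp_le_int eq_iff_diff_eq_0 abs_of_nat not_le)
  moreover have "u div p = p ^ r * g" using g p0 by simp
  ultimately show ?thesis using g by simp
qed

text \<open>
The values at \<open>n/2\<close> and \<open>n/(2p)\<close> would be equal; the first is odd, the second is zero.
\<close>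

lemma half_profile_odd_prime:
  assumes m: "odd m" and n: "n = 2 * m" and x: "gcd_invariant n x" "\<And>k. \<bar>x k\<bar> \<le> 1"
    and alt: "alternating_spectrum n x K y" and prof: "half_profile m x"
    and p: "prime (p :: nat)" "p \<noteq> 2" "p dvd n"
  shows "\<not> int p dvd y"
proof
  assume "int p dvd y"
  have m0: "m > 0" using m by (auto intro: Nat.gr0I)
  have "n div m = 2" using n m0 by simp
  moreover have "\<not> p dvd 2" using p primes_dvd_imp_eq two_is_prime_nat by blast
  ultimately have *: "p dvd m \<and> x (int m) = x (int (m div p))"
    using alternating_spectrum_odd_prime[OF p(1,2) \<open>int p dvd y\<close> p(3) _ x alt, of m] m0 n by simp
  then obtain g where "m = p * g" by blast
  then have "m div p dvd m" "m div p \<noteq> m" using p(1) m0 prime_gt_1_nat[OF p(1)] by auto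
  then have "x (int (m div p)) = 0" using prof unfolding half_profile_def by blast
  then have "x (int m) = 0" using * by simp
  then show False using prof unfolding half_profile_def by simp
qed

text \<open>
The value at \<open>n/2\<close> would equal that at \<open>n/(2p)\<close>, and the value at \<open>n/4\<close> that at \<open>n/(4p)\<close>. The
profile requires different parities of the first and the third of these values, and equal
parities of the other two.
\<close>

lemma quarter_profile_odd_prime:
  assumes m: "odd m" and n: "n = 2 ^ Suc (Suc r) * m"
    and x: "gcd_invariant n x" "\<And>k. \<bar>x k\<bar> \<le> 1"
    and alt: "alternating_spectrum n x K y" and prof: "quarter_profile r m x"
    and p: "prime (p :: nat)" "p \<noteq> 2" "p dvd n"
  shows "\<not> int p dvd y"
proof
  assume y: "int p dvd y"
  have m0: "m > 0" using m by (auto intro: Nat.gr0I)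
  have p2: "\<not> p dvd 2 ^ i" for i
    using p by (meson prime_dvd_power primes_dvd_imp_eq two_is_prime_nat)
  then have "p dvd m" using p n by (metis prime_dvd_mult_iff)
  then obtain g where g: "m = p * g" by blast
  have p1: "p > 1" using prime_gt_1_nat[OF p(1)] .
  have gm: "g dvd m" "g \<noteq> m" using p1 m0 g by auto
  have eq: "x (int (2 ^ t * m)) = x (int (2 ^ t * g))" if "t < Suc (Suc r)" for t
  proof -
    have "n = 2 ^ t * m * 2 ^ (Suc (Suc r) - t)"
      using that unfolding n by (simp flip: power_add)
    then have "n div (2 ^ t * m) = 2 ^ (Suc (Suc r) - t)" "2 ^ t * m dvd n"
      using m0 by (metis nonzero_mult_div_cancel_left mult_eq_0_iff power_eq_0_iff zero_neq_numeral less_irrefl, simp)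
    moreover have "(2::nat) ^ t < 2 ^ Suc (Suc r)" using that by (intro power_strict_increasing) auto
    then have "2 ^ t * m \<noteq> n" using m0 unfolding n by (metis mult_cancel2 less_irrefl)
    ultimately have "x (int (2 ^ t * m)) = x (int (2 ^ t * m div p))"
      using alternating_spectrum_odd_prime[OF p(1,2) y p(3) _ x alt, of "2 ^ t * m"] p2 n m0 by simp
    also have "2 ^ t * m div p = 2 ^ t * g" using g p1 by simp
    finally show ?thesis .
  qed
  have "x (int (2 ^ Suc (Suc r) * g)) = x (int (2 ^ Suc r * g)) \<and>
      even (x (int (2 ^ Suc (Suc r) * g)) - x (int (2 ^ r * g)))"
    using prof gm unfolding quarter_profile_def by blast
  moreover have "odd (x (int (2 ^ r * m)) - x (int (2 ^ Suc r * m)))"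
    using prof unfolding quarter_profile_def by blast
  moreover have "x (int (2 ^ r * m)) = x (int (2 ^ r * g))"
    "x (int (2 ^ Suc r * m)) = x (int (2 ^ Suc r * g))"
    using eq[of r] eq[of "Suc r"] by simp_all
  ultimately show False by presburger
qed

section \<open>Alternating spectra: sufficiency\<close>

lemma rou_half: "rou 2 h = (if even h then 1 else -1)"
proof -
  have "rou 2 (2 * j) = 1" for j by (simp add: rou_eq_1_iff)
  moreover have "rou 2 1 = -1" by (simp add: rou_def)
  ultimately show ?thesis
    by (auto elim!: evenE oddE simp: rou_add)
qed

text \<open>
Every position has this form, so that a gcd-invariant function is given by its values at the
divisors \<open>2\<^sup>i g\<close> with \<open>g | m\<close>.
\<close>

lemma gcd_invariant_dyadic:
  assumes m: "odd m" and n: "n = 2 ^ b * m" and x: "gcd_invariant n x"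
    and i: "i \<le> b" "odd u \<or> i = b"
  shows "x (int (2 ^ i) * u) = x (int (2 ^ i * nat (gcd u (int m))))"
proof -
  have gcd: "gcd (int (2 ^ i) * v) (int n) = int (2 ^ i) * gcd v (int m)" if "odd v \<or> i = b" for v
  proof -
    have "int n = int (2 ^ i) * (2 ^ (b - i) * int m)"
      unfolding n using i(1) by (simp flip: power_add mult.assoc)
    then have "gcd (int (2 ^ i) * v) (int n) = int (2 ^ i) * gcd v (2 ^ (b - i) * int m)"
      by (simp only: gcd_mult_left) simp
    also have "gcd v (2 ^ (b - i) * int m) = gcd v (int m)"
      using that by (intro gcd_mult_right_left_cancel) auto
    finally show ?thesis .
  qed
  have "odd (gcd u (int m))" using m by (meson dvd_trans even_of_nat gcd_dvd2)
  then have "odd (gcd u (int m)) \<or> i = b" ..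
  then have "gcd (int (2 ^ i) * gcd u (int m)) (int n) = gcd (int (2 ^ i) * u) (int n)"
    using gcd gcd[OF i(2)] by simp
  then show ?thesis by (intro gcd_invariantD[OF x]) simp
qed

text \<open>
A position that is not a multiple of \<open>m\<close> has gcd \<open>g\<close> or \<open>2g\<close> with \<open>n\<close>, where \<open>g\<close> is a proper
divisor of \<open>m\<close>.
\<close>

lemma half_profile_eq_0:
  assumes m: "odd m" and n: "n = 2 * m" and x: "gcd_invariant n x" and prof: "half_profile m x"
    and k: "\<not> int m dvd k"
  shows "x k = 0"
proof -
  have n1: "n = 2 ^ 1 * m" using n by simp
  have zero: "x (int (nat (gcd u (int m)))) = 0 \<and> x (int (2 * nat (gcd u (int m)))) = 0" if "u dvd k" for u
  proof -
    have g: "int (nat (gcd u (int m))) = gcd u (int m)" by simp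
    then have "int (nat (gcd u (int m))) dvd int m" by simp
    moreover have "gcd u (int m) dvd k" using that by (rule dvd_trans[OF gcd_dvd1])
    then have "nat (gcd u (int m)) \<noteq> m" using k g by metis
    ultimately show ?thesis
      using prof unfolding half_profile_def of_nat_dvd_iff by blast
  qed
  show ?thesis
  proof (cases "even k")
    case True
    then obtain u where u: "k = 2 * u" ..
    then show ?thesis
      using gcd_invariant_dyadic[OF m n1 x, of 1 u] zero[of u] by simp
  next
    case False
    then show ?thesis
      using gcd_invariant_dyadic[OF m n1 x, of 0 k] zero[of k] by simp
  qed
qed

theorem half_profile_imp_alternating_spectrum:
  assumes m: "odd m" and n: "n = 2 * m" and x: "gcd_invariant n x" and prof: "half_profile m x"
  shows "alternating_spectrum n x (x 0 + x (int m)) 2"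
  unfolding alternating_spectrum_def
proof
  fix h
  have m0: "m > 0" using m by (auto intro: Nat.gr0I)
  have zero: "x k = 0" if "\<not> int m dvd k" for k
    using half_profile_eq_0[OF m n x prof that] .
  have "ft n x h = (\<Sum>k\<in>{0, int m}. of_int (x k) * rou n (h * k))"
    unfolding ft_def
  proof (rule sum.mono_neutral_right)
    show "\<forall>k\<in>{0..<int n} - {0, int m}. of_int (x k) * rou n (h * k) = 0"
    proof
      fix k assume k: "k \<in> {0..<int n} - {0, int m}"
      have "\<not> int m dvd k"
      proof
        assume "int m dvd k"
        then obtain j where j: "k = int m * j" ..
        with k m0 have "0 \<le> j" "j < 2" "j \<noteq> 0" "j \<noteq> 1"
          by (auto simp: n zero_le_mult_iff)
        then show False by simp
      qed
      then show "of_int (x k) * rou n (h * k) = 0" using zero by simp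
    qed
  qed (use m0 n in auto)
  also have "\<dots> = of_int (x 0) + of_int (x (int m)) * rou (m * 2) (int m * h)"
    using m0 by (simp add: n mult.commute)
  also have "\<dots> = of_int (x 0 + x (int m) * (if even h then 1 else -1))"
    unfolding rou_scale[OF m0] rou_half by simp
  finally have ft: "ft n x h = of_int (x 0 + x (int m) * (if even h then 1 else -1))" .
  from prof obtain c where "x (int m) = 2 * c + 1"
    unfolding half_profile_def by (auto elim: oddE)
  then have "x 0 + x (int m) * (if even h then 1 else -1) =
    x 0 + x (int m) + (if odd h then 2 else 0) + 2 * 2 * (if odd h then - c - 1 else 0)" by simp
  then show "\<exists>z. ft n x h = of_int (x 0 + x (int m) + (if odd h then 2 else 0) + 2 * 2 * z)"
    using ft by metis
qed

text \<open>
If \<open>2\<^sup>r\<close> does not divide \<open>k\<close>, a shift by \<open>n/4\<close> preserves the gcd with \<open>n\<close>. Otherwise the orbit of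
\<open>k\<close> under this shift consists of positions \<open>2\<^sup>r w\<close> whose gcds with \<open>n\<close> are among the divisors
\<open>2\<^sup>r g\<close>, \<open>2\<^bsup>r+1\<^esup> g\<close> and \<open>2\<^bsup>r+2\<^esup> g\<close> that the profile relates.
\<close>

lemma quarter_profile_shift:
  assumes m: "odd m" and n: "n = 2 ^ Suc (Suc r) * m" and x: "gcd_invariant n x"
    and prof: "quarter_profile r m x" and k: "\<not> int (2 ^ r * m) dvd k"
  shows "x (k + 2 * int (2 ^ r * m)) = x k" "even (x (k + int (2 ^ r * m)) - x k)"
proof -
  define s where "s = int (2 ^ r * m)"
  have "x (k + 2 * s) = x k \<and> even (x (k + s) - x k)"
  proof (cases "int (2 ^ r) dvd k")
    case False
    have "x (j + s) = x j" if "\<not> int (2 ^ r) dvd j" for j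
      unfolding s_def using gcd_shift[OF two_is_prime_nat, of r j m "Suc (Suc r)"] that
      by (intro gcd_invariantD[OF x]) (simp add: n)
    moreover have "\<not> int (2 ^ r) dvd k + s"
      using False by (simp add: s_def dvd_add_left_iff)
    ultimately have "x (k + s) = x k" "x (k + s + s) = x (k + s)"
      using False by blast+
    then show ?thesis by (simp add: add.assoc)
  next
    case True
    then obtain c where c: "k = int (2 ^ r) * c" ..
    define g where "g = nat (gcd c (int m))"
    have g: "int g = gcd c (int m)" by (simp add: g_def)
    then have "int g dvd int m" by simp
    then have gm: "g dvd m" by (simp only: of_nat_dvd_iff)
    have "g \<noteq> m"
    proof
      assume "g = m"
      then have "int m dvd c" using g by (metis gcd_dvd1)
      then show False using k by (simp add: c)
    qed
    then have prof_g: "x (int (2 ^ Suc (Suc r) * g)) = x (int (2 ^ Suc r * g))"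
      "even (x (int (2 ^ Suc (Suc r) * g)) - x (int (2 ^ r * g)))"
      using prof gm unfolding quarter_profile_def by blast+
    note dyadic = gcd_invariant_dyadic[OF m n x]
    \<comment> \<open>Along the orbit of \<open>k\<close> only the parity of \<open>w = c + j m\<close> matters, and it alternates.\<close>
    have val: "x (int (2 ^ r) * w) = x (int ((if even w then 2 ^ Suc (Suc r) else 2 ^ r) * g))"
      if w: "gcd w (int m) = int g" for w
    proof (cases "even w")
      case True
      then obtain u where u: "w = 2 * u" ..
      have gu: "gcd u (int m) = int g"
        using w m unfolding u by (simp add: gcd_mult_left_left_cancel)
      show ?thesis
      proof (cases "even u")
        case True
        then obtain v where v: "u = 2 * v" ..
        have "gcd v (int m) = int g"
          using gu m unfolding v by (simp add: gcd_mult_left_left_cancel)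
        then show ?thesis using dyadic[of "Suc (Suc r)" v] by (simp add: u v mult_ac)
      next
        case False
        then show ?thesis using dyadic[of "Suc r" u] gu prof_g(1) by (simp add: u mult_ac)
      qed
    next
      case False
      then show ?thesis using dyadic[of r w] w by simp
    qed
    have step: "k + int j * s = int (2 ^ r) * (c + int j * int m)" for j
      by (simp add: c s_def algebra_simps)
    have gcd_step: "gcd (c + int j * int m) (int m) = int g" for j
      unfolding g by (metis gcd_add_mult gcd.commute add.commute mult.commute)
    show ?thesis
      using val[OF gcd_step[of 0]] val[OF gcd_step[of 1]] val[OF gcd_step[of 2]] prof_g(2) m
        step[of 0] step[of 1] step[of 2] by (cases "even c") auto
  qed
  then show "x (k + 2 * int (2 ^ r * m)) = x k" "even (x (k + int (2 ^ r * m)) - x k)"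
    unfolding s_def by simp_all
qed

lemma sum_four_blocks:
  fixes f :: "int \<Rightarrow> 'a :: comm_monoid_add"
  assumes "s \<ge> 0"
  shows "sum f {0..<4 * s} = (\<Sum>k\<in>{0..<s}. f k + f (k + s) + f (k + 2 * s) + f (k + 3 * s))"
proof -
  have shift: "sum f {a..<a + s} = (\<Sum>k\<in>{0..<s}. f (k + a))" for a
    by (rule sum.reindex_bij_witness[of _ "\<lambda>k. k + a" "\<lambda>k. k - a"]) auto
  have "{0..<4 * s} = {0..<0 + s} \<union> {s..<s + s} \<union> {2 * s..<2 * s + s} \<union> {3 * s..<3 * s + s}"
    using assms by auto
  then have "sum f {0..<4 * s} = sum f {0..<0 + s} + sum f {s..<s + s}
      + sum f {2 * s..<2 * s + s} + sum f {3 * s..<3 * s + s}"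
    by (simp only:) (subst sum.union_disjoint; (force simp: add.assoc)?)+
  then show ?thesis unfolding shift by (simp add: sum.distrib add.assoc)
qed

text \<open>
Split the Fourier sum into the orbits of the shift by \<open>n/4\<close>. On the orbit of \<open>k \<noteq> 0\<close> the values of
\<open>x\<close> are \<open>\<alpha>, \<beta>, \<alpha>, \<beta>\<close> with \<open>\<alpha> \<equiv> \<beta> (mod 2)\<close>, and the orbit contributes a multiple of 4 in \<open>\<int>[\<omega>]\<close>.
The orbit of \<open>0\<close> contributes the alternating term. The Fourier transform is an integer by
gcd-invariance, so the congruence descends to \<open>\<int>\<close>.
\<close>

theorem quarter_profile_imp_alternating_spectrum:
  assumes m: "odd m" and n: "n = 2 ^ Suc (Suc r) * m" and x: "gcd_invariant n x"
    and prof: "quarter_profile r m x"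
  shows "alternating_spectrum n x (x 0 + x (int (2 ^ Suc r * m)) + 2 * x (int (2 ^ r * m))) 2"
proof -
  define s where "s = int (2 ^ r * m)"
  have m0: "m > 0" using m by (auto intro: Nat.gr0I)
  have n0: "n > 0" and s0: "s > 0" using m0 by (simp_all add: n s_def)
  have ns: "int n = 4 * s" by (simp add: n s_def)
  have s2: "int (2 ^ Suc r * m) = 2 * s" by (simp add: s_def)
  define K where "K = x 0 + x (2 * s) + 2 * x s"
  have x3: "x (3 * s) = x s"
  proof -
    have "x (3 * s) = x (3 * s - int n)"
      by (rule periodic_cong[OF gcd_invariant_imp_periodic[OF x]]) simp
    also have "\<dots> = x (- s)" by (simp add: ns)
    also have "\<dots> = x s" by (intro gcd_invariantD[OF x]) simp
    finally show ?thesis .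
  qed
  have "\<exists>z. ft n x h = of_int (K + (if odd h then 2 else 0) + 2 * 2 * z)" for h
  proof -
    \<comment> \<open>the factor by which the character changes under the shift by \<open>n/4\<close>\<close>
    define \<iota> where "\<iota> = rou n (h * s)"
    define f where "f = (\<lambda>k. of_int (x k) * rou n (h * k))"
    have rou_n: "rou n (int (2 ^ r * m) * j) = rou 4 j" for j
      using rou_scale[of "2 ^ r * m" 4 j] m0 by (simp add: n mult_ac)
    have i1: "\<iota> = rou 4 h" using rou_n[of h] by (simp add: \<iota>_def s_def mult.commute)
    have "rou 4 (2 * j) = rou 2 j" for j
      using rou_scale[of 2 2 j] by simp
    then have i2: "\<iota> * \<iota> = (if even h then 1 else -1)"
      unfolding i1 rou_add[symmetric] using rou_half[of h] by (metis mult_2)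
    have block: "f k + f (k + s) + f (k + 2 * s) + f (k + 3 * s) =
        rou n (h * k) * (of_int (x k) + of_int (x (k + s)) * \<iota> + of_int (x (k + 2 * s)) * (\<iota> * \<iota>)
          + of_int (x (k + 3 * s)) * (\<iota> * (\<iota> * \<iota>)))" for k
    proof -
      have "rou n (h * (k + s)) = rou n (h * k) * \<iota>"
        "rou n (h * (k + 2 * s)) = rou n (h * k) * (\<iota> * \<iota>)"
        "rou n (h * (k + 3 * s)) = rou n (h * k) * (\<iota> * (\<iota> * \<iota>))"
        unfolding \<iota>_def rou_add[symmetric] by (simp_all add: algebra_simps)
      then show ?thesis unfolding f_def by (simp add: algebra_simps)
    qed
    have rest: "\<exists>Z\<in>cyc_int n. f k + f (k + s) + f (k + 2 * s) + f (k + 3 * s) = 4 * Z"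
      if k: "k \<in> {1..<s}" for k
    proof -
      have nd: "\<not> s dvd k" using k zdvd_not_zless by auto
      then have nd': "\<not> s dvd k + s" by simp
      have a: "x (k + 2 * s) = x k" and "even (x (k + s) - x k)"
        using quarter_profile_shift[OF m n x prof, of k] nd by (simp_all add: s_def)
      then obtain c where c: "x (k + s) = x k + 2 * c" by (metis add.commute diff_add_cancel evenE)
      have "x (k + s + 2 * s) = x (k + s)"
        using quarter_profile_shift(1)[OF m n x prof, of "k + s"] nd' by (simp add: s_def)
      then have b: "x (k + 3 * s) = x k + 2 * c" using c by (simp add: add.assoc)
      have "f k + f (k + s) + f (k + 2 * s) + f (k + 3 * s) =
          rou n (h * k) * (1 + \<iota> * \<iota>) * (of_int (x k) + of_int (x k + 2 * c) * \<iota>)"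
        unfolding block a b c by (simp add: algebra_simps)
      also have "\<dots> = 4 * ((if even h then of_int (if \<iota> = 1 then x k + c else - c) else 0) * rou n (h * k))"
      proof (cases "even h")
        case True
        then have "\<iota> * \<iota> = 1" using i2 by simp
        then have "\<iota> = 1 \<or> \<iota> = -1" by (simp add: square_eq_1_iff)
        then show ?thesis using True by (auto simp: algebra_simps)
      next
        case False
        then show ?thesis using i2 by simp
      qed
      finally show ?thesis
        using cyc_int_of_int_mult[OF cyc_int_rou[OF n0], of "if \<iota> = 1 then x k + c else - c" "h * k"]
        by (intro bexI[of _ "(if even h then of_int (if \<iota> = 1 then x k + c else - c) else 0) * rou n (h * k)"])
          (simp_all only: if_True if_False mult_zero_left cyc_int_0 simp_thms split: if_split)
    qed
    have zero: "\<exists>z. f 0 + f (0 + s) + f (0 + 2 * s) + f (0 + 3 * s) =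
        of_int (K + (if odd h then 2 else 0) + 4 * z)"
    proof -
      have "odd (x s - x (2 * s))"
        using prof unfolding quarter_profile_def s_def by (simp add: mult.assoc)
      then obtain c where c: "x s - x (2 * s) = 2 * c + 1" by (rule oddE)
      have val: "f 0 + f (0 + s) + f (0 + 2 * s) + f (0 + 3 * s) =
          of_int (x 0) + of_int (x s) * (\<iota> * (1 + \<iota> * \<iota>)) + of_int (x (2 * s)) * (\<iota> * \<iota>)"
        unfolding block by (simp only: add_0 x3) (simp add: algebra_simps)
      show ?thesis
      proof (cases "even h")
        case True
        then have ii: "\<iota> * \<iota> = 1" using i2 by simp
        then have "\<iota> = 1 \<or> \<iota> = -1" by (simp add: square_eq_1_iff)
        then have "f 0 + f (0 + s) + f (0 + 2 * s) + f (0 + 3 * s) =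
          of_int (K + (if odd h then 2 else 0) + 4 * (if \<iota> = 1 then 0 else - x s))"
          using True unfolding val ii K_def by auto
        then show ?thesis by blast
      next
        case False
        then have ii: "\<iota> * \<iota> = -1" using i2 by simp
        have "x (2 * s) = x s - 2 * c - 1" using c by simp
        then have "f 0 + f (0 + s) + f (0 + 2 * s) + f (0 + 3 * s) =
          of_int (K + (if odd h then 2 else 0) + 4 * (c - x s))"
          using False unfolding val ii K_def by simp
        then show ?thesis by blast
      qed
    qed
    then obtain z0 where z0: "f 0 + f (0 + s) + f (0 + 2 * s) + f (0 + 3 * s) =
        of_int (K + (if odd h then 2 else 0) + 4 * z0)" by blast
    from rest obtain Z where Z: "\<And>k. k \<in> {1..<s} \<Longrightarrow> Z k \<in> cyc_int n"
      "\<And>k. k \<in> {1..<s} \<Longrightarrow> f k + f (k + s) + f (k + 2 * s) + f (k + 3 * s) = 4 * Z k"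
      by metis
    have "ft n x h = (\<Sum>k\<in>{0..<s}. f k + f (k + s) + f (k + 2 * s) + f (k + 3 * s))"
      unfolding ft_def ns using s0 by (simp add: sum_four_blocks f_def)
    also have "{0..<s} = insert 0 {1..<s}" using s0 by auto
    also have "(\<Sum>k\<in>insert 0 {1..<s}. f k + f (k + s) + f (k + 2 * s) + f (k + 3 * s)) =
        of_int (K + (if odd h then 2 else 0) + 4 * z0) + 4 * sum Z {1..<s}"
      by (simp only: sum_distrib_left) (subst sum.insert, auto simp: Z(2) z0[simplified])
    finally have ft: "ft n x h = of_int (K + (if odd h then 2 else 0) + 4 * z0) + 4 * sum Z {1..<s}" .
    obtain F where F: "ft n x h = of_int F"
      using gcd_invariant_imp_integral_spectrum[OF n0 x] Ints_cases by metis
    have "of_int (F - (K + (if odd h then 2 else 0) + 4 * z0)) = of_int 4 * sum Z {1..<s}"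
      using ft F by (simp add: algebra_simps)
    then have "4 dvd F - (K + (if odd h then 2 else 0) + 4 * z0)"
      using Z(1) by (intro dvd_of_int_eq_cyc_int[OF n0]) (auto intro: cyc_int_sum)
    then obtain w where "F - (K + (if odd h then 2 else 0) + 4 * z0) = 4 * w" ..
    then have "F = K + (if odd h then 2 else 0) + 2 * 2 * (z0 + w)" by simp
    then show ?thesis using F by blast
  qed
  then show ?thesis
    unfolding alternating_spectrum_def s2 K_def s_def[symmetric] by blast
qed

section \<open>Alignment of phases\<close>

lemma ft_diff: "ft n (\<lambda>k. c k - s k) h = ft n c h - ft n s h"
  unfolding ft_def by (simp add: sum_subtractf algebra_simps)

lemma ft_uminus:
  assumes "n > 0" "periodic n c" "\<And>k. c (- k) = c k"
  shows "ft n c (- h) = ft n c h"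
proof -
  have "ft n c h = (\<Sum>k\<in>{0..<int n}. of_int (c (- k)) * rou n (h * (- k)))"
    unfolding ft_def by (rule sum_periodic_uminus[symmetric, OF assms(1) periodic_ft_summand[OF assms(1,2)]])
  then show ?thesis unfolding ft_def by (simp add: assms(3))
qed

lemma ft_Reals:
  assumes "n > 0" "periodic n c" "\<And>k. c (- k) = c k"
  shows "ft n c h \<in> \<real>"
proof -
  have "cnj (ft n c h) = ft n c (- h)"
    unfolding ft_def by (simp add: cnj_sum cnj_rou)
  then show ?thesis using ft_uminus[OF assms] Reals_cnj_iff by metis
qed

text \<open>
The form of the indicator function of \<open>S\<^sub>1\<close>, whose period is 2.
\<close>

definition parity_fun :: "int \<Rightarrow> int \<Rightarrow> int \<Rightarrow> int" where
  "parity_fun s0 s1 k = (if even k then s0 else s1)"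

lemma gcd_invariant_parity_fun:
  assumes "even n"
  shows "gcd_invariant n (parity_fun s0 s1)"
  unfolding gcd_invariant_def
proof (intro allI impI)
  fix j k assume "gcd j (int n) = gcd k (int n)"
  moreover have "even i \<longleftrightarrow> even (gcd i (int n))" for i
    using assms by (metis dvd_trans even_of_nat gcd_dvd1 gcd_greatest)
  ultimately have "even j \<longleftrightarrow> even k" by metis
  then show "parity_fun s0 s1 j = parity_fun s0 s1 k" by (simp add: parity_fun_def)
qed

lemma sum_even_odd:
  fixes f :: "int \<Rightarrow> 'a :: comm_monoid_add"
  shows "sum f {0..<int (2 * N)} = (\<Sum>i\<in>{0..<int N}. f (2 * i) + f (2 * i + 1))"
proof (induction N)
  case (Suc N)
  have "{0..<int (2 * Suc N)} = insert (2 * int N + 1) (insert (2 * int N) {0..<int (2 * N)})"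
    "{0..<int (Suc N)} = insert (int N) {0..<int N}" by auto
  then show ?case using Suc by (simp add: add_ac)
qed simp

text \<open>
The Fourier transform of \<open>parity_fun s0 s1\<close> on \<open>\<int>/(2N)\<close>; it lives on the frequencies \<open>0\<close> and \<open>N\<close>.
\<close>

definition parity_ft :: "nat \<Rightarrow> int \<Rightarrow> int \<Rightarrow> int \<Rightarrow> int" where
  "parity_ft N s0 s1 h =
     (if int N dvd h then int N * (s0 + (if even (h div int N) then s1 else - s1)) else 0)"

lemma ft_parity_fun:
  assumes "N > 0"
  shows "ft (2 * N) (parity_fun s0 s1) h = of_int (parity_ft N s0 s1 h)"
proof -
  have "rou (2 * N) (h * (2 * i)) = rou N (h * i)" for i
    using rou_scale[of 2 N "h * i"] by (simp add: mult.left_commute)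
  moreover have "rou (2 * N) (h * (2 * i + 1)) = rou (2 * N) h * rou (2 * N) (h * (2 * i))" for i
    unfolding rou_add[symmetric] by (simp add: algebra_simps)
  ultimately have "ft (2 * N) (parity_fun s0 s1) h =
      (\<Sum>i\<in>{0..<int N}. (of_int s0 + of_int s1 * rou (2 * N) h) * rou N (h * i))"
    unfolding ft_def sum_even_odd by (simp add: parity_fun_def algebra_simps)
  also have "\<dots> = (of_int s0 + of_int s1 * rou (2 * N) h) * (if int N dvd h then of_nat N else 0)"
    by (simp only: sum_distrib_left[symmetric] sum_rou[OF assms])
  also have "\<dots> = of_int (parity_ft N s0 s1 h)"
  proof (cases "int N dvd h")
    case True
    then obtain j where j: "h = int N * j" ..
    then have "rou (2 * N) h = rou 2 j"
      using rou_scale[OF assms, of 2 j] by (simp add: mult.commute)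
    moreover have "h div int N = j" using j assms by simp
    ultimately show ?thesis using True by (simp add: parity_ft_def rou_half algebra_simps)
  qed (simp add: parity_ft_def)
  finally show ?thesis .
qed

text \<open>
The eigenvalues of the Cayley graph are \<open>ft n c h + \<sigma> * ft n s h\<close>. They are real for even \<open>c\<close> and
\<open>s\<close>, and the real part only changes the type.
\<close>

definition phase_alignment :: "nat \<Rightarrow> (int \<Rightarrow> int) \<Rightarrow> (int \<Rightarrow> int) \<Rightarrow> real \<Rightarrow> bool" where
  "phase_alignment n c s t \<longleftrightarrow> (\<forall>h. \<forall>\<sigma>\<in>{1, -1}.
     cis (t * (Re (ft n c h) + \<sigma> * Re (ft n s h) - (Re (ft n c 0) + Re (ft n s 0)))) =
       (if even h then 1 else -1))"

definition pst_profile :: "nat \<Rightarrow> (int \<Rightarrow> int) \<Rightarrow> int \<Rightarrow> int \<Rightarrow> bool" where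
  "pst_profile n c s0 s1 \<longleftrightarrow> gcd_invariant n c \<and>
     ((\<exists>m. odd m \<and> n = 2 * m \<and> s0 = 1 \<and> s1 = 1 \<and>
         half_profile m (\<lambda>k. c k - parity_fun s0 s1 k)) \<or>
      (\<exists>r m. odd m \<and> n = 2 ^ Suc (Suc r) * m \<and>
         quarter_profile r m (\<lambda>k. c k - parity_fun s0 s1 k)))"

lemma cis_sign_imp_int_multiple:
  assumes "cis \<theta> = (if even (h :: int) then 1 else -1)"
  obtains w :: int where "\<theta> = pi * of_int w" "even w \<longleftrightarrow> even h"
proof (cases "even h")
  case True
  then have "cos \<theta> = 1" using assms by (metis cis.simps(1) one_complex.simps(1))
  then obtain z :: int where "\<theta> = of_int z * 2 * pi" using cos_one_2pi_int by auto
  then show ?thesis using True that[of "2 * z"] by simp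
next
  case False
  then have "cis (\<theta> + pi) = 1" using assms by (simp flip: cis_mult)
  then have "cos (\<theta> + pi) = 1" by (metis cis.simps(1) one_complex.simps(1))
  then obtain z :: int where "\<theta> + pi = of_int z * 2 * pi" using cos_one_2pi_int by blast
  then have "\<theta> = pi * of_int (2 * z - 1)" by (simp add: algebra_simps)
  then show ?thesis using False that[of "2 * z - 1"] by simp
qed

lemma gcd_invariant_diff:
  assumes "gcd_invariant n c" "gcd_invariant n s"
  shows "gcd_invariant n (\<lambda>k. c k - s k :: int)"
  using assms unfolding gcd_invariant_def by metis

text \<open>
The two signs at \<open>h = 0\<close> show that \<open>t/\<pi>\<close> is rational. So all eigenvalues are rational, and being
cyclotomic integers they are integers. If \<open>t/\<pi> = x/d\<close> in lowest terms, then \<open>d\<close> divides every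
difference of eigenvalues, and \<open>x\<close> is odd since the frequency \<open>h = 1\<close> has an odd phase; therefore
the quotient of the difference by \<open>d\<close> has the parity of \<open>h\<close>.
\<close>

lemma phase_alignment_imp_alternating_spectrum:
  assumes N: "N > 0" and n: "n = 2 * N"
    and c: "periodic n c" "\<And>k. c k \<in> {0, 1}" "\<And>k. c (- k) = c k"
    and s01: "s0 + s1 > 0"
    and al: "phase_alignment n c (parity_fun s0 s1) t" "t \<ge> 0"
  obtains K y :: int and x :: nat where "gcd_invariant n c" "y > 0" "x > 0" "t = pi * x / y"
    "alternating_spectrum n (\<lambda>k. c k - parity_fun s0 s1 k) K y"
    "\<And>h. y dvd parity_ft N s0 s1 h"
proof -
  define S where "S = parity_ft N s0 s1"
  have n0: "n > 0" using N n by simp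
  have Sft: "ft n (parity_fun s0 s1) h = of_int (S h)" for h
    unfolding n S_def by (rule ft_parity_fun[OF N])
  have S0: "S 0 > 0" using N s01 by (simp add: S_def parity_ft_def)
  define C where "C = (\<lambda>h. Re (ft n c h))"
  have Cft: "ft n c h = of_real (C h)" for h
    using ft_Reals[OF n0 c(1,3)] unfolding C_def by (simp add: of_real_Re)
  have "\<exists>w. t * (C h + \<sigma> * of_int (S h) - (C 0 + of_int (S 0))) = pi * of_int w \<and> (even w \<longleftrightarrow> even h)"
    if "\<sigma> \<in> {1, -1}" for h \<sigma>
  proof -
    have "cis (t * (C h + \<sigma> * of_int (S h) - (C 0 + of_int (S 0)))) = (if even h then 1 else -1)"
      using al(1) that unfolding phase_alignment_def Sft C_def by auto
    then show ?thesis by (rule cis_sign_imp_int_multiple) blast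
  qed
  then have W_ex: "\<exists>W. \<forall>h. \<forall>\<sigma>\<in>{1, -1}. t * (C h + \<sigma> * of_int (S h) - (C 0 + of_int (S 0))) = pi * of_int (W h \<sigma>) \<and>
      (even (W h \<sigma>) \<longleftrightarrow> even h)"
    by (intro choice allI bchoice ballI)
  then obtain W where W: "\<And>h \<sigma>. \<sigma> \<in> {1, -1} \<Longrightarrow>
      t * (C h + \<sigma> * of_int (S h) - (C 0 + of_int (S 0))) = pi * of_int (W h \<sigma>)"
    "\<And>h \<sigma>. \<sigma> \<in> {1, -1} \<Longrightarrow> even (W h \<sigma>) \<longleftrightarrow> even h"
    by blast
  have "t \<noteq> 0"
  proof
    assume "t = 0"
    then have "W 1 1 = 0" using W(1)[of 1 1] by simp
    then show False using W(2)[of 1 1] by simp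
  qed
  define \<tau> where "\<tau> = t / pi"
  have \<tau>0: "\<tau> > 0" using \<open>t \<noteq> 0\<close> al(2) by (simp add: \<tau>_def)
  have W': "\<tau> * (C h + \<sigma> * of_int (S h) - (C 0 + of_int (S 0))) = of_int (W h \<sigma>)"
    if "\<sigma> \<in> {1, -1}" for h \<sigma>
    using W(1)[OF that, of h] by (simp add: \<tau>_def field_simps)
  have "\<tau> * (- 2 * of_int (S 0)) = of_int (W 0 (-1))" using W'[of "-1" 0] by simp
  then have "\<tau> = of_int (W 0 (-1)) / (- 2 * of_int (S 0))" using S0 by (simp add: field_simps)
  then have "\<tau> \<in> \<rat>" by simp
  have int_C0: "C 0 \<in> \<int>" by (auto simp: C_def ft_def intro!: Ints_sum)
  have "ft n c h \<in> \<int>" for h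
  proof -
    have "C h = of_int (W h 1) / \<tau> - of_int (S h) + (C 0 + of_int (S 0))"
      using W'[of 1 h] \<tau>0 by (simp add: field_simps)
    moreover have "\<dots> \<in> \<rat>" using \<open>\<tau> \<in> \<rat>\<close> int_C0 Ints_subset_Rats by auto
    ultimately have "C h \<in> \<rat>" by simp
    then obtain i j :: int where "C h = of_int i / of_int j" by (auto simp: Rats_eq_int_div_int)
    then have "ft n c h = of_int i / of_int j" unfolding Cft by simp
    then have "ft n c h \<in> \<rat>" by simp
    then show ?thesis
      using rational_algebraic_int_is_int algebraic_int_cyc_int[OF n0 cyc_int_ft[OF n0]] by blast
  qed
  then have inv: "gcd_invariant n c"
    using integral_spectrum_imp_gcd_invariant[OF n0 c(1,2)] by blast
  have "\<exists>z. C h = of_int z" for h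
    using \<open>ft n c h \<in> \<int>\<close> unfolding C_def by (auto elim!: Ints_cases)
  then obtain Z where Z: "\<And>h. C h = of_int (Z h)" by metis
  obtain x d :: nat where xd: "d \<noteq> 0" "\<tau> = real x / real d" "coprime x d"
    using Rats_abs_nat_div_natE[OF \<open>\<tau> \<in> \<rat>\<close>] \<tau>0 by (metis abs_of_pos)
  then have x0: "x > 0" using \<tau>0 by (auto intro: Nat.gr0I)
  define M where "M = (\<lambda>h \<sigma>. Z h + \<sigma> * S h - (Z 0 + S 0))"
  have factor: "\<exists>v. M h \<sigma> = int d * v \<and> W h (of_int \<sigma>) = int x * v" if "\<sigma> \<in> {1, -1}" for h \<sigma>
  proof -
    have "real_of_int \<sigma> \<in> {1, -1}" using that by auto
    then have "of_nat x * of_int (M h \<sigma>) = (of_nat d * of_int (W h (of_int \<sigma>)) :: real)"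
      using W'[of "of_int \<sigma>" h] xd by (simp add: Z M_def field_simps)
    then have "of_int (int x * M h \<sigma>) = (of_int (int d * W h (of_int \<sigma>)) :: real)" by simp
    then have eq: "int x * M h \<sigma> = int d * W h (of_int \<sigma>)" by (simp only: of_int_eq_iff)
    then have "int d dvd int x * M h \<sigma>" by simp
    then have "int d dvd M h \<sigma>"
      using xd(3) by (simp add: coprime_dvd_mult_right_iff coprime_commute)
    then obtain v where "M h \<sigma> = int d * v" ..
    moreover from this have "W h (of_int \<sigma>) = int x * v" using eq xd(1) by simp
    ultimately show ?thesis by blast
  qed
  have "odd (int x)" using factor[of 1 1] W(2)[of 1 1] by auto
  have "\<exists>v. M h \<sigma> = int d * v \<and> (even v \<longleftrightarrow> even h)" if \<sigma>: "\<sigma> \<in> {1, -1}" for h \<sigma>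
  proof -
    obtain v where v: "M h \<sigma> = int d * v" "W h (of_int \<sigma>) = int x * v"
      using factor[OF \<sigma>, of h] by blast
    have "real_of_int \<sigma> \<in> {1, -1}" using \<sigma> by auto
    then have "even (int x * v) \<longleftrightarrow> even h" using W(2)[of "of_int \<sigma>" h] v(2) by simp
    then have "even v \<longleftrightarrow> even h" using \<open>odd (int x)\<close> by simp
    then show ?thesis using v(1) by blast
  qed
  then have "\<exists>V. \<forall>h. \<forall>\<sigma>\<in>{1, -1}. M h \<sigma> = int d * V h \<sigma> \<and> (even (V h \<sigma>) \<longleftrightarrow> even h)"
    by (intro choice allI bchoice ballI)
  then obtain V where V: "\<And>h \<sigma>. \<sigma> \<in> {1, -1} \<Longrightarrow> M h \<sigma> = int d * V h \<sigma>"
    "\<And>h \<sigma>. \<sigma> \<in> {1, -1} \<Longrightarrow> even (V h \<sigma>) \<longleftrightarrow> even h" by blast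
  have alt: "alternating_spectrum n (\<lambda>k. c k - parity_fun s0 s1 k) (Z 0 + S 0) (int d)"
    unfolding alternating_spectrum_def
  proof
    fix h
    have "even (V h (-1) - (if odd h then 1 else 0))" using V(2)[of "-1" h] by auto
    then obtain z where "V h (-1) - (if odd h then 1 else 0) = 2 * z" by (rule evenE)
    then have z: "V h (-1) = (if odd h then 1 else 0) + 2 * z" by linarith
    have "Z h - S h = Z 0 + S 0 + int d * V h (-1)" using V(1)[of "-1" h] by (simp add: M_def)
    also have "\<dots> = Z 0 + S 0 + (if odd h then int d else 0) + 2 * int d * z"
      unfolding z by (simp add: algebra_simps)
    finally have "ft n (\<lambda>k. c k - parity_fun s0 s1 k) h =
        of_int (Z 0 + S 0 + (if odd h then int d else 0) + 2 * int d * z)"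
      unfolding ft_diff Sft Cft Z by (metis of_int_diff of_real_of_int_eq)
    then show "\<exists>z. ft n (\<lambda>k. c k - parity_fun s0 s1 k) h =
        of_int (Z 0 + S 0 + (if odd h then int d else 0) + 2 * int d * z)" by blast
  qed
  have dvd: "int d dvd S h" for h
  proof -
    have "2 * S h = int d * (V h 1 - V h (-1))"
      using V(1)[of 1 h] V(1)[of "-1" h] by (simp add: M_def algebra_simps)
    moreover have "even (V h 1 - V h (-1))" using V(2)[of 1 h] V(2)[of "-1" h] by simp
    then obtain z where "V h 1 - V h (-1) = 2 * z" ..
    ultimately have "S h = int d * z" by simp
    then show ?thesis by simp
  qed
  have "t = pi * real x / real_of_int (int d)"
    using xd(2) by (simp add: \<tau>_def field_simps)
  then show ?thesis
    using that[OF inv _ x0 _ alt] dvd xd(1) S_def by auto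
qed

text \<open>
The number \<open>y\<close> divides \<open>|S\<^sub>1| = N(s0 + s1)\<close>. This rules out a half class of reflections for
\<open>n \<equiv> 2 (mod 4)\<close>, it supplies the hypothesis \<open>small\<close> for \<open>4 | n\<close>, and it shows that an odd prime
divisor of \<open>y\<close> divides \<open>n\<close>.
\<close>

theorem phase_alignment_imp_pst_profile:
  assumes "n > 0" "even n"
    and c: "periodic n c" "\<And>k. c k \<in> {0, 1}" "\<And>k. c (- k) = c k"
    and s01: "s0 \<in> {0, 1}" "s1 \<in> {0, 1}" "s0 + s1 > 0"
    and al: "phase_alignment n c (parity_fun s0 s1) t" "t \<ge> 0"
  shows "pst_profile n c s0 s1 \<and> pi / 2 \<le> t"
proof -
  define N where "N = n div 2"
  have N: "N > 0" "n = 2 * N" using assms(1,2) by (auto simp: N_def)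
  obtain K y :: int and x :: nat where inv: "gcd_invariant n c" and y: "y > 0" and x: "x > 0"
    and t: "t = pi * x / y" and alt: "alternating_spectrum n (\<lambda>k. c k - parity_fun s0 s1 k) K y"
    and dvd: "\<And>h. y dvd parity_ft N s0 s1 h"
    using phase_alignment_imp_alternating_spectrum[OF N c s01(3) al] by blast
  define X where "X = (\<lambda>k. c k - parity_fun s0 s1 k)"
  have X: "gcd_invariant n X" "\<And>k. \<bar>X k\<bar> \<le> 1"
  proof -
    show "gcd_invariant n X"
      unfolding X_def using inv gcd_invariant_parity_fun[OF assms(2)] by (rule gcd_invariant_diff)
    show "\<bar>X k\<bar> \<le> 1" for k
      using c(2)[of k] s01(1,2) by (auto simp: X_def parity_fun_def)
  qed
  have alt: "alternating_spectrum n X K y" using alt X_def by simp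
  have dvd0: "y dvd int N * (s0 + s1)" using dvd[of 0] by (simp add: parity_ft_def)
  define r where "r = multiplicity 2 n"
  obtain m where m: "n = 2 ^ r * m" "odd m"
    using multiplicity_decompose'[of n 2] assms(1) r_def by auto
  have "r \<noteq> 0" using m assms(2) by (metis mult_1 power_0)
  have m0: "m > 0" using m(2) by (auto intro: Nat.gr0I)
  have prof: "y mod 4 = 2 \<and> pst_profile n c s0 s1 \<and>
      (\<forall>p. prime p \<and> p \<noteq> 2 \<and> p dvd n \<longrightarrow> \<not> int p dvd y)"
  proof (cases "r = 1")
    case True
    then have n: "n = 2 * m" using m by simp
    then have "N = m" using N by simp
    have y4: "y mod 4 = 2" and half: "half_profile m X"
      using alternating_spectrum_imp_half_profile[OF m(2) n X alt y] by auto
    then have "even y" by presburger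
    then have "even (int N * (s0 + s1))" using dvd0 dvd_trans by blast
    then have "s0 = 1" "s1 = 1" using s01 m(2) \<open>N = m\<close> by auto
    then have "pst_profile n c s0 s1"
      unfolding pst_profile_def using inv n m(2) half X_def by auto
    moreover have "\<forall>p. prime p \<and> p \<noteq> 2 \<and> p dvd n \<longrightarrow> \<not> int p dvd y"
      using half_profile_odd_prime[OF m(2) n X alt half] by blast
    ultimately show ?thesis using y4 by blast
  next
    case False
    then obtain r' where "r = Suc (Suc r')" using \<open>r \<noteq> 0\<close>
      by (metis One_nat_def not0_implies_Suc)
    then have n: "n = 2 ^ Suc (Suc r') * m" using m by simp
    then have Nm: "N = 2 ^ Suc r' * m" using N by simp
    have small: "\<bar>X (int (2 ^ r' * m)) - X (int (2 ^ Suc r' * m))\<bar> \<le> 1" if "4 dvd y"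
    proof -
      have "parity_fun s0 s1 (int (2 ^ r' * m)) = parity_fun s0 s1 (int (2 ^ Suc r' * m))"
      proof (cases "r' = 0")
        case True
        have "4 dvd int N * (s0 + s1)" using dvd0 that dvd_trans by blast
        then have "4 dvd 2 * (int m * (s0 + s1))" by (simp add: Nm True mult.assoc)
        moreover have "even u" if "4 dvd 2 * u" for u :: int using that by presburger
        ultimately have "even (int m * (s0 + s1))" by blast
        then have "s0 = 1" "s1 = 1" using s01 m(2) by auto
        then show ?thesis by (simp add: parity_fun_def)
      next
        case False
        then show ?thesis by (simp add: parity_fun_def)
      qed
      then show ?thesis
        using c(2)[of "int (2 ^ r' * m)"] c(2)[of "int (2 ^ Suc r' * m)"] unfolding X_def by auto
    qed
    have y4: "y mod 4 = 2" and quarter: "quarter_profile r' m X"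
      using alternating_spectrum_imp_quarter_profile[OF m(2) n X alt y small] by auto
    then have "pst_profile n c s0 s1"
      unfolding pst_profile_def using inv n m(2) X_def by auto
    moreover have "\<forall>p. prime p \<and> p \<noteq> 2 \<and> p dvd n \<longrightarrow> \<not> int p dvd y"
      using quarter_profile_odd_prime[OF m(2) n X alt quarter] by blast
    ultimately show ?thesis using y4 by blast
  qed
  have "y = 2"
  proof (rule ccontr)
    assume "y \<noteq> 2"
    define w where "w = nat (y div 2)"
    have "y mod 4 = 2" using prof by blast
    then have "y = 2 * (y div 2)" "odd (y div 2)" by presburger+
    then have w: "y = 2 * int w" "odd w" "w \<noteq> 1"
      using y \<open>y \<noteq> 2\<close> unfolding w_def by (auto simp: even_nat_iff)
    then obtain p where p: "prime p" "p dvd w" using prime_factor_nat by blast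
    then have p2: "p \<noteq> 2" using w(2) by auto
    have py: "int p dvd y" using p w(1) by simp
    then have "int p dvd int N * (s0 + s1)" using dvd0 dvd_trans by blast
    moreover have "prime (int p)" using p by simp
    ultimately have "int p dvd int N \<or> int p dvd s0 + s1" by (simp add: prime_dvd_mult_iff)
    moreover have "\<not> int p dvd s0 + s1"
    proof
      assume "int p dvd s0 + s1"
      then have "int p \<le> s0 + s1" using s01(3) zdvd_imp_le by blast
      moreover have "p > 2" using p p2 prime_ge_2_nat[of p] by linarith
      ultimately show False using s01 by auto
    qed
    ultimately have "p dvd n" using N by simp
    then show False using prof p p2 py by blast
  qed
  moreover have "real x \<ge> 1" using x by simp
  ultimately have "pi / 2 \<le> t" using t by simp
  then show ?thesis using prof by blast
qed

text \<open>
The alternating spectrum of \<open>c - s\<close> settles the sign \<open>\<sigma> = -1\<close>. Passing to \<open>\<sigma> = 1\<close> adds twice the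
Fourier transform of \<open>s\<close>, a multiple of 4.
\<close>

theorem pst_profile_imp_phase_alignment:
  assumes n0: "n > 0" and prof: "pst_profile n c s0 s1"
    and c: "\<And>k. c (- k) = c k"
  shows "phase_alignment n c (parity_fun s0 s1) (pi / 2)"
proof -
  have inv: "gcd_invariant n c" using prof unfolding pst_profile_def by blast
  have "even n" using prof unfolding pst_profile_def by auto
  define N where "N = n div 2"
  have N: "N > 0" "n = 2 * N" using n0 \<open>even n\<close> by (auto simp: N_def)
  define S where "S = parity_ft N s0 s1"
  have Sft: "ft n (parity_fun s0 s1) h = of_int (S h)" for h
    unfolding N(2) S_def by (rule ft_parity_fun[OF N(1)])
  have invX: "gcd_invariant n (\<lambda>k. c k - parity_fun s0 s1 k)"
    using inv gcd_invariant_parity_fun[OF \<open>even n\<close>] by (rule gcd_invariant_diff)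
  have "\<exists>K. alternating_spectrum n (\<lambda>k. c k - parity_fun s0 s1 k) K 2"
    using prof half_profile_imp_alternating_spectrum[OF _ _ invX]
      quarter_profile_imp_alternating_spectrum[OF _ _ invX]
    unfolding pst_profile_def by blast
  then obtain K where K: "\<And>h. \<exists>z. ft n (\<lambda>k. c k - parity_fun s0 s1 k) h =
      of_int (K + (if odd h then 2 else 0) + 2 * 2 * z)"
    unfolding alternating_spectrum_def by blast
  have Seven: "even (S h)" for h
  proof -
    have "even N \<or> (s0 = 1 \<and> s1 = 1)"
      using prof N(2) unfolding pst_profile_def by (auto simp: mult.assoc)
    then show ?thesis by (auto simp: S_def parity_ft_def)
  qed
  have "\<exists>z. ft n c h = of_int z" for h
    using gcd_invariant_imp_integral_spectrum[OF n0 inv] Ints_cases by metis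
  then obtain C where C: "\<And>h. ft n c h = of_int (C h)" by metis
  have XC: "\<exists>z. C h - S h = K + (if odd h then 2 else 0) + 4 * z" for h
  proof -
    obtain z where "ft n (\<lambda>k. c k - parity_fun s0 s1 k) h =
      of_int (K + (if odd h then 2 else 0) + 2 * 2 * z)" using K by blast
    then have "of_int (C h - S h) = (of_int (K + (if odd h then 2 else 0) + 2 * 2 * z) :: complex)"
      unfolding ft_diff C Sft by simp
    then show ?thesis unfolding of_int_eq_iff by auto
  qed
  have key: "\<exists>z. C h + \<sigma> * S h - (C 0 + S 0) = (if odd h then 2 else 0) + 4 * z"
    if "\<sigma> \<in> {1, -1}" for h \<sigma>
  proof -
    obtain z z' where z: "C h - S h = K + (if odd h then 2 else 0) + 4 * z" "C 0 - S 0 = K + 4 * z'"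
      using XC[of h] XC[of 0] by auto
    obtain u u' where u: "S h = 2 * u" "S 0 = 2 * u'" using Seven by (meson evenE)
    have "C h + \<sigma> * S h - (C 0 + S 0) =
      (if odd h then 2 else 0) + 4 * (z - z' - u' + (if \<sigma> = 1 then u else 0))"
      using z u that by auto
    then show ?thesis by blast
  qed
  show ?thesis
    unfolding phase_alignment_def
  proof (intro allI ballI)
    fix h :: int and \<sigma> :: real assume \<sigma>: "\<sigma> \<in> {1, -1}"
    define \<sigma>' :: int where "\<sigma>' = (if \<sigma> = 1 then 1 else -1)"
    have \<sigma>': "\<sigma> = of_int \<sigma>'" "\<sigma>' \<in> {1, -1}" using \<sigma> by (auto simp: \<sigma>'_def)
    obtain z where z: "C h + \<sigma>' * S h - (C 0 + S 0) = (if odd h then 2 else 0) + 4 * z"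
      using key[OF \<sigma>'(2)] by blast
    have "Re (ft n c h) + \<sigma> * Re (ft n (parity_fun s0 s1) h) -
        (Re (ft n c 0) + Re (ft n (parity_fun s0 s1) 0)) = of_int (C h + \<sigma>' * S h - (C 0 + S 0))"
      unfolding C Sft \<sigma>'(1) by simp
    also have "\<dots> = (if odd h then 2 else 0) + 4 * of_int z" unfolding z by simp
    finally have eq: "pi / 2 * (Re (ft n c h) + \<sigma> * Re (ft n (parity_fun s0 s1) h) -
        (Re (ft n c 0) + Re (ft n (parity_fun s0 s1) 0))) = (if odd h then pi else 0) + 2 * pi * of_int z"
      by (simp add: algebra_simps)
    have "cis (2 * pi * of_int z) = 1" by (rule cis_multiple_2pi) simp
    then show "cis (pi / 2 * (Re (ft n c h) + \<sigma> * Re (ft n (parity_fun s0 s1) h) -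
        (Re (ft n c 0) + Re (ft n (parity_fun s0 s1) 0)))) = (if even h then 1 else - 1)"
      unfolding eq cis_mult[symmetric] by simp
  qed
qed

section \<open>The spectrum of a Cayley graph of a dihedral group\<close>

lemma sum_swap3:
  "(\<Sum>l\<in>A. \<Sum>h\<in>B. \<Sum>j\<in>C. f l h j) = (\<Sum>h\<in>B. \<Sum>j\<in>C. \<Sum>l\<in>A. f l h j)"
  by (subst sum.swap, intro sum.cong refl, rule sum.swap)

context dihedral
begin

text \<open>
Every element of the group is a rotation \<open>a\<^sup>i\<close> or a reflection \<open>b a\<^sup>i\<close>; the flag tells which. The
exponent is an integer modulo \<open>n\<close>.
\<close>

definition elt :: "int \<Rightarrow> bool \<Rightarrow> 'a" where
  "elt i e = (if e then b \<otimes> a [^] i else a [^] i)"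

lemma elt_closed [simp, intro]: "elt i e \<in> carrier G"
  by (simp add: elt_def a_closed b_closed)

lemma b_mult_b: "b \<otimes> b = \<one>"
  using b_pow_2 b_closed by (simp add: numeral_2_eq_2)

lemma inv_b: "inv b = b"
  using b_mult_b b_closed by (simp add: inv_equality)

lemma pow_mult_b: "a [^] (i :: int) \<otimes> b = b \<otimes> a [^] (- i)"
proof -
  have conj: "group_hom G G (\<lambda>x. inv b \<otimes> x \<otimes> b)"
  proof (unfold_locales, unfold hom_def, intro CollectI conjI ballI)
    fix x y assume xy: "x \<in> carrier G" "y \<in> carrier G"
    have "b \<otimes> (b \<otimes> z) = z" if "z \<in> carrier G" for z
      using that b_closed by (simp add: b_mult_b m_assoc[symmetric])
    then show "inv b \<otimes> (x \<otimes> y) \<otimes> b = inv b \<otimes> x \<otimes> b \<otimes> (inv b \<otimes> y \<otimes> b)"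
      using xy b_closed by (simp add: inv_b m_assoc)
  qed (use b_closed in auto)
  have "inv b \<otimes> a [^] i \<otimes> b = (inv b \<otimes> a \<otimes> b) [^] i"
    using group_hom.hom_int_pow[OF conj a_closed] .
  also have "\<dots> = a [^] (- i)"
    unfolding b_conj_a using a_closed by (simp add: int_pow_inv int_pow_neg)
  finally have "b \<otimes> (inv b \<otimes> a [^] i \<otimes> b) = b \<otimes> a [^] (- i)" by simp
  moreover have "b \<otimes> (inv b \<otimes> a [^] i \<otimes> b) = (b \<otimes> inv b) \<otimes> (a [^] i \<otimes> b)"
    using a_closed b_closed by (simp only: m_assoc inv_closed int_pow_closed m_closed)
  ultimately show ?thesis using a_closed b_closed by simp
qed

lemma elt_mult: "elt i e \<otimes> elt j f = elt (j + (if f then - i else i)) (e \<noteq> f)"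
proof -
  note cl = a_closed b_closed
  have TT: "b \<otimes> a [^] i \<otimes> (b \<otimes> a [^] j) = a [^] (j - i)"
  proof -
    have "b \<otimes> a [^] i \<otimes> (b \<otimes> a [^] j) = b \<otimes> (a [^] i \<otimes> b) \<otimes> a [^] j"
      using cl by (simp add: m_assoc)
    also have "\<dots> = (b \<otimes> b) \<otimes> (a [^] (- i) \<otimes> a [^] j)"
      unfolding pow_mult_b using cl by (simp add: m_assoc)
    finally show ?thesis using cl by (simp add: b_mult_b int_pow_mult[symmetric])
  qed
  have FT: "a [^] i \<otimes> (b \<otimes> a [^] j) = b \<otimes> a [^] (j - i)"
  proof -
    have "a [^] i \<otimes> (b \<otimes> a [^] j) = (a [^] i \<otimes> b) \<otimes> a [^] j"
      using cl by (simp add: m_assoc)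
    also have "\<dots> = b \<otimes> (a [^] (- i) \<otimes> a [^] j)"
      unfolding pow_mult_b using cl by (simp add: m_assoc)
    finally show ?thesis using cl by (simp add: int_pow_mult[symmetric])
  qed
  show ?thesis
    using cl TT FT by (auto simp: elt_def m_assoc int_pow_mult[symmetric] add.commute)
qed

lemma elt_0: "elt 0 False = \<one>"
  by (simp add: elt_def)

lemma elt_inv: "inv (elt i e) = elt (if e then i else - i) e"
  by (rule inv_equality) (auto simp: elt_mult elt_0)

lemma elt_quotient: "elt j f \<otimes> inv (elt i e) = elt (if e then i - j else j - i) (e \<noteq> f)"
  by (auto simp: elt_inv elt_mult)

lemma elt_eq_pow: "a [^] (k :: nat) = elt (int k) False"
  by (simp add: elt_def int_pow_int)

lemma elt_periodic: "elt (i + int n * z) e = elt i e"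
proof -
  have "a [^] (int n * z) = (a [^] int n) [^] z" using a_closed by (simp add: int_pow_pow)
  also have "\<dots> = \<one>" using a_pow_n by (simp add: int_pow_int)
  finally show ?thesis using a_closed by (simp add: elt_def int_pow_mult)
qed

lemma elt_cong: "int n dvd i - j \<Longrightarrow> elt i e = elt j e"
  using elt_periodic[of j _ e] by (auto elim!: dvdE simp: algebra_simps)

lemma carrier_eq_range: "carrier G = {elt i e |i e. True}"
proof
  have "subgroup {elt i e |i e. True} G"
  proof (rule subgroupI)
    show "inv x \<in> {elt i e |i e. True}" if "x \<in> {elt i e |i e. True}" for x
      using that by (elim CollectE exE conjE) (simp only: elt_inv, blast)
    show "x \<otimes> y \<in> {elt i e |i e. True}"
      if "x \<in> {elt i e |i e. True}" "y \<in> {elt i e |i e. True}" for x y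
      using that by (elim CollectE exE conjE) (simp only: elt_mult, blast)
  qed auto
  moreover have "a = elt 1 False" "b = elt 0 True"
    using a_closed b_closed by (simp_all add: elt_def)
  then have "{a, b} \<subseteq> {elt i e |i e. True}" by auto
  ultimately have "generate G {a, b} \<subseteq> {elt i e |i e. True}"
    by (intro generate_subgroup_incl)
  then show "carrier G \<subseteq> {elt i e |i e. True}" using generated by simp
qed auto

context
  assumes n_pos: "n > 0"
begin

lemma bij_betw_elt: "bij_betw (\<lambda>(i, e). elt i e) ({0..<int n} \<times> UNIV) (carrier G)"
proof -
  have im: "(\<lambda>(i, e). elt i e) ` ({0..<int n} \<times> UNIV) = carrier G"
  proof
    show "carrier G \<subseteq> (\<lambda>(i, e). elt i e) ` ({0..<int n} \<times> UNIV)"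
    proof
      fix x assume "x \<in> carrier G"
      then obtain i e where "x = elt i e" using carrier_eq_range by auto
      also have "\<dots> = elt (i mod int n) e"
        by (intro elt_cong) (simp add: mod_eq_dvd_iff[symmetric])
      finally show "x \<in> (\<lambda>(i, e). elt i e) ` ({0..<int n} \<times> UNIV)"
        using n_pos by (intro image_eqI[of _ _ "(i mod int n, e)"]) auto
    qed
  qed auto
  have "card ({0..<int n} \<times> (UNIV :: bool set)) = card (carrier G)"
    using order_G by (simp add: Coset.order_def card_cartesian_product)
  then have "inj_on (\<lambda>(i, e). elt i e) ({0..<int n} \<times> UNIV)"
    by (intro eq_card_imp_inj_on) (simp_all add: im)
  then show ?thesis using im by (simp add: bij_betw_def)
qed

lemma elt_eq_iff: "elt i e = elt j f \<longleftrightarrow> int n dvd i - j \<and> e = f"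
proof
  assume eq: "elt i e = elt j f"
  have "elt (i mod int n) e = elt i e" "elt (j mod int n) f = elt j f"
    by (rule elt_cong, simp add: mod_eq_dvd_iff[symmetric])+
  then have mod_eq: "elt (i mod int n) e = elt (j mod int n) f" by (simp only: eq)
  have "(i mod int n, e) = (j mod int n, f)"
    by (rule inj_onD[OF bij_betw_imp_inj_on[OF bij_betw_elt]]) (use n_pos in \<open>simp_all add: mod_eq\<close>)
  then show "int n dvd i - j \<and> e = f" by (simp add: mod_eq_dvd_iff)
qed (auto intro: elt_cong)

end

text \<open>
The indicator functions of \<open>S\<^sub>0\<close> and \<open>S\<^sub>1\<close>, in terms of exponents.
\<close>

definition conn :: "'a set \<Rightarrow> bool \<Rightarrow> int \<Rightarrow> int" where
  "conn S e k = (if elt k e \<in> S then 1 else 0)"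

lemma conn_01: "conn S e k \<in> {0, 1}"
  by (simp add: conn_def)

lemma periodic_conn: "periodic n (conn S e)"
  by (rule periodicI_cong) (auto simp: conn_def dest: elt_cong[of _ _ e])

lemma conj_closedD:
  assumes "conj_closed G S" "s \<in> S" "g \<in> carrier G"
  shows "inv g \<otimes> s \<otimes> g \<in> S"
  using assms unfolding conj_closed_def by blast

lemma conn_uminus:
  assumes "conj_closed G S"
  shows "conn S e (- k) = conn S e k"
proof -
  have "elt (- k) e \<in> S" if "elt k e \<in> S" for k
  proof -
    have "inv (elt 0 True) \<otimes> elt k e \<otimes> elt 0 True \<in> S"
      by (rule conj_closedD[OF assms that]) simp
    then show ?thesis by (simp add: elt_inv elt_mult split: if_splits)
  qed
  from this[of k] this[of "- k"] show ?thesis by (auto simp: conn_def)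
qed

lemma conn_reflection_add_2:
  assumes "conj_closed G S"
  shows "conn S True (k + 2) = conn S True k"
proof -
  have "elt (k + 2) True \<in> S" if "elt k True \<in> S" for k
  proof -
    have "inv (elt 1 False) \<otimes> elt k True \<otimes> elt 1 False \<in> S"
      by (rule conj_closedD[OF assms that]) simp
    then show ?thesis by (simp add: elt_inv elt_mult add.commute)
  qed
  moreover have "elt k True \<in> S" if "elt (k + 2) True \<in> S" for k
  proof -
    have "inv (elt (-1) False) \<otimes> elt (k + 2) True \<otimes> elt (-1) False \<in> S"
      by (rule conj_closedD[OF assms that]) simp
    then show ?thesis by (simp add: elt_inv elt_mult add.commute)
  qed
  ultimately show ?thesis by (auto simp: conn_def)
qed

lemma conn_reflection_eq_parity_fun:
  assumes "conj_closed G S"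
  shows "conn S True = parity_fun (conn S True 0) (conn S True 1)"
proof
  fix k
  have "periodic 2 (conn S True)"
    using conn_reflection_add_2[OF assms] by (simp add: periodic_def)
  then have "conn S True k = conn S True (k mod 2)"
    by (rule periodic_cong) (simp add: mod_eq_dvd_iff[symmetric])
  then show "conn S True k = parity_fun (conn S True 0) (conn S True 1) k"
    by (auto simp: parity_fun_def even_iff_mod_2_eq_zero odd_iff_mod_2_eq_one)
qed

text \<open>
In \<open>elt_quotient\<close> the exponent is \<open>\<plusminus>(j - i)\<close>, with a sign that depends on the vertex. The
connection set cannot see this sign, so the adjacency matrix is that of a Cayley graph of
\<open>\<int>/n \<times> \<int>/2\<close>.
\<close>

lemma adj_matrix_elt:
  assumes "conj_closed G S"
  shows "adj_matrix (Cay G S) (elt i e) (elt j f) = of_int (conn S (e \<noteq> f) (j - i))"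
proof -
  have "elt (i - j) g \<in> S \<longleftrightarrow> elt (j - i) g \<in> S" for g
    using conn_uminus[OF assms, of g "j - i"] by (simp add: conn_def split: if_splits)
  then show ?thesis
    by (auto simp: adj_matrix_def Cay_def elt_quotient conn_def)
qed

definition eigval :: "'a set \<Rightarrow> int \<Rightarrow> complex \<Rightarrow> complex" where
  "eigval S h \<sigma> = ft n (conn S False) h + \<sigma> * ft n (conn S True) h"

lemma sum_conn_rou:
  assumes "n > 0"
  shows "(\<Sum>l\<in>{0..<int n}. of_int (conn S e (l - i)) * rou n (h * (l - j))) =
    rou n (h * (i - j)) * ft n (conn S e) h"
proof -
  have "(\<Sum>l\<in>{0..<int n}. of_int (conn S e (l - i)) * rou n (h * (l - j))) =
      (\<Sum>l\<in>{0..<int n}. rou n (h * (i - j)) * (of_int (conn S e (- i + l)) * rou n (h * l)) * rou n (h * - i))"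
  proof (intro sum.cong refl)
    fix l
    have "rou n (h * (l - j)) = rou n (h * (i - j)) * rou n (h * l) * rou n (h * - i)"
      unfolding rou_add[symmetric] by (simp add: algebra_simps)
    then show "of_int (conn S e (l - i)) * rou n (h * (l - j)) =
        rou n (h * (i - j)) * (of_int (conn S e (- i + l)) * rou n (h * l)) * rou n (h * - i)"
      by (simp add: mult_ac)
  qed
  also have "\<dots> = rou n (h * (i - j)) * (ft n (conn S e) h * rou n (- h * - i)) * rou n (h * - i)"
    unfolding ft_shift[OF assms periodic_conn, symmetric] by (simp add: sum_distrib_left sum_distrib_right)
  also have "\<dots> = rou n (h * (i - j)) * ft n (conn S e) h"
    by (simp add: mult.assoc flip: rou_add)
  finally show ?thesis .
qed

text \<open>
The spectral decomposition with respect to the characters of \<open>\<int>/n \<times> \<int>/2\<close>, written for a multiple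
of the adjacency matrix so that the exponential series can be summed termwise. In the step, the
sum over rotations reproduces \<open>ft n c h\<close> and the sum over reflections \<open>\<sigma>\<close> times \<open>ft n s h\<close>.
\<close>

lemma vmat_pow_Cay:
  assumes n: "n > 0" and S: "conj_closed G S"
  shows "vmat_pow (carrier G) (\<lambda>u v. \<alpha> * adj_matrix (Cay G S) u v) k (elt i e) (elt j f) =
    (\<Sum>h\<in>{0..<int n}. \<Sum>\<sigma>\<in>{1, -1}. rou n (h * (i - j)) * (if e = f then 1 else \<sigma>) * (\<alpha> * eigval S h \<sigma>) ^ k)
      / of_nat (2 * n)"
proof (induction k arbitrary: i e)
  case 0
  have "(\<Sum>h\<in>{0..<int n}. rou n (h * (i - j))) = (if int n dvd i - j then of_nat n else 0)"
    using sum_rou[OF n, of "i - j"] by (simp add: mult.commute)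
  moreover have "(\<Sum>\<sigma>\<in>{1, -1}. rou n (h * (i - j)) * (if e = f then 1 else \<sigma>) * (\<alpha> * eigval S h \<sigma>) ^ 0) =
      rou n (h * (i - j)) * (if e = f then 2 else 0)" for h
    by simp
  ultimately show ?case
    unfolding sum_distrib_right[symmetric] using n
    by (simp only: sum_distrib_right[symmetric]) (simp add: elt_eq_iff[OF n])
next
  case (Suc k)
  define F where "F = (\<lambda>h \<sigma>. (\<alpha> * eigval S h \<sigma>) ^ k)"
  define D where "D = (of_nat (2 * n) :: complex)"
  have over_G: "sum \<Phi> (carrier G) = (\<Sum>g\<in>UNIV. \<Sum>l\<in>{0..<int n}. \<Phi> (elt l g))" for \<Phi> :: "'a \<Rightarrow> complex"
  proof -
    have "sum \<Phi> (carrier G) = (\<Sum>(l, g)\<in>{0..<int n} \<times> UNIV. \<Phi> (elt l g))"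
      using sum.reindex_bij_betw[OF bij_betw_elt[OF n], of \<Phi>] by (simp add: case_prod_unfold)
    also have "\<dots> = (\<Sum>l\<in>{0..<int n}. \<Sum>g\<in>UNIV. \<Phi> (elt l g))"
      by (rule sum.cartesian_product[symmetric])
    also have "\<dots> = (\<Sum>g\<in>UNIV. \<Sum>l\<in>{0..<int n}. \<Phi> (elt l g))"
      by (rule sum.swap)
    finally show ?thesis .
  qed
  have "vmat_pow (carrier G) (\<lambda>u v. \<alpha> * adj_matrix (Cay G S) u v) (Suc k) (elt i e) (elt j f) =
      (\<Sum>g\<in>UNIV. \<Sum>l\<in>{0..<int n}. \<alpha> * of_int (conn S (e \<noteq> g) (l - i)) *
        vmat_pow (carrier G) (\<lambda>u v. \<alpha> * adj_matrix (Cay G S) u v) k (elt l g) (elt j f))"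
    by (simp only: vmat_pow.simps over_G adj_matrix_elt[OF S])
  also have "\<dots> = (\<Sum>g\<in>UNIV. \<Sum>l\<in>{0..<int n}. \<Sum>h\<in>{0..<int n}. \<Sum>\<sigma>\<in>{1, -1}.
        (of_int (conn S (e \<noteq> g) (l - i)) * rou n (h * (l - j))) * (\<alpha> * (if g = f then 1 else \<sigma>) * F h \<sigma> / D))"
    unfolding Suc F_def D_def sum_divide_distrib sum_distrib_left
    by (intro sum.cong refl) (simp only: times_divide_eq_right mult_ac)
  also have "\<dots> = (\<Sum>g\<in>UNIV. \<Sum>h\<in>{0..<int n}. \<Sum>\<sigma>\<in>{1, -1}. \<Sum>l\<in>{0..<int n}.
        (of_int (conn S (e \<noteq> g) (l - i)) * rou n (h * (l - j))) * (\<alpha> * (if g = f then 1 else \<sigma>) * F h \<sigma> / D))"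
    by (intro sum.cong refl sum_swap3)
  also have "\<dots> = (\<Sum>g\<in>UNIV. \<Sum>h\<in>{0..<int n}. \<Sum>\<sigma>\<in>{1, -1}.
        (rou n (h * (i - j)) * ft n (conn S (e \<noteq> g)) h) * (\<alpha> * (if g = f then 1 else \<sigma>) * F h \<sigma> / D))"
    unfolding sum_distrib_right[symmetric] sum_conn_rou[OF n] ..
  also have "\<dots> = (\<Sum>h\<in>{0..<int n}. \<Sum>\<sigma>\<in>{1, -1}. \<Sum>g\<in>UNIV.
        (rou n (h * (i - j)) * ft n (conn S (e \<noteq> g)) h) * (\<alpha> * (if g = f then 1 else \<sigma>) * F h \<sigma> / D))"
    by (rule sum_swap3)
  also have "\<dots> = (\<Sum>h\<in>{0..<int n}. \<Sum>\<sigma>\<in>{1, -1}. rou n (h * (i - j)) * (if e = f then 1 else \<sigma>) *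
      (\<alpha> * eigval S h \<sigma> * F h \<sigma>)) / D"
    unfolding sum_divide_distrib UNIV_bool eigval_def
    by (intro sum.cong refl) (cases e; cases f; auto simp: algebra_simps add_divide_distrib)
  finally show ?case unfolding F_def D_def by (simp add: mult_ac)
qed

lemma transition_matrix_Cay:
  assumes n: "n > 0" and S: "conj_closed G S"
  shows "transition_matrix (Cay G S) t (elt i e) (elt j f) =
    (\<Sum>h\<in>{0..<int n}. \<Sum>\<sigma>\<in>{1, -1}. rou n (h * (i - j)) * (if e = f then 1 else \<sigma>) *
      exp (- \<i> * of_real t * eigval S h \<sigma>)) / of_nat (2 * n)"
proof -
  have "(\<lambda>k. vmat_pow (carrier G) (\<lambda>u v. - \<i> * of_real t * adj_matrix (Cay G S) u v) k (elt i e) (elt j f) / fact k)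
      sums ((\<Sum>h\<in>{0..<int n}. \<Sum>\<sigma>\<in>{1, -1}. rou n (h * (i - j)) * (if e = f then 1 else \<sigma>) *
      exp (- \<i> * of_real t * eigval S h \<sigma>)) / of_nat (2 * n))"
  proof -
    have "(\<lambda>k. z ^ k / fact k) sums exp z" for z :: complex
      using exp_converges[of z] by (simp add: scaleR_conv_of_real field_simps)
    then have "(\<lambda>k. (\<Sum>h\<in>{0..<int n}. \<Sum>\<sigma>\<in>{1, -1}. rou n (h * (i - j)) * (if e = f then 1 else \<sigma>) *
        ((- \<i> * of_real t * eigval S h \<sigma>) ^ k / fact k)) / of_nat (2 * n)) sums
      ((\<Sum>h\<in>{0..<int n}. \<Sum>\<sigma>\<in>{1, -1}. rou n (h * (i - j)) * (if e = f then 1 else \<sigma>) *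
        exp (- \<i> * of_real t * eigval S h \<sigma>)) / of_nat (2 * n))"
      by (intro sums_divide sums_sum sums_mult)
    moreover have "(\<Sum>h\<in>{0..<int n}. \<Sum>\<sigma>\<in>{1, -1}. rou n (h * (i - j)) * (if e = f then 1 else \<sigma>) *
        ((- \<i> * of_real t * eigval S h \<sigma>) ^ k / fact k)) / of_nat (2 * n) =
      vmat_pow (carrier G) (\<lambda>u v. - \<i> * of_real t * adj_matrix (Cay G S) u v) k (elt i e) (elt j f) / fact k" for k
      unfolding vmat_pow_Cay[OF n S] sum_divide_distrib by (simp add: field_simps)
    ultimately show ?thesis by simp
  qed
  then show ?thesis
    unfolding transition_matrix_def vmat_exp_def by (simp add: Cay_def sums_iff)
qed

end

text \<open>
Equality in the triangle inequality: the average \<open>w\<close> has modulus 1, no \<open>Re (cnj w * f i)\<close>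
exceeds 1, and these numbers have the average 1.
\<close>

lemma norm_sum_eq_card_iff:
  fixes f :: "'i \<Rightarrow> complex"
  assumes A: "finite A" "x \<in> A" and f: "\<And>i. i \<in> A \<Longrightarrow> norm (f i) = 1"
  shows "norm (sum f A) = card A \<longleftrightarrow> (\<forall>i\<in>A. f i = f x)"
proof
  assume *: "norm (sum f A) = card A"
  define w where "w = sum f A / card A"
  have card: "card A > 0" using A by (auto simp: card_gt_0_iff)
  have w: "norm w = 1" using * card by (simp add: w_def norm_divide)
  have le: "Re (cnj w * f i) \<le> 1" if "i \<in> A" for i
    using complex_Re_le_cmod[of "cnj w * f i"] f[OF that] w by (simp add: norm_mult)
  have "(\<Sum>i\<in>A. 1 - Re (cnj w * f i)) = card A - Re (cnj w * sum f A)"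
    by (simp add: sum_subtractf sum_distrib_left)
  also have "sum f A = of_nat (card A) * w" using card by (simp add: w_def)
  also have "cnj w * (of_nat (card A) * w) = of_nat (card A) * (w * cnj w)" by (simp add: mult_ac)
  also have "w * cnj w = 1" using w by (simp add: complex_norm_square[symmetric])
  finally have "(\<Sum>i\<in>A. 1 - Re (cnj w * f i)) = 0" by simp
  then have eq: "Re (cnj w * f i) = 1" if "i \<in> A" for i
    using sum_nonneg_eq_0_iff[OF A(1), of "\<lambda>i. 1 - Re (cnj w * f i)"] le that by force
  have "f i = w" if "i \<in> A" for i
  proof -
    have "norm (cnj w * f i) = 1" using f[OF that] w by (simp add: norm_mult)
    then have "(Re (cnj w * f i))\<^sup>2 + (Im (cnj w * f i))\<^sup>2 = 1" by (simp only: cmod_power2[symmetric]) simp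
    then have "Im (cnj w * f i) = 0" using eq[OF that] by (simp only:) simp
    then have "cnj w * f i = 1" using eq[OF that] by (simp add: complex_eq_iff)
    then have "w * cnj w * f i = w" by (simp add: mult.assoc)
    moreover have "w * cnj w = 1" using w by (simp add: complex_norm_square[symmetric])
    ultimately show ?thesis by simp
  qed
  then show "\<forall>i\<in>A. f i = f x" using A(2) by simp
next
  assume "\<forall>i\<in>A. f i = f x"
  then have "sum f A = (\<Sum>i\<in>A. f x)" by (intro sum.cong) auto
  then show "norm (sum f A) = card A" using f[OF A(2)] by (simp add: norm_mult)
qed

section \<open>Perfect state transfer as alignment of phases\<close>

lemma ft_cong:
  assumes "n > 0" "int n dvd h - h'"
  shows "ft n c h = ft n c h'"
  unfolding ft_def
proof (intro sum.cong refl)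
  fix k
  have "int n dvd h * k - h' * k" using assms(2) by (simp flip: left_diff_distrib)
  then show "of_int (c k) * rou n (h * k) = of_int (c k) * rou n (h' * k)"
    using rou_cong[OF assms(1)] by simp
qed

context dihedral
begin

text \<open>
The shift by 2 fixes the function and multiplies its Fourier transform by a root of unity.
\<close>

lemma ft_reflection_eq_0:
  assumes "n > 0" "conj_closed G S" "\<not> int n dvd 2 * h"
  shows "ft n (conn S True) h = 0"
proof -
  have "ft n (conn S True) h * rou n (- h * 2) =
      (\<Sum>j\<in>{0..<int n}. of_int (conn S True (2 + j)) * rou n (h * j))"
    by (rule ft_shift[symmetric, OF assms(1) periodic_conn])
  also have "\<dots> = ft n (conn S True) h"
    unfolding ft_def using conn_reflection_add_2[OF assms(2)] by (simp add: add.commute)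
  finally have "ft n (conn S True) h * (rou n (- h * 2) - 1) = 0" by (simp add: algebra_simps)
  moreover have "rou n (- h * 2) \<noteq> 1"
    using assms(1,3) rou_eq_1_iff[of n "- h * 2"] by (simp add: mult.commute)
  ultimately show ?thesis by simp
qed

definition freq :: "'a set \<Rightarrow> int \<Rightarrow> real \<Rightarrow> real" where
  "freq S h \<sigma> = Re (ft n (conn S False) h) + \<sigma> * Re (ft n (conn S True) h)"

lemma pst_at_elt_iff:
  assumes n: "n > 0" and S: "conj_closed G S"
  shows "pst_at (Cay G S) (elt i e) (elt j f) t \<longleftrightarrow> elt i e \<noteq> elt j f \<and> 0 \<le> t \<and>
    (\<forall>h. \<forall>\<sigma>\<in>{1, -1}. rou n (h * (i - j)) * (if e = f then 1 else of_real \<sigma>) =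
       cis (t * (freq S h \<sigma> - freq S 0 1)))"
proof -
  define F where "F = (\<lambda>(h, \<sigma>). rou n (h * (i - j)) * (if e = f then 1 else of_real \<sigma>) *
      cis (- t * freq S h \<sigma>))"
  define A where "A = {0..<int n} \<times> {1, -1 :: real}"
  have A: "finite A" "(0, 1) \<in> A" "card A = 2 * n"
    using n by (simp_all add: A_def card_cartesian_product)
  have F1: "norm (F p) = 1" if "p \<in> A" for p
    using that by (auto simp: F_def A_def norm_mult)
  have F0: "F (0, 1) = cis (- t * freq S 0 1)" by (simp add: F_def)
  have real: "ft n (conn S g) h = of_real (Re (ft n (conn S g) h))" for g h
    using ft_Reals[OF n periodic_conn conn_uminus[OF S]] by (simp add: of_real_Re)
  have eig: "exp (- \<i> * of_real t * eigval S h (of_real \<sigma>)) = cis (- t * freq S h \<sigma>)" for h \<sigma>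
  proof -
    have "eigval S h (of_real \<sigma>) = of_real (freq S h \<sigma>)"
      unfolding eigval_def freq_def using real[of False h] real[of True h] by simp
    then show ?thesis by (simp add: cis_conv_exp mult_ac)
  qed
  have "transition_matrix (Cay G S) t (elt i e) (elt j f) = sum F A / of_nat (2 * n)"
  proof -
    have "(\<Sum>\<sigma>\<in>{1, -1}. rou n (h * (i - j)) * (if e = f then 1 else \<sigma>) *
        exp (- \<i> * of_real t * eigval S h \<sigma>)) = (\<Sum>\<sigma>\<in>{1, -1}. F (h, \<sigma>))" for h
      using eig[of h 1] eig[of h "-1"] by (simp add: F_def)
    then show ?thesis
      unfolding transition_matrix_Cay[OF n S] A_def by (simp only: sum.cartesian_product) simp
  qed
  then have "norm (transition_matrix (Cay G S) t (elt i e) (elt j f)) = norm (sum F A) / (2 * n)"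
    by (simp add: norm_divide)
  then have "norm (transition_matrix (Cay G S) t (elt i e) (elt j f)) = 1 \<longleftrightarrow> norm (sum F A) = card A"
    using n A(3) by (auto simp: divide_eq_1_iff)
  also have "\<dots> \<longleftrightarrow> (\<forall>p\<in>A. F p = F (0, 1))"
    by (rule norm_sum_eq_card_iff[OF A(1,2) F1])
  also have "\<dots> \<longleftrightarrow> (\<forall>h\<in>{0..<int n}. \<forall>\<sigma>\<in>{1, -1}. rou n (h * (i - j)) * (if e = f then 1 else of_real \<sigma>) =
       cis (t * (freq S h \<sigma> - freq S 0 1)))" (is "_ \<longleftrightarrow> (\<forall>h\<in>{0..<int n}. ?P h)")
  proof -
    have "F (h, \<sigma>) = F (0, 1) \<longleftrightarrow> rou n (h * (i - j)) * (if e = f then 1 else of_real \<sigma>) =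
       cis (t * (freq S h \<sigma> - freq S 0 1))" for h \<sigma>
    proof -
      have split: "cis (t * (freq S h \<sigma> - freq S 0 1)) = cis (- t * freq S 0 1) / cis (- t * freq S h \<sigma>)"
        by (simp add: cis_divide algebra_simps)
      show ?thesis unfolding split F0 by (simp add: F_def field_simps)
    qed
    then show ?thesis unfolding A_def by blast
  qed
  also have "\<dots> \<longleftrightarrow> (\<forall>h. ?P h)"
  proof
    assume *: "\<forall>h\<in>{0..<int n}. ?P h"
    show "\<forall>h. ?P h"
    proof
      fix h
      have d: "int n dvd h mod int n - h" by (simp add: mod_eq_dvd_iff[symmetric])
      then have "int n dvd (h mod int n) * (i - j) - h * (i - j)" by (simp flip: left_diff_distrib)
      then have "rou n ((h mod int n) * (i - j)) = rou n (h * (i - j))" by (rule rou_cong[OF n])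
      moreover have "freq S (h mod int n) \<sigma> = freq S h \<sigma>" for \<sigma>
        unfolding freq_def using ft_cong[OF n d] by simp
      moreover have "?P (h mod int n)" using * n by simp
      ultimately show "?P h" by simp
    qed
  qed blast
  finally show ?thesis unfolding pst_at_def by (auto simp: Cay_def)
qed

lemma phase_alignment_conn:
  "phase_alignment n (conn S False) (conn S True) t \<longleftrightarrow>
     (\<forall>h. \<forall>\<sigma>\<in>{1, -1}. cis (t * (freq S h \<sigma> - freq S 0 1)) = (if even h then 1 else -1))"
  unfolding phase_alignment_def freq_def by simp

text \<open>
As \<open>n \<ge> 3\<close>, the reflections do not contribute to the eigenvalues at \<open>h = \<plusminus>1\<close>. So both signs
\<open>\<sigma>\<close> have the same phase at \<open>h = 1\<close>, which excludes transfer between a rotation and a reflection.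
The eigenvalues at \<open>h = 1\<close> and \<open>h = -1\<close> agree, which makes twice the difference of the exponents
a multiple of \<open>n\<close>.
\<close>

theorem pst_at_iff_phase_alignment:
  assumes n: "n \<ge> 3" and S: "conj_closed G S"
  shows "pst_at (Cay G S) u v t \<longleftrightarrow> u \<in> carrier G \<and> even n \<and> v = u \<otimes> a [^] (n div 2) \<and> 0 \<le> t \<and>
    phase_alignment n (conn S False) (conn S True) t"
proof
  assume pst: "pst_at (Cay G S) u v t"
  then have "u \<in> carrier G" "v \<in> carrier G" by (auto simp: pst_at_def Cay_def)
  then obtain i e j f where uv: "u = elt i e" "v = elt j f" using carrier_eq_range by auto
  have n0: "n > 0" using n by simp
  have ne: "elt i e \<noteq> elt j f" and t: "0 \<le> t" and ph: "\<And>h \<sigma>. \<sigma> \<in> {1, -1} \<Longrightarrow>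
      rou n (h * (i - j)) * (if e = f then 1 else of_real \<sigma>) = cis (t * (freq S h \<sigma> - freq S 0 1))"
    using pst unfolding uv pst_at_elt_iff[OF n0 S] by blast+
  have "\<not> int n dvd 2" using n by (auto dest: zdvd_imp_le)
  then have s1: "ft n (conn S True) 1 = 0" "ft n (conn S True) (-1) = 0"
    using ft_reflection_eq_0[OF n0 S, of 1] ft_reflection_eq_0[OF n0 S, of "-1"] by simp_all
  have freq: "freq S 1 1 = freq S 1 (-1)" "freq S (-1) 1 = freq S 1 1"
    using s1 ft_uminus[OF n0 periodic_conn conn_uminus[OF S], of False 1] by (simp_all add: freq_def)
  have ef: "e = f"
  proof (rule ccontr)
    assume "e \<noteq> f"
    then have "rou n (i - j) = - rou n (i - j)"
      using ph[of 1 1] ph[of "-1" 1] freq(1) by simp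
    then have "rou n (i - j) = 0" by simp
    then show False using norm_rou[of n "i - j"] by simp
  qed
  have "rou n (i - j) = rou n (- (i - j))"
    using ph[of 1 1] ph[of 1 "-1"] freq(2) ef by simp
  then have "rou n (2 * (i - j)) = rou n (- (i - j)) * rou n (i - j)"
    by (simp only: mult_2 rou_add)
  also have "\<dots> = 1" by (simp flip: rou_add)
  finally have d2: "int n dvd 2 * (i - j)" using rou_eq_1_iff[OF n0] by blast
  have nd: "\<not> int n dvd i - j" using ne ef elt_eq_iff[OF n0] by blast
  have "even n"
  proof (rule ccontr)
    assume "odd n"
    then have "coprime (int n) 2" by simp
    then show False using d2 nd coprime_dvd_mult_right_iff by blast
  qed
  define N where "N = n div 2"
  have N: "n = 2 * N" "N > 0" using \<open>even n\<close> n0 by (auto simp: N_def)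
  obtain w where "2 * (i - j) = int n * w" using d2 by (rule dvdE)
  then have w: "i - j = int N * w" using N by simp
  have "odd w"
  proof
    assume "even w"
    then have "int n dvd i - j" unfolding w N by auto
    then show False using nd by blast
  qed
  have "v = elt (int N + i) e"
  proof -
    have "even (w + 1)" using \<open>odd w\<close> by simp
    then have "int n dvd int N * (w + 1)" unfolding N by auto
    moreover have "int N * (w + 1) = (int N + i) - j" using w by (simp add: algebra_simps)
    ultimately have "elt (int N + i) e = elt j f" using ef by (auto intro: elt_cong)
    then show ?thesis using uv by simp
  qed
  also have "\<dots> = u \<otimes> a [^] (n div 2)"
    unfolding uv elt_eq_pow elt_mult by (simp add: N_def)
  finally have "v = u \<otimes> a [^] (n div 2)" .
  moreover have "phase_alignment n (conn S False) (conn S True) t"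
    unfolding phase_alignment_conn
  proof (intro allI ballI)
    fix h :: int and \<sigma> :: real assume "\<sigma> \<in> {1, -1}"
    then have "cis (t * (freq S h \<sigma> - freq S 0 1)) = rou n (h * (i - j))"
      using ph ef by simp
    also have "\<dots> = rou (N * 2) (int N * (h * w))"
      unfolding w N by (simp add: mult_ac)
    also have "\<dots> = (if even h then 1 else -1)"
      unfolding rou_scale[OF N(2)] rou_half using \<open>odd w\<close> by simp
    finally show "cis (t * (freq S h \<sigma> - freq S 0 1)) = (if even h then 1 else -1)" .
  qed
  ultimately show "u \<in> carrier G \<and> even n \<and> v = u \<otimes> a [^] (n div 2) \<and> 0 \<le> t \<and>
    phase_alignment n (conn S False) (conn S True) t"
    using \<open>u \<in> carrier G\<close> \<open>even n\<close> t by blast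
next
  assume *: "u \<in> carrier G \<and> even n \<and> v = u \<otimes> a [^] (n div 2) \<and> 0 \<le> t \<and>
    phase_alignment n (conn S False) (conn S True) t"
  then obtain i e where u: "u = elt i e" using carrier_eq_range by auto
  define N where "N = n div 2"
  have n0: "n > 0" using n by simp
  have N: "n = 2 * N" "N > 0" using * n0 by (auto simp: N_def)
  have v: "v = elt (int N + i) e"
    using * unfolding u elt_eq_pow elt_mult by (simp add: N_def)
  have "\<not> int n dvd i - (int N + i)"
    using N by (auto dest: zdvd_imp_le)
  moreover have "rou n (h * (i - (int N + i))) = (if even h then 1 else -1)" for h
  proof -
    have "rou n (h * (i - (int N + i))) = rou (N * 2) (int N * (- h))"
      unfolding N by (simp add: mult_ac)
    then show ?thesis unfolding rou_scale[OF N(2)] rou_half by simp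
  qed
  ultimately show "pst_at (Cay G S) u v t"
    using * unfolding u v pst_at_elt_iff[OF n0 S] phase_alignment_conn elt_eq_iff[OF n0] by simp
qed

end

section \<open>Sets of divisors\<close>

text \<open>
The support of \<open>c\<close> is the union of the sets \<open>G\<^sub>n(d)\<close> over \<open>d \<in> D\<close>, in terms of exponents.
Multiples of \<open>n\<close> have to be excluded explicitly, as \<open>D\<close> may contain \<open>n\<close>.
\<close>

definition gcd_support :: "nat \<Rightarrow> (int \<Rightarrow> int) \<Rightarrow> nat set \<Rightarrow> bool" where
  "gcd_support n c D \<longleftrightarrow> (\<forall>k. c k = 1 \<longleftrightarrow> \<not> int n dvd k \<and> nat (gcd k (int n)) \<in> D)"

lemma gcd_support_iff:
  assumes n: "n > 0" and c: "\<And>k. c k \<in> {0, 1}" "c 0 = 0"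
  shows "gcd_support n c D \<longleftrightarrow>
    gcd_invariant n c \<and> (\<forall>d. d dvd n \<and> d \<noteq> n \<longrightarrow> (c (int d) = 1 \<longleftrightarrow> d \<in> D))"
proof
  assume D: "gcd_support n c D"
  have "gcd_invariant n c"
    unfolding gcd_invariant_def
  proof (intro allI impI)
    fix j k assume eq: "gcd j (int n) = gcd k (int n)"
    have "int n dvd i \<longleftrightarrow> gcd i (int n) = int n" for i
      using n by (metis abs_of_nat gcd_proj2_iff normalize_int_def)
    then have "int n dvd j \<longleftrightarrow> int n dvd k" using eq by simp
    then have "c j = 1 \<longleftrightarrow> c k = 1" using D eq unfolding gcd_support_def by metis
    then show "c j = c k" using c(1)[of j] c(1)[of k] by auto
  qed
  moreover have "c (int d) = 1 \<longleftrightarrow> d \<in> D" if "d dvd n" "d \<noteq> n" for d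
  proof -
    have "gcd (int d) (int n) = int d" using that(1) by (metis gcd_int_int_eq gcd_nat.absorb1)
    moreover have "\<not> n dvd d" using that by (auto dest: dvd_antisym)
    ultimately show ?thesis using D unfolding gcd_support_def by simp
  qed
  ultimately show "gcd_invariant n c \<and> (\<forall>d. d dvd n \<and> d \<noteq> n \<longrightarrow> (c (int d) = 1 \<longleftrightarrow> d \<in> D))" by blast
next
  assume *: "gcd_invariant n c \<and> (\<forall>d. d dvd n \<and> d \<noteq> n \<longrightarrow> (c (int d) = 1 \<longleftrightarrow> d \<in> D))"
  show "gcd_support n c D"
    unfolding gcd_support_def
  proof
    fix k
    show "c k = 1 \<longleftrightarrow> \<not> int n dvd k \<and> nat (gcd k (int n)) \<in> D"
    proof (cases "int n dvd k")
      case True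
      then have "gcd k (int n) = gcd 0 (int n)" by simp
      then have "c k = c 0" using * gcd_invariantD by blast
      then show ?thesis using True c(2) by simp
    next
      case False
      define d where "d = nat (gcd k (int n))"
      have d: "int d = gcd k (int n)" by (simp add: d_def)
      then have "int d dvd int n" "int d dvd k" by simp_all
      then have "d dvd n" "d \<noteq> n" using False by auto
      moreover have "gcd k (int n) = gcd (int d) (int n)" by (simp add: d)
      then have "c k = c (int d)" using * gcd_invariantD by blast
      ultimately have "c k = 1 \<longleftrightarrow> d \<in> D" using * by metis
      then show ?thesis using False unfolding d_def by blast
    qed
  qed
qed

lemma multiplicity_two_power_mult:
  "multiplicity 2 (2 ^ i * g) = i" if "odd (g :: nat)"
  using multiplicity_prime_elem_times_other[of "2 :: nat" g "2 ^ i"] that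
  by (simp add: mult.commute)

lemma two_power_mult_eq_iff:
  "2 ^ i * g = 2 ^ j * g' \<longleftrightarrow> i = j \<and> g = g'" if "odd (g :: nat)" "odd g'"
  using multiplicity_two_power_mult[OF that(1), of i] multiplicity_two_power_mult[OF that(2), of j]
  by auto

lemma dvd_two_power_mult_iff:
  assumes "odd (m :: nat)"
  shows "d dvd 2 ^ b * m \<longleftrightarrow> (\<exists>i\<le>b. \<exists>g. g dvd m \<and> d = 2 ^ i * g)"
proof
  assume "d dvd 2 ^ b * m"
  then obtain x y where xy: "d = x * y" "x dvd 2 ^ b" "y dvd m"
    using division_decomp by blast
  then obtain i where "i \<le> b" "x = 2 ^ i" using divides_primepow_nat[OF two_is_prime_nat] by blast
  then show "\<exists>i\<le>b. \<exists>g. g dvd m \<and> d = 2 ^ i * g" using xy by blast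
qed (auto intro!: mult_dvd_mono le_imp_power_dvd)

lemma multiplicity_two_codivisor:
  assumes m: "odd (m :: nat)" and g: "g dvd m" and i: "i \<le> b"
  shows "multiplicity 2 (2 ^ b * m div (2 ^ i * g)) = b - i"
proof -
  from g obtain e where e: "m = g * e" ..
  have "2 ^ b * m = (2 ^ i * g) * (2 ^ (b - i) * e)"
    using i by (simp add: e mult_ac flip: power_add)
  moreover have "2 ^ i * g \<noteq> 0" using m e by (cases "g = 0") auto
  ultimately have "2 ^ b * m div (2 ^ i * g) = 2 ^ (b - i) * e"
    by (metis nonzero_mult_div_cancel_left)
  moreover have "odd e" using m e by simp
  ultimately show ?thesis using multiplicity_two_power_mult by metis
qed

text \<open>
The relations of \<open>quarter_profile\<close> for \<open>c\<close> alone, when \<open>s\<close> agrees at the positions compared.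
\<close>

definition plain_profile :: "nat \<Rightarrow> nat \<Rightarrow> (int \<Rightarrow> int) \<Rightarrow> bool" where
  "plain_profile r m c \<longleftrightarrow> c (int (2 ^ r * m)) \<noteq> c (int (2 ^ Suc r * m)) \<and>
     (\<forall>g. g dvd m \<and> g \<noteq> m \<longrightarrow> c (int (2 ^ Suc (Suc r) * g)) = c (int (2 ^ Suc r * g)) \<and>
        c (int (2 ^ Suc (Suc r) * g)) = c (int (2 ^ r * g)))"

text \<open>
The same for \<open>n = 4m\<close> and \<open>s\<close> the indicator function of one parity class: \<open>s\<close> distinguishes the
odd position \<open>g\<close> from \<open>2g\<close> and \<open>4g\<close>, which reverses the relations between these.
\<close>

definition twisted_profile :: "nat \<Rightarrow> (int \<Rightarrow> int) \<Rightarrow> bool" where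
  "twisted_profile m c \<longleftrightarrow> c (int m) = c (int (2 * m)) \<and>
     (\<forall>g. g dvd m \<and> g \<noteq> m \<longrightarrow> c (int (4 * g)) = c (int (2 * g)) \<and> c (int (4 * g)) \<noteq> c (int g))"

locale four_dvd =
  fixes r m n :: nat
  assumes m_odd: "odd m" and n_eq: "n = 2 ^ Suc (Suc r) * m"
begin

lemma m_pos: "m > 0"
  using m_odd by (auto intro: Nat.gr0I)

lemma n_pos: "n > 0"
  using m_pos by (simp add: n_eq)

lemma odd_divisor: "g dvd m \<Longrightarrow> odd g"
  using m_odd dvd_trans by blast

lemma quarter_eq: "n div 4 = 2 ^ r * m" and half_eq: "n div 2 = 2 ^ Suc r * m"
  by (simp_all add: n_eq)

lemma dvd_n_iff: "d dvd n \<longleftrightarrow> (\<exists>i\<le>Suc (Suc r). \<exists>g. g dvd m \<and> d = 2 ^ i * g)"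
  unfolding n_eq using dvd_two_power_mult_iff[OF m_odd] .

lemma multiplicity_codivisor: "g dvd m \<Longrightarrow> i \<le> Suc (Suc r) \<Longrightarrow>
    multiplicity 2 (n div (2 ^ i * g)) = Suc (Suc r) - i"
  unfolding n_eq using multiplicity_two_codivisor[OF m_odd] .

lemma dyadic_eq_iff: "g dvd m \<Longrightarrow> g' dvd m \<Longrightarrow> 2 ^ i * g = 2 ^ j * g' \<longleftrightarrow> i = j \<and> g = g'"
  using two_power_mult_eq_iff odd_divisor by metis

lemma val2_divisors_eq: "val2_divisors n = (\<lambda>g. 2 ^ r * g) ` {g. g dvd m \<and> g \<noteq> m}"
proof (intro equalityI subsetI)
  fix d assume d: "d \<in> val2_divisors n"
  then obtain i g where ig: "i \<le> Suc (Suc r)" "g dvd m" "d = 2 ^ i * g"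
    unfolding val2_divisors_def dvd_n_iff by blast
  moreover have "i = r" using d multiplicity_codivisor[OF ig(2,1)] ig unfolding val2_divisors_def by auto
  moreover have "g \<noteq> m" using d ig \<open>i = r\<close> unfolding val2_divisors_def quarter_eq by auto
  ultimately show "d \<in> (\<lambda>g. 2 ^ r * g) ` {g. g dvd m \<and> g \<noteq> m}" by blast
next
  fix d assume "d \<in> (\<lambda>g. 2 ^ r * g) ` {g. g dvd m \<and> g \<noteq> m}"
  then obtain g where g: "g dvd m" "g \<noteq> m" "d = 2 ^ r * g" by blast
  moreover have "d dvd n" unfolding dvd_n_iff using g le_SucI[OF le_SucI[OF order_refl]] by blast
  ultimately show "d \<in> val2_divisors n"
    using multiplicity_codivisor[OF g(1), of r] dyadic_eq_iff[OF g(1), of m r r]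
    unfolding val2_divisors_def quarter_eq by simp
qed

lemma high_divisors_eq: "{d. d dvd n \<and> 3 \<le> multiplicity 2 (n div d)} = {2 ^ i * g |i g. i < r \<and> g dvd m}"
proof (intro equalityI subsetI)
  fix d assume d: "d \<in> {d. d dvd n \<and> 3 \<le> multiplicity 2 (n div d)}"
  then obtain i g where ig: "i \<le> Suc (Suc r)" "g dvd m" "d = 2 ^ i * g"
    unfolding dvd_n_iff by blast
  moreover have "i < r" using d multiplicity_codivisor[OF ig(2,1)] ig by auto
  ultimately show "d \<in> {2 ^ i * g |i g. i < r \<and> g dvd m}" by blast
next
  fix d assume "d \<in> {2 ^ i * g |i g. i < r \<and> g dvd m}"
  then obtain i g where ig: "i < r" "g dvd m" "d = 2 ^ i * g" by blast
  then have "d dvd n" unfolding dvd_n_iff by (intro exI[of _ i]) auto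
  then show "d \<in> {d. d dvd n \<and> 3 \<le> multiplicity 2 (n div d)}"
    using multiplicity_codivisor[OF ig(2), of i] ig by simp
qed

lemma divisor_cases:
  assumes "d dvd n" "d \<noteq> n"
  obtains (high) i g where "i < r" "g dvd m" "d = 2 ^ i * g"
    | (quarter) "d = 2 ^ r * m" | (half) "d = 2 ^ Suc r * m"
    | (two) g where "g dvd m" "g \<noteq> m" "d = 2 ^ r * g"
    | (one) g where "g dvd m" "g \<noteq> m" "d = 2 ^ Suc r * g"
    | (zero) g where "g dvd m" "g \<noteq> m" "d = 2 ^ Suc (Suc r) * g"
proof -
  from assms(1) obtain i g where ig: "i \<le> Suc (Suc r)" "g dvd m" "d = 2 ^ i * g"
    unfolding dvd_n_iff by blast
  from ig(1) consider "i < r" | "i = r" | "i = Suc r" | "i = Suc (Suc r)" by linarith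
  then show thesis
  proof cases
    case 1
    then show thesis using high ig by blast
  next
    case 2
    then show thesis using quarter two ig by (cases "g = m") auto
  next
    case 3
    then show thesis using half one ig by (cases "g = m") auto
  next
    case 4
    then show thesis using zero ig assms(2) n_eq by (cases "g = m") auto
  qed
qed

lemma dyadic_proper_divisor:
  assumes "g dvd m" "i < Suc (Suc r) \<or> g \<noteq> m" "i \<le> Suc (Suc r)"
  shows "2 ^ i * g dvd n" "2 ^ i * g \<noteq> n"
proof -
  show "2 ^ i * g dvd n" unfolding dvd_n_iff using assms by blast
  show "2 ^ i * g \<noteq> n" unfolding n_eq using assms dyadic_eq_iff[OF assms(1), of m i "Suc (Suc r)"] by auto
qed

lemma mem_dyadic_image:
  assumes "g dvd m" "E \<subseteq> {g. g dvd m \<and> g \<noteq> m}"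
  shows "2 ^ i * g \<in> (\<lambda>g. 2 ^ j * g) ` E \<longleftrightarrow> i = j \<and> g \<in> E"
  using assms dyadic_eq_iff[OF assms(1)] by (auto simp: image_iff)

lemma scaled_images:
  fixes E :: "nat set"
  shows
  "(\<lambda>x. 2 * x) ` (\<lambda>g. 2 ^ r * g) ` E = (\<lambda>g. 2 ^ Suc r * g) ` E"
  "(\<lambda>x. 4 * x) ` (\<lambda>g. 2 ^ r * g) ` E = (\<lambda>g. 2 ^ Suc (Suc r) * g) ` E"
  unfolding image_image by (rule image_cong; simp add: mult.assoc)+

context
  fixes c :: "int \<Rightarrow> int"
  assumes c01: "\<And>k. c k \<in> {0, 1}" and c0: "c 0 = 0"
begin

lemma c_eqI: "(c j = 1 \<longleftrightarrow> c k = 1) \<Longrightarrow> c j = c k"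
  using c01[of j] c01[of k] by auto

lemma supp_iff: "gcd_support n c D \<longleftrightarrow>
    gcd_invariant n c \<and> (\<forall>d. d dvd n \<and> d \<noteq> n \<longrightarrow> (c (int d) = 1 \<longleftrightarrow> d \<in> D))"
  by (rule gcd_support_iff) (use n_pos c01 c0 in auto)

text \<open>
Every proper divisor of \<open>n\<close> is \<open>2\<^sup>i g\<close> with \<open>g | m\<close>. The set \<open>F\<close> collects \<open>i < r\<close>, where there
are no relations. The three sets built from \<open>E\<close> collect the triples \<open>2\<^sup>r g\<close>, \<open>2\<^bsup>r+1\<^esup> g\<close>,
\<open>2\<^bsup>r+2\<^esup> g\<close> with \<open>g \<noteq> m\<close>, on which \<open>c\<close> is constant, and \<open>\<xi>\<close> is the one of \<open>n/4\<close> and \<open>n/2\<close> where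
\<open>c\<close> is 1.
\<close>

lemma plain_profile_iff_gcd_support:
  "gcd_invariant n c \<and> plain_profile r m c \<longleftrightarrow>
    (\<exists>E F \<xi>. E \<subseteq> val2_divisors n \<and> F \<subseteq> {d. d dvd n \<and> 3 \<le> multiplicity 2 (n div d)} \<and>
       \<xi> \<in> {n div 4, n div 2} \<and>
       gcd_support n c (F \<union> E \<union> (\<lambda>x. 2 * x) ` E \<union> (\<lambda>x. 4 * x) ` E \<union> {\<xi>}))"
proof
  assume *: "gcd_invariant n c \<and> plain_profile r m c"
  then have dist: "c (int (2 ^ r * m)) \<noteq> c (int (2 ^ Suc r * m))"
    and triple: "\<And>g. g dvd m \<Longrightarrow> g \<noteq> m \<Longrightarrow> c (int (2 ^ Suc (Suc r) * g)) = c (int (2 ^ Suc r * g)) \<and>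
        c (int (2 ^ Suc (Suc r) * g)) = c (int (2 ^ r * g))"
    unfolding plain_profile_def by blast+
  define E' where "E' = {g. g dvd m \<and> g \<noteq> m \<and> c (int (2 ^ r * g)) = 1}"
  define E where "E = (\<lambda>g. 2 ^ r * g) ` E'"
  define F where "F = {2 ^ i * g |i g. i < r \<and> g dvd m \<and> c (int (2 ^ i * g)) = 1}"
  define \<xi> where "\<xi> = (if c (int (2 ^ r * m)) = 1 then 2 ^ r * m else 2 ^ Suc r * m)"
  define D where "D = F \<union> E \<union> (\<lambda>x. 2 * x) ` E \<union> (\<lambda>x. 4 * x) ` E \<union> {\<xi>}"
  have E': "E' \<subseteq> {g. g dvd m \<and> g \<noteq> m}" by (auto simp: E'_def)
  have D_eq: "D = F \<union> (\<lambda>g. 2 ^ r * g) ` E' \<union> (\<lambda>g. 2 ^ Suc r * g) ` E'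
      \<union> (\<lambda>g. 2 ^ Suc (Suc r) * g) ` E' \<union> {\<xi>}"
    unfolding D_def E_def scaled_images ..
  have F_mem: "2 ^ i * g \<in> F \<longleftrightarrow> i < r \<and> c (int (2 ^ i * g)) = 1" if "g dvd m" for i g
    unfolding F_def using that by (auto simp: dyadic_eq_iff)
  have \<xi>_mem: "2 ^ i * g = \<xi> \<longleftrightarrow> g = m \<and> i = (if c (int (2 ^ r * m)) = 1 then r else Suc r)"
    if "g dvd m" for i g
    unfolding \<xi>_def using dyadic_eq_iff[OF that dvd_refl, of i r] dyadic_eq_iff[OF that dvd_refl, of i "Suc r"]
    by (auto simp del: power_Suc)
  have D_mem: "2 ^ i * g \<in> D \<longleftrightarrow> (i < r \<and> c (int (2 ^ i * g)) = 1) \<or>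
      (i \<in> {r, Suc r, Suc (Suc r)} \<and> g \<in> E') \<or>
      (g = m \<and> i = (if c (int (2 ^ r * m)) = 1 then r else Suc r))" if "g dvd m" for i g
    unfolding D_eq Un_iff F_mem[OF that] mem_dyadic_image[OF that E'] singleton_iff \<xi>_mem[OF that]
    by auto
  have "c (int d) = 1 \<longleftrightarrow> d \<in> D" if "d dvd n" "d \<noteq> n" for d
    using that
  proof (cases rule: divisor_cases)
    case (high i g)
    then show ?thesis using D_mem[of g i] by auto
  next
    case quarter
    then show ?thesis using D_mem[of m r] by (auto simp: E'_def)
  next
    case half
    have "c (int (2 ^ Suc r * m)) = 1 \<longleftrightarrow> c (int (2 ^ r * m)) \<noteq> 1"
      using dist c01[of "int (2 ^ Suc r * m)"] c01[of "int (2 ^ r * m)"] by auto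
    then show ?thesis using half D_mem[of m "Suc r"] by (auto simp: E'_def)
  next
    case (two g)
    then show ?thesis using D_mem[of g r] by (auto simp: E'_def)
  next
    case (one g)
    then show ?thesis using D_mem[of g "Suc r"] triple[of g] by (auto simp: E'_def)
  next
    case (zero g)
    then show ?thesis using D_mem[of g "Suc (Suc r)"] triple[of g] by (auto simp: E'_def)
  qed
  then have "gcd_support n c D"
    using * supp_iff[of D] by blast
  moreover have "E \<subseteq> val2_divisors n" unfolding E_def val2_divisors_eq using E' by blast
  moreover have "F \<subseteq> {d. d dvd n \<and> 3 \<le> multiplicity 2 (n div d)}"
    unfolding high_divisors_eq F_def by blast
  moreover have "\<xi> \<in> {n div 4, n div 2}" unfolding quarter_eq half_eq by (simp add: \<xi>_def)
  ultimately show "\<exists>E F \<xi>. E \<subseteq> val2_divisors n \<and> F \<subseteq> {d. d dvd n \<and> 3 \<le> multiplicity 2 (n div d)} \<and>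
       \<xi> \<in> {n div 4, n div 2} \<and>
       gcd_support n c (F \<union> E \<union> (\<lambda>x. 2 * x) ` E \<union> (\<lambda>x. 4 * x) ` E \<union> {\<xi>})"
    unfolding D_def by blast
next
  assume "\<exists>E F \<xi>. E \<subseteq> val2_divisors n \<and> F \<subseteq> {d. d dvd n \<and> 3 \<le> multiplicity 2 (n div d)} \<and>
       \<xi> \<in> {n div 4, n div 2} \<and>
       gcd_support n c (F \<union> E \<union> (\<lambda>x. 2 * x) ` E \<union> (\<lambda>x. 4 * x) ` E \<union> {\<xi>})"
  then obtain E F \<xi> where E: "E \<subseteq> val2_divisors n"
    and F: "F \<subseteq> {d. d dvd n \<and> 3 \<le> multiplicity 2 (n div d)}"
    and \<xi>: "\<xi> = 2 ^ r * m \<or> \<xi> = 2 ^ Suc r * m"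
    and supp: "gcd_support n c (F \<union> E \<union> (\<lambda>x. 2 * x) ` E \<union> (\<lambda>x. 4 * x) ` E \<union> {\<xi>})"
    unfolding quarter_eq half_eq by blast
  from E obtain E' where E': "E = (\<lambda>g. 2 ^ r * g) ` E'" "E' \<subseteq> {g. g dvd m \<and> g \<noteq> m}"
    unfolding val2_divisors_eq by (meson subset_imageE)
  define D where "D = F \<union> E \<union> (\<lambda>x. 2 * x) ` E \<union> (\<lambda>x. 4 * x) ` E \<union> {\<xi>}"
  have D_eq: "D = F \<union> (\<lambda>g. 2 ^ r * g) ` E' \<union> (\<lambda>g. 2 ^ Suc r * g) ` E'
      \<union> (\<lambda>g. 2 ^ Suc (Suc r) * g) ` E' \<union> {\<xi>}"
    unfolding D_def E' scaled_images ..
  have F_mem: "2 ^ i * g \<notin> F" if "g dvd m" "i \<ge> r" for i g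
  proof
    assume "2 ^ i * g \<in> F"
    then obtain i' g' where "2 ^ i * g = 2 ^ i' * g'" "i' < r" "g' dvd m"
      using F unfolding high_divisors_eq by blast
    then show False using dyadic_eq_iff[OF that(1)] that(2) by auto
  qed
  have inv: "gcd_invariant n c" and D: "\<And>d. d dvd n \<Longrightarrow> d \<noteq> n \<Longrightarrow> c (int d) = 1 \<longleftrightarrow> d \<in> D"
    using supp supp_iff[of D] unfolding D_def by blast+
  have D_mem: "2 ^ i * g \<in> D \<longleftrightarrow> (i \<in> {r, Suc r, Suc (Suc r)} \<and> g \<in> E') \<or> 2 ^ i * g = \<xi>"
    if "g dvd m" "i \<ge> r" for i g
    unfolding D_eq Un_iff mem_dyadic_image[OF that(1) E'(2)] singleton_iff
    using F_mem[OF that] by auto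
  have m_E': "m \<notin> E'" using E'(2) by blast
  have "c (int (2 ^ r * m)) = 1 \<longleftrightarrow> 2 ^ r * m = \<xi>"
    using D[OF dyadic_proper_divisor[of m r]] D_mem[of m r] m_E' by simp
  moreover have "c (int (2 ^ Suc r * m)) = 1 \<longleftrightarrow> 2 ^ Suc r * m = \<xi>"
    using D[OF dyadic_proper_divisor[of m "Suc r"]] D_mem[of m "Suc r"] m_E' by simp
  moreover have "2 ^ r * m \<noteq> 2 ^ Suc r * m" using m_pos by simp
  ultimately have "c (int (2 ^ r * m)) \<noteq> c (int (2 ^ Suc r * m))" using \<xi> by metis
  moreover have "c (int (2 ^ i * g)) = 1 \<longleftrightarrow> g \<in> E'"
    if "g dvd m" "g \<noteq> m" "i \<in> {r, Suc r, Suc (Suc r)}" for i g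
  proof -
    have "2 ^ i * g \<noteq> \<xi>" using \<xi> that dyadic_eq_iff[OF that(1) dvd_refl] by metis
    moreover have "c (int (2 ^ i * g)) = 1 \<longleftrightarrow> 2 ^ i * g \<in> D"
      by (rule D; rule dyadic_proper_divisor) (use that in auto)
    moreover have "i \<ge> r" using that(3) by auto
    ultimately show ?thesis using D_mem[of g i] that by blast
  qed
  then have "c (int (2 ^ Suc (Suc r) * g)) = c (int (2 ^ Suc r * g)) \<and>
        c (int (2 ^ Suc (Suc r) * g)) = c (int (2 ^ r * g))" if "g dvd m" "g \<noteq> m" for g
    using that by (intro conjI c_eqI) blast+
  ultimately show "gcd_invariant n c \<and> plain_profile r m c"
    using inv unfolding plain_profile_def by blast
qed

text \<open>
Now \<open>E\<close> collects the odd \<open>g\<close>, and the doubles and quadruples are those of the complement. The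
condition \<open>E \<noteq> {} \<or> \<rho> = 1\<close> says that \<open>c\<close> is 1 at some odd divisor of \<open>n\<close>, and by
gcd-invariance this is the same as at some odd integer.
\<close>

lemma twisted_profile_iff_gcd_support:
  assumes r: "r = 0"
  shows "gcd_invariant n c \<and> twisted_profile m c \<and> (\<exists>k. odd k \<and> c k = 1) \<longleftrightarrow>
    (\<exists>E. E \<subseteq> val2_divisors n \<and> (\<exists>\<rho>\<in>{0, 1::nat}. (E \<noteq> {} \<or> \<rho> = 1) \<and>
       gcd_support n c (E \<union> (\<lambda>x. 2 * x) ` (val2_divisors n - E) \<union> (\<lambda>x. 4 * x) ` (val2_divisors n - E)
         \<union> (if \<rho> = 1 then {n div 4, n div 2} else {}))))"
proof -
  have val2: "val2_divisors n = {g. g dvd m \<and> g \<noteq> m}"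
    unfolding val2_divisors_eq r by simp
  have n4: "n = 4 * m" using n_eq r by simp
  have quarter: "n div 4 = m" and half: "n div 2 = 2 * m" by (simp_all add: n4)
  have eq_iff: "g = g' \<longleftrightarrow> g = g'" "g \<noteq> 2 * g'" "g \<noteq> 4 * g'" "2 * g \<noteq> g'" "4 * g \<noteq> g'"
    "2 * g \<noteq> 4 * g'" "4 * g \<noteq> 2 * g'" if "g dvd m" "g' dvd m" for g g'
    using odd_divisor[OF that(1)] odd_divisor[OF that(2)] by presburger+
  define D where "D = (\<lambda>E \<rho>. E \<union> (\<lambda>x. 2 * x) ` (val2_divisors n - E) \<union> (\<lambda>x. 4 * x) ` (val2_divisors n - E)
         \<union> (if \<rho> = (1::nat) then {n div 4, n div 2} else {}))"
  have mem: "g \<in> D E \<rho> \<longleftrightarrow> (if g = m then \<rho> = 1 else g \<in> E)"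
    "2 * g \<in> D E \<rho> \<longleftrightarrow> (if g = m then \<rho> = 1 else g \<notin> E)"
    "4 * g \<in> D E \<rho> \<longleftrightarrow> g \<noteq> m \<and> g \<notin> E"
    if g: "g dvd m" and E: "E \<subseteq> {g. g dvd m \<and> g \<noteq> m}" for g E \<rho>
  proof -
    have E_dvd: "x dvd m" "x \<noteq> m" if "x \<in> E" for x using E that by blast+
    have E_odd: "2 * x \<notin> E" "4 * x \<notin> E" for x
      using odd_divisor[OF E_dvd(1), of "2 * x"] odd_divisor[OF E_dvd(1), of "4 * x"] by auto
    show "g \<in> D E \<rho> \<longleftrightarrow> (if g = m then \<rho> = 1 else g \<in> E)"
      unfolding D_def val2 quarter half using g E_dvd E_odd eq_iff[OF g] by (auto simp: image_iff)
    show "2 * g \<in> D E \<rho> \<longleftrightarrow> (if g = m then \<rho> = 1 else g \<notin> E)"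
      unfolding D_def val2 quarter half using g E_dvd E_odd eq_iff[OF g] by (auto simp: image_iff)
    show "4 * g \<in> D E \<rho> \<longleftrightarrow> g \<noteq> m \<and> g \<notin> E"
      unfolding D_def val2 quarter half using g E_dvd E_odd eq_iff[OF g] by (auto simp: image_iff)
  qed
  have supp: "gcd_support n c (D E \<rho>) \<longleftrightarrow> gcd_invariant n c \<and>
      (c (int m) = 1 \<longleftrightarrow> \<rho> = 1) \<and> (c (int (2 * m)) = 1 \<longleftrightarrow> \<rho> = 1) \<and>
      (\<forall>g. g dvd m \<and> g \<noteq> m \<longrightarrow> (c (int g) = 1 \<longleftrightarrow> g \<in> E) \<and> (c (int (2 * g)) = 1 \<longleftrightarrow> g \<notin> E) \<and>
         (c (int (4 * g)) = 1 \<longleftrightarrow> g \<notin> E))" (is "_ \<longleftrightarrow> ?R")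
    if E: "E \<subseteq> {g. g dvd m \<and> g \<noteq> m}" for E \<rho>
  proof
    assume "gcd_support n c (D E \<rho>)"
    then have inv: "gcd_invariant n c"
      and D: "\<And>d. d dvd n \<Longrightarrow> d \<noteq> n \<Longrightarrow> c (int d) = 1 \<longleftrightarrow> d \<in> D E \<rho>"
      using supp_iff[of "D E \<rho>"] by blast+
    have "m dvd n" "m \<noteq> n" "2 * m dvd n" "2 * m \<noteq> n" using m_pos by (auto simp: n4)
    then have "(c (int m) = 1 \<longleftrightarrow> \<rho> = 1) \<and> (c (int (2 * m)) = 1 \<longleftrightarrow> \<rho> = 1)"
      using D mem(1,2)[OF dvd_refl E] by metis
    moreover have "(c (int g) = 1 \<longleftrightarrow> g \<in> E) \<and> (c (int (2 * g)) = 1 \<longleftrightarrow> g \<notin> E) \<and>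
         (c (int (4 * g)) = 1 \<longleftrightarrow> g \<notin> E)" if "g dvd m" "g \<noteq> m" for g
    proof -
      have "g dvd n" "g \<noteq> n" "2 * g dvd n" "2 * g \<noteq> n" "4 * g dvd n" "4 * g \<noteq> n"
        using that eq_iff[OF that(1) dvd_refl] by (auto simp: n4 intro: mult_dvd_mono dvd_mult)
      then show ?thesis using D mem[OF that(1) E] that(2) by metis
    qed
    ultimately show ?R using inv by blast
  next
    assume R: ?R
    have "c (int d) = 1 \<longleftrightarrow> d \<in> D E \<rho>" if "d dvd n" "d \<noteq> n" for d
      using that
    proof (cases rule: divisor_cases)
      case (high i g)
      then show ?thesis using r by simp
    next
      case quarter
      then show ?thesis using R mem(1)[OF dvd_refl E] r by simp
    next
      case half
      then show ?thesis using R mem(2)[OF dvd_refl E] r by simp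
    next
      case (two g)
      then show ?thesis using R mem(1)[OF two(1) E] r by simp
    next
      case (one g)
      then show ?thesis using R mem(2)[OF one(1) E] r by simp
    next
      case (zero g)
      then show ?thesis using R mem(3)[OF zero(1) E] r by simp
    qed
    then show "gcd_support n c (D E \<rho>)"
      using R supp_iff[of "D E \<rho>"] by blast
  qed
  have odd_val: "\<exists>g. g dvd m \<and> c (int g) = 1" if "gcd_invariant n c" "odd k" "c k = 1" for k
  proof -
    define d where "d = nat (gcd k (int n))"
    have d: "int d = gcd k (int n)" by (simp add: d_def)
    then have "int d dvd int n" "int d dvd k" by simp_all
    then have "odd d" "d dvd n" using that(2) by (auto dest: dvd_trans)
    moreover have "coprime d (2 * 2)" using \<open>odd d\<close> by (simp only: coprime_mult_right_iff) simp
    then have "coprime d 4" by simp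
    ultimately have "d dvd m" unfolding n4 using coprime_dvd_mult_right_iff by blast
    moreover have "c (int d) = c k" by (rule gcd_invariantD[OF that(1)]) (simp add: d)
    ultimately show ?thesis using that(3) by auto
  qed
  have "gcd_invariant n c \<and> twisted_profile m c \<and> (\<exists>k. odd k \<and> c k = 1) \<longleftrightarrow>
    (\<exists>E. E \<subseteq> val2_divisors n \<and> (\<exists>\<rho>\<in>{0, 1}. (E \<noteq> {} \<or> \<rho> = 1) \<and> gcd_support n c (D E \<rho>)))"
  proof
    assume *: "gcd_invariant n c \<and> twisted_profile m c \<and> (\<exists>k. odd k \<and> c k = 1)"
    define E where "E = {g. g dvd m \<and> g \<noteq> m \<and> c (int g) = 1}"
    define \<rho> :: nat where "\<rho> = (if c (int m) = 1 then 1 else 0)"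
    have E: "E \<subseteq> {g. g dvd m \<and> g \<noteq> m}" by (auto simp: E_def)
    have flip: "c (int (4 * g)) = 1 \<longleftrightarrow> c (int g) \<noteq> 1" "c (int (2 * g)) = c (int (4 * g))"
      if "g dvd m" "g \<noteq> m" for g
      using * that c01[of "int (4 * g)"] c01[of "int g"] unfolding twisted_profile_def by auto
    have "c (int (2 * m)) = c (int m)" using * unfolding twisted_profile_def by simp
    then have "gcd_support n c (D E \<rho>)"
      unfolding supp[OF E] using * flip by (auto simp: E_def \<rho>_def)
    moreover have "E \<noteq> {} \<or> \<rho> = 1"
    proof -
      obtain g where "g dvd m" "c (int g) = 1" using * odd_val by blast
      then show ?thesis by (cases "g = m") (auto simp: E_def \<rho>_def)
    qed
    moreover have "\<rho> \<in> {0, 1}" by (simp add: \<rho>_def)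
    ultimately show "\<exists>E. E \<subseteq> val2_divisors n \<and> (\<exists>\<rho>\<in>{0, 1}. (E \<noteq> {} \<or> \<rho> = 1) \<and> gcd_support n c (D E \<rho>))"
      using E val2 by blast
  next
    assume "\<exists>E. E \<subseteq> val2_divisors n \<and> (\<exists>\<rho>\<in>{0, 1}. (E \<noteq> {} \<or> \<rho> = 1) \<and> gcd_support n c (D E \<rho>))"
    then obtain E \<rho> where E: "E \<subseteq> {g. g dvd m \<and> g \<noteq> m}" and ne: "E \<noteq> {} \<or> \<rho> = 1"
      and "gcd_support n c (D E \<rho>)" unfolding val2 by blast
    then have R: "gcd_invariant n c" "c (int m) = 1 \<longleftrightarrow> \<rho> = 1" "c (int (2 * m)) = 1 \<longleftrightarrow> \<rho> = 1"
      "\<And>g. g dvd m \<Longrightarrow> g \<noteq> m \<Longrightarrow> (c (int g) = 1 \<longleftrightarrow> g \<in> E) \<and> (c (int (2 * g)) = 1 \<longleftrightarrow> g \<notin> E) \<and>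
         (c (int (4 * g)) = 1 \<longleftrightarrow> g \<notin> E)"
      using supp[OF E] by blast+
    have "c (int m) = c (int (2 * m))" using R(2,3) by (intro c_eqI) blast
    moreover have "c (int (4 * g)) = c (int (2 * g)) \<and> c (int (4 * g)) \<noteq> c (int g)"
      if "g dvd m" "g \<noteq> m" for g
      using R(4)[OF that] by (intro conjI c_eqI) metis+
    moreover have "\<exists>k. odd k \<and> c k = 1"
    proof (cases "\<rho> = 1")
      case True
      then show ?thesis using R(2) m_odd by (intro exI[of _ "int m"]) auto
    next
      case False
      then obtain g where "g \<in> E" using ne by blast
      then show ?thesis using E R(4)[of g] odd_divisor[of g] by (intro exI[of _ "int g"]) auto
    qed
    ultimately show "gcd_invariant n c \<and> twisted_profile m c \<and> (\<exists>k. odd k \<and> c k = 1)"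
      using R(1) unfolding twisted_profile_def by blast
  qed
  then show ?thesis unfolding D_def .
qed

lemma quarter_profile_iff:
  assumes s: "s0 \<in> {0, 1}" "s1 \<in> {0, 1}"
  shows "quarter_profile r m (\<lambda>k. c k - parity_fun s0 s1 k) \<longleftrightarrow>
    (if r = 0 \<and> s0 \<noteq> s1 then twisted_profile m c else plain_profile r m c)"
proof (cases "r = 0 \<and> s0 \<noteq> s1")
  case True
  have par: "parity_fun s0 s1 (int g) = s1" "parity_fun s0 s1 (int (2 * g)) = s0"
    "parity_fun s0 s1 (int (4 * g)) = s0" if "g dvd m" for g
    using odd_divisor[OF that] by (simp_all add: parity_fun_def)
  have diff: "odd (c j - s1 - (c k - s0)) \<longleftrightarrow> c j = c k" "even (c k - s0 - (c j - s1)) \<longleftrightarrow> c k \<noteq> c j" for j k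
    using True s c01[of j] c01[of k] by auto
  let ?X = "\<lambda>k. c k - parity_fun s0 s1 k"
  have vals: "odd (?X (int g) - ?X (int (2 * g))) \<longleftrightarrow> c (int g) = c (int (2 * g))"
    "?X (int (4 * g)) = ?X (int (2 * g)) \<longleftrightarrow> c (int (4 * g)) = c (int (2 * g))"
    "even (?X (int (4 * g)) - ?X (int g)) \<longleftrightarrow> c (int (4 * g)) \<noteq> c (int g)" if "g dvd m" for g
    unfolding par[OF that] diff by simp_all
  have "quarter_profile r m ?X \<longleftrightarrow> odd (?X (int m) - ?X (int (2 * m))) \<and>
      (\<forall>g. g dvd m \<and> g \<noteq> m \<longrightarrow> ?X (int (4 * g)) = ?X (int (2 * g)) \<and> even (?X (int (4 * g)) - ?X (int g)))"
    using True by (simp add: quarter_profile_def)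
  also have "\<dots> \<longleftrightarrow> twisted_profile m c"
    unfolding twisted_profile_def vals(1)[OF dvd_refl] using vals(2,3) by blast
  finally have "quarter_profile r m ?X \<longleftrightarrow> twisted_profile m c" .
  then show ?thesis using True by simp
next
  case False
  have par: "parity_fun s0 s1 (int (2 ^ Suc r * g)) = parity_fun s0 s1 (int (2 ^ r * g))"
    "parity_fun s0 s1 (int (2 ^ Suc (Suc r) * g)) = parity_fun s0 s1 (int (2 ^ r * g))" for g
    using False by (auto simp: parity_fun_def)
  have "odd (c j - s - (c k - s)) \<longleftrightarrow> c j \<noteq> c k" "even (c j - s - (c k - s)) \<longleftrightarrow> c j = c k" for j k s
    using c01[of j] c01[of k] by auto
  then have "quarter_profile r m (\<lambda>k. c k - parity_fun s0 s1 k) \<longleftrightarrow> plain_profile r m c"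
    unfolding quarter_profile_def plain_profile_def par by auto
  then show ?thesis using False by auto
qed

end

end

section \<open>Rotations, reflections and connectedness\<close>

text \<open>
Connectedness is used through two-colourings of the vertices: one that is constant along the arcs
is constant.
\<close>

lemma connected_imp_constant:
  assumes con: "Digraph_Component.connected (with_proj X)"
    and closed: "\<And>x y. (x, y) \<in> parcs X \<Longrightarrow> P x \<longleftrightarrow> P y"
    and u: "u \<in> pverts X" "P u" and v: "v \<in> pverts X"
  shows "P v"
proof -
  have "u \<rightarrow>\<^sup>*\<^bsub>with_proj (mk_symmetric (with_proj X))\<^esub> v"
    using con u(1) v unfolding Digraph_Component.connected_def strongly_connected_def by simp
  then have "(u, v) \<in> (parcs (mk_symmetric (with_proj X)))\<^sup>*"
    using reachable_rtranclI by fastforce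
  then show "P v"
  proof (induction rule: rtrancl_induct)
    case (step y z)
    then have "(y, z) \<in> parcs X \<or> (z, y) \<in> parcs X"
      by (auto simp: parcs_mk_symmetric)
    then show ?case using closed step.IH by blast
  qed (rule u(2))
qed

context dihedral
begin

lemma ball_carrier_iff: "(\<forall>x\<in>carrier G. Q x) \<longleftrightarrow> (\<forall>k e. Q (elt k e))"
  unfolding carrier_eq_range by blast

lemma generate_a: "generate G {a} = range (\<lambda>k. elt k False)"
  using generate_pow[OF a_closed] by (auto simp: elt_def)

lemma reflections: "b <# generate G {a} = range (\<lambda>k. elt k True)"
  unfolding generate_a l_coset_def by (auto simp: elt_def)

lemma generate_a_sq: "generate G {a [^] (2::nat)} = range (\<lambda>k. elt (2 * k) False)"
proof -
  have "(a [^] (2::nat)) [^] k = a [^] (2 * k)" for k :: int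
    using int_pow_pow[OF a_closed, of 2 k] int_pow_int[of G a 2] by simp
  then show ?thesis using generate_pow[of "a [^] (2::nat)"] a_closed by (auto simp: elt_def)
qed

lemma even_reflections: "b <# generate G {a [^] (2::nat)} = range (\<lambda>k. elt (2 * k) True)"
  unfolding generate_a_sq l_coset_def by (auto simp: elt_def)

lemma odd_reflections: "(b \<otimes> a) <# generate G {a [^] (2::nat)} = range (\<lambda>k. elt (2 * k + 1) True)"
proof -
  have "(b \<otimes> a) \<otimes> elt (2 * k) False = elt (2 * k + 1) True" for k
  proof -
    have "b \<otimes> a = elt 1 True" using a_closed by (simp add: elt_def)
    then show ?thesis by (simp add: elt_mult)
  qed
  then show ?thesis unfolding generate_a_sq l_coset_def by auto
qed

context
  assumes n3: "n \<ge> 3"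
begin

lemma n0: "n > 0"
  using n3 by simp

lemma elt_mem_rotations: "elt k e \<in> generate G {a} \<longleftrightarrow> \<not> e"
  unfolding generate_a by (cases e) (auto simp: image_iff elt_eq_iff[OF n0] intro: exI[of _ k])

lemma elt_mem_reflections: "elt k e \<in> b <# generate G {a} \<longleftrightarrow> e"
  unfolding reflections by (cases e) (auto simp: image_iff elt_eq_iff[OF n0] intro: exI[of _ k])

lemma elt_mem_gcd_powers:
  "elt k e \<in> gcd_powers G a n d \<longleftrightarrow> \<not> e \<and> \<not> int n dvd k \<and> nat (gcd k (int n)) = d"
proof
  assume "elt k e \<in> gcd_powers G a n d"
  then obtain l :: nat where l: "elt k e = a [^] l" "1 \<le> l" "l < n" "gcd l n = d"
    unfolding gcd_powers_def by blast
  then have e: "\<not> e" and dvd: "int n dvd k - int l"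
    using elt_eq_iff[OF n0, of k e "int l" False] by (auto simp: elt_eq_pow)
  have "\<not> int n dvd int l" using l by (auto dest: dvd_imp_le)
  moreover have "int n dvd int l" if "int n dvd k"
    using dvd_diff[OF that dvd] by simp
  ultimately have "\<not> int n dvd k" by blast
  moreover have "gcd k (int n) = gcd (int l) (int n)"
    using dvd by (metis gcd_red_int mod_eq_dvd_iff gcd.commute)
  ultimately show "\<not> e \<and> \<not> int n dvd k \<and> nat (gcd k (int n)) = d" using e l(4) by simp
next
  assume *: "\<not> e \<and> \<not> int n dvd k \<and> nat (gcd k (int n)) = d"
  define l where "l = nat (k mod int n)"
  have il: "int l = k mod int n" using n0 by (simp add: l_def)
  then have "int l < int n" using n0 by simp
  then have "l < n" by simp
  moreover have "l \<noteq> 0" using il * by (metis dvd_eq_mod_eq_0 of_nat_0)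
  moreover have "gcd (int l) (int n) = gcd k (int n)"
    unfolding il by (metis gcd_red_int gcd.commute)
  then have "gcd l n = d" using * by (metis gcd_int_int_eq nat_int)
  moreover have "elt k e = a [^] l"
    unfolding elt_eq_pow il using * by (auto intro!: elt_cong simp: mod_eq_dvd_iff[symmetric])
  ultimately show "elt k e \<in> gcd_powers G a n d" unfolding gcd_powers_def by force
qed

context
  fixes S
  assumes S: "S \<subseteq> carrier G - {\<one>}" and conj: "conj_closed G S"
begin

lemma rotations_eq_gcd_powers_iff:
  "S \<inter> generate G {a} = (\<Union>d\<in>D. gcd_powers G a n d) \<longleftrightarrow> gcd_support n (conn S False) D"
proof -
  have gp: "gcd_powers G a n d \<subseteq> carrier G" for d
    by (auto simp: gcd_powers_def a_closed)
  have "S \<inter> generate G {a} = (\<Union>d\<in>D. gcd_powers G a n d) \<longleftrightarrow>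
      (\<forall>x\<in>carrier G. x \<in> S \<inter> generate G {a} \<longleftrightarrow> x \<in> (\<Union>d\<in>D. gcd_powers G a n d))"
    using S gp by blast
  also have "\<dots> \<longleftrightarrow> (\<forall>k e. elt k e \<in> S \<inter> generate G {a} \<longleftrightarrow> elt k e \<in> (\<Union>d\<in>D. gcd_powers G a n d))"
    by (rule ball_carrier_iff)
  also have "\<dots> \<longleftrightarrow> gcd_support n (conn S False) D"
    unfolding gcd_support_def conn_def
    by (simp add: elt_mem_gcd_powers elt_mem_rotations all_bool_eq) blast
  finally show ?thesis .
qed

lemma conn_rotation_0: "conn S False 0 = 0"
  using S elt_0 by (auto simp: conn_def)

lemma reflection_mem_iff: "elt k True \<in> S \<longleftrightarrow> (if even k then conn S True 0 else conn S True 1) = 1"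
proof -
  have "conn S True k = (if even k then conn S True 0 else conn S True 1)"
    by (subst conn_reflection_eq_parity_fun[OF conj]) (simp add: parity_fun_def)
  then show ?thesis by (simp add: conn_def split: if_splits)
qed

lemma reflection_set_eq_iff:
  assumes "\<And>k f. elt k f \<in> T \<longleftrightarrow> f \<and> Q k" "T \<subseteq> carrier G"
  shows "S \<inter> (b <# generate G {a}) = T \<longleftrightarrow> (\<forall>k. elt k True \<in> S \<longleftrightarrow> Q k)"
proof -
  have "S \<inter> (b <# generate G {a}) = T \<longleftrightarrow>
      (\<forall>x\<in>carrier G. x \<in> S \<inter> (b <# generate G {a}) \<longleftrightarrow> x \<in> T)"
    using S assms(2) by blast
  also have "\<dots> \<longleftrightarrow> (\<forall>k f. elt k f \<in> S \<inter> (b <# generate G {a}) \<longleftrightarrow> elt k f \<in> T)"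
    by (rule ball_carrier_iff)
  also have "\<dots> \<longleftrightarrow> (\<forall>k. elt k True \<in> S \<longleftrightarrow> Q k)"
    by (simp add: elt_mem_reflections assms(1) all_bool_eq)
  finally show ?thesis .
qed

lemma reflections_full_iff:
  "S \<inter> (b <# generate G {a}) = b <# generate G {a} \<longleftrightarrow> conn S True 0 = 1 \<and> conn S True 1 = 1"
proof -
  have "S \<inter> (b <# generate G {a}) = b <# generate G {a} \<longleftrightarrow> (\<forall>k. elt k True \<in> S \<longleftrightarrow> True)"
    by (rule reflection_set_eq_iff) (simp_all add: elt_mem_reflections, auto simp: reflections)
  also have "\<dots> \<longleftrightarrow> conn S True 0 = 1 \<and> conn S True 1 = 1"
    unfolding reflection_mem_iff by (metis even_zero odd_one)
  finally show ?thesis .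
qed

lemma reflections_empty_iff:
  "S \<inter> (b <# generate G {a}) = {} \<longleftrightarrow> conn S True 0 = 0 \<and> conn S True 1 = 0"
proof -
  have "S \<inter> (b <# generate G {a}) = {} \<longleftrightarrow> (\<forall>k. elt k True \<in> S \<longleftrightarrow> False)"
    by (rule reflection_set_eq_iff) auto
  also have "\<dots> \<longleftrightarrow> conn S True 0 = 0 \<and> conn S True 1 = 0"
    unfolding reflection_mem_iff using conn_01[of S True 0] conn_01[of S True 1]
    by (metis even_zero odd_one insert_iff singletonD zero_neq_one)
  finally show ?thesis .
qed

lemma elt_mem_progression:
  assumes "even n"
  shows "elt j f \<in> range (\<lambda>k. elt (2 * k + d) True) \<longleftrightarrow> f \<and> even (j - d)"
proof
  assume "elt j f \<in> range (\<lambda>k. elt (2 * k + d) True)"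
  then obtain k where "int n dvd j - (2 * k + d)" "f" using elt_eq_iff[OF n0] by auto
  then have "even (j - (2 * k + d))" using assms by (meson dvd_trans even_of_nat)
  then show "f \<and> even (j - d)" using \<open>f\<close> by simp
next
  assume "f \<and> even (j - d)"
  moreover from this obtain k where "j - d = 2 * k" using evenE by blast
  then have "j = 2 * k + d" by simp
  ultimately show "elt j f \<in> range (\<lambda>k. elt (2 * k + d) True)" by auto
qed

lemma reflections_half_iff:
  assumes "even n"
  shows "S \<inter> (b <# generate G {a}) \<in> {b <# generate G {a [^] (2::nat)}, (b \<otimes> a) <# generate G {a [^] (2::nat)}}
    \<longleftrightarrow> conn S True 0 \<noteq> conn S True 1"
proof -
  have "S \<inter> (b <# generate G {a}) = b <# generate G {a [^] (2::nat)} \<longleftrightarrow> (\<forall>k. elt k True \<in> S \<longleftrightarrow> even k)"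
    unfolding even_reflections using elt_mem_progression[OF assms, of _ _ 0]
    by (intro reflection_set_eq_iff) auto
  also have "\<dots> \<longleftrightarrow> conn S True 0 = 1 \<and> conn S True 1 = 0"
    unfolding reflection_mem_iff using conn_01[of S True 1]
    by (metis even_zero odd_one insert_iff singletonD zero_neq_one)
  finally have e: "S \<inter> (b <# generate G {a}) = b <# generate G {a [^] (2::nat)} \<longleftrightarrow>
      conn S True 0 = 1 \<and> conn S True 1 = 0" .
  have "S \<inter> (b <# generate G {a}) = (b \<otimes> a) <# generate G {a [^] (2::nat)} \<longleftrightarrow> (\<forall>k. elt k True \<in> S \<longleftrightarrow> odd k)"
    unfolding odd_reflections using elt_mem_progression[OF assms, of _ _ 1]
    by (intro reflection_set_eq_iff) auto
  also have "\<dots> \<longleftrightarrow> conn S True 0 = 0 \<and> conn S True 1 = 1"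
    unfolding reflection_mem_iff using conn_01[of S True 0]
    by (metis even_zero odd_one insert_iff singletonD zero_neq_one)
  finally have o: "S \<inter> (b <# generate G {a}) = (b \<otimes> a) <# generate G {a [^] (2::nat)} \<longleftrightarrow>
      conn S True 0 = 0 \<and> conn S True 1 = 1" .
  show ?thesis
    unfolding insert_iff e o using conn_01[of S True 0] conn_01[of S True 1] by auto
qed

text \<open>
With all reflections in \<open>S\<close>, the profile of \<open>c - 1\<close> says that \<open>c\<close> vanishes on the multiples of
\<open>m = n/2\<close> only.
\<close>

lemma half_profile_iff:
  assumes m: "odd m" and n: "n = 2 * m"
  shows "gcd_invariant n (conn S False) \<and> conn S True 0 = 1 \<and> conn S True 1 = 1 \<and>
      half_profile m (\<lambda>k. conn S False k - parity_fun (conn S True 0) (conn S True 1) k)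
    \<longleftrightarrow> S = carrier G - {\<one>, a [^] (n div 2)}"
proof -
  let ?c = "conn S False"
  have m0: "m > 0" using m by (auto intro: Nat.gr0I)
  have par1: "parity_fun 1 1 = (\<lambda>k. 1)" by (simp add: parity_fun_def fun_eq_iff)
  have am: "a [^] (n div 2) = elt (int m) False" unfolding elt_eq_pow n by simp
  have m_dvd: "int m dvd k \<longleftrightarrow> int n dvd k \<or> int n dvd k - int m" for k
  proof
    assume "int m dvd k"
    then obtain j where j: "k = int m * j" ..
    show "int n dvd k \<or> int n dvd k - int m"
    proof (cases "even j")
      case True
      then show ?thesis unfolding j n by auto
    next
      case False
      then have "even (j - 1)" by simp
      then have "int n dvd int m * (j - 1)" unfolding n by auto
      then show ?thesis unfolding j by (simp add: algebra_simps)
    qed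
  next
    assume "int n dvd k \<or> int n dvd k - int m"
    moreover have "int m dvd int n" using n by simp
    ultimately have "int m dvd k \<or> int m dvd k - int m" using dvd_trans by blast
    then show "int m dvd k" using dvd_add[of "int m" "k - int m" "int m"] by auto
  qed
  have excl: "elt k e \<in> carrier G - {\<one>, a [^] (n div 2)} \<longleftrightarrow> e \<or> \<not> int m dvd k" for k e
    unfolding am elt_0[symmetric] m_dvd by (auto simp: elt_eq_iff[OF n0])
  have "S = carrier G - {\<one>, a [^] (n div 2)} \<longleftrightarrow>
      (\<forall>x\<in>carrier G. x \<in> S \<longleftrightarrow> x \<in> carrier G - {\<one>, a [^] (n div 2)})"
    using S by blast
  also have "\<dots> \<longleftrightarrow> (\<forall>k e. elt k e \<in> S \<longleftrightarrow> e \<or> \<not> int m dvd k)"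
    unfolding ball_carrier_iff excl ..
  also have "\<dots> \<longleftrightarrow> (\<forall>k. elt k True \<in> S) \<and> (\<forall>k. elt k False \<in> S \<longleftrightarrow> \<not> int m dvd k)"
    by (auto simp: all_bool_eq)
  also have "(\<forall>k. elt k True \<in> S) \<longleftrightarrow> conn S True 0 = 1 \<and> conn S True 1 = 1"
    unfolding reflection_mem_iff by (metis even_zero odd_one)
  also have "(\<forall>k. elt k False \<in> S \<longleftrightarrow> \<not> int m dvd k) \<longleftrightarrow> (\<forall>k. ?c k = (if int m dvd k then 0 else 1))"
    by (auto simp: conn_def)
  finally have S_iff: "S = carrier G - {\<one>, a [^] (n div 2)} \<longleftrightarrow> (conn S True 0 = 1 \<and> conn S True 1 = 1) \<and>
      (\<forall>k. ?c k = (if int m dvd k then 0 else 1))" .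
  have "gcd_invariant n ?c \<and> half_profile m (\<lambda>k. ?c k - 1) \<longleftrightarrow> (\<forall>k. ?c k = (if int m dvd k then 0 else 1))"
  proof
    assume *: "gcd_invariant n ?c \<and> half_profile m (\<lambda>k. ?c k - 1)"
    then have inv: "gcd_invariant n (\<lambda>k. ?c k - 1)" unfolding gcd_invariant_def by metis
    show "\<forall>k. ?c k = (if int m dvd k then 0 else 1)"
    proof
      fix k
      show "?c k = (if int m dvd k then 0 else 1)"
      proof (cases "int m dvd k")
        case True
        have "?c (int m) = 0"
          using * conn_01[of S False "int m"] unfolding half_profile_def by auto
        moreover have "?c k = ?c 0 \<or> ?c k = ?c (int m)"
          using True periodic_cong[OF periodic_conn, of k _ S False] unfolding m_dvd by auto
        ultimately show ?thesis using True conn_rotation_0 by auto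
      next
        case False
        then have "?c k - 1 = 0" using half_profile_eq_0[OF m n inv] * by blast
        then show ?thesis using False by simp
      qed
    qed
  next
    assume c: "\<forall>k. ?c k = (if int m dvd k then 0 else 1)"
    have "int m dvd k \<longleftrightarrow> int m dvd gcd k (int n)" for k using n by simp
    then have inv: "gcd_invariant n ?c" unfolding gcd_invariant_def using c by metis
    have "\<not> m dvd g \<and> \<not> m dvd 2 * g" if "g dvd m" "g \<noteq> m" for g
    proof -
      have "\<not> m dvd g" using that by (auto dest: dvd_antisym)
      moreover have "coprime m 2" using m by simp
      ultimately show ?thesis using coprime_dvd_mult_right_iff by blast
    qed
    moreover have "?c (int d) = (if m dvd d then 0 else 1)" for d
      using c[rule_format, of "int d"] by (simp only: of_nat_dvd_iff)
    ultimately have "half_profile m (\<lambda>k. ?c k - 1)"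
      unfolding half_profile_def by (simp del: of_nat_mult)
    with inv show "gcd_invariant n ?c \<and> half_profile m (\<lambda>k. ?c k - 1)" by blast
  qed
  then show ?thesis
    unfolding S_iff using par1 by (cases "conn S True 0 = 1 \<and> conn S True 1 = 1") (simp, blast)
qed

context
  assumes connected: "Digraph_Component.connected (with_proj (Cay G S))"
begin

text \<open>
Otherwise the colouring by rotations and reflections is constant along the arcs.
\<close>

lemma reflections_nonempty: "conn S True 0 + conn S True 1 > 0"
proof (rule ccontr)
  assume "\<not> conn S True 0 + conn S True 1 > 0"
  then have no_refl: "elt k True \<notin> S" for k
    using reflection_mem_iff[of k] conn_01[of S True 0] conn_01[of S True 1] by auto
  define P where "P = (\<lambda>x. \<exists>k. x = elt k False)"
  have P: "P (elt k e) \<longleftrightarrow> \<not> e" for k e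
    unfolding P_def by (cases e) (auto simp: elt_eq_iff[OF n0] intro: exI[of _ k])
  have "P (elt 0 True)"
  proof (rule connected_imp_constant[OF connected])
    fix x y assume "(x, y) \<in> parcs (Cay G S)"
    then have "x \<in> carrier G" "y \<in> carrier G" and q: "y \<otimes> inv x \<in> S" by (auto simp: Cay_def)
    then obtain i e j f where xy: "x = elt i e" "y = elt j f" using carrier_eq_range by auto
    have "\<not> (e \<noteq> f)"
      using q no_refl unfolding xy elt_quotient by metis
    then show "P x \<longleftrightarrow> P y" unfolding xy P by simp
  next
    show "P (elt 0 False)" unfolding P by simp
  qed (auto simp: Cay_def)
  then show False unfolding P by simp
qed

text \<open>
Let \<open>S\<^sub>1\<close> be one parity class of reflections and all rotations in \<open>S\<close> be even. Then the parity of
the exponent, shifted on reflections by the parity of that class, is constant along the arcs.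
\<close>

lemma odd_rotation_exists:
  assumes "even n" "conn S True 0 \<noteq> conn S True 1"
  shows "\<exists>k. odd k \<and> conn S False k = 1"
proof (rule ccontr)
  assume "\<not> (\<exists>k. odd k \<and> conn S False k = 1)"
  then have no_odd: "even k" if "elt k False \<in> S" for k using that by (auto simp: conn_def)
  define \<delta> where "\<delta> = conn S True 1"
  have refl: "even k \<longleftrightarrow> even \<delta>" if "elt k True \<in> S" for k
    using that reflection_mem_iff[of k] assms(2) conn_01[of S True 0] conn_01[of S True 1]
    unfolding \<delta>_def by (auto split: if_splits)
  define P where "P = (\<lambda>x. \<exists>i e. x = elt i e \<and> even (i + (if e then \<delta> else 0)))"
  have P: "P (elt i e) \<longleftrightarrow> even (i + (if e then \<delta> else 0))" for i e
  proof
    assume "P (elt i e)"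
    then obtain j where j: "int n dvd i - j" "even (j + (if e then \<delta> else 0))"
      unfolding P_def elt_eq_iff[OF n0] by blast
    then have "even (i - j)" using assms(1) by (meson dvd_trans even_of_nat)
    then have "even ((i - j) + (j + (if e then \<delta> else 0)))" using j(2) by (rule dvd_add)
    then show "even (i + (if e then \<delta> else 0))" by simp
  next
    assume "even (i + (if e then \<delta> else 0))"
    then show "P (elt i e)" unfolding P_def by blast
  qed
  have "P (elt 1 False)"
  proof (rule connected_imp_constant[OF connected])
    fix x y assume "(x, y) \<in> parcs (Cay G S)"
    then have "x \<in> carrier G" "y \<in> carrier G" and q: "y \<otimes> inv x \<in> S" by (auto simp: Cay_def)
    then obtain i e j f where xy: "x = elt i e" "y = elt j f" using carrier_eq_range by auto
    have "even (j - i) \<longleftrightarrow> (e = f \<or> even \<delta>)"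
    proof (cases "e = f")
      case True
      then have "elt (if e then i - j else j - i) False \<in> S" using q unfolding xy elt_quotient by simp
      then have "even (if e then i - j else j - i)" by (rule no_odd)
      then show ?thesis using True by (auto split: if_splits)
    next
      case False
      then have "elt (if e then i - j else j - i) True \<in> S" using q unfolding xy elt_quotient by simp
      then have "even (if e then i - j else j - i) \<longleftrightarrow> even \<delta>" by (rule refl)
      then show ?thesis using False by (auto split: if_splits)
    qed
    then show "P x \<longleftrightarrow> P y" unfolding xy P by auto
  next
    show "P (elt 0 False)" unfolding P by simp
  qed (auto simp: Cay_def)
  then show False unfolding P by simp
qed

lemma pst_at_imp_pst_profile:
  assumes "pst_at (Cay G S) u v t"
  shows "pst_profile n (conn S False) (conn S True 0) (conn S True 1) \<and> pi / 2 \<le> t"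
proof -
  have *: "even n" "0 \<le> t" "phase_alignment n (conn S False) (conn S True) t"
    using assms unfolding pst_at_iff_phase_alignment[OF n3 conj] by blast+
  then have "phase_alignment n (conn S False) (parity_fun (conn S True 0) (conn S True 1)) t"
    by (simp only: conn_reflection_eq_parity_fun[OF conj, symmetric])
  then show ?thesis
    by (rule phase_alignment_imp_pst_profile[OF n0 *(1) periodic_conn conn_01 conn_uminus[OF conj]
      conn_01 conn_01 reflections_nonempty _ *(2)])
qed

lemma pst_profile_imp_pst_at:
  assumes "pst_profile n (conn S False) (conn S True 0) (conn S True 1)" "even n" "u \<in> carrier G"
  shows "pst_at (Cay G S) u (u \<otimes> a [^] (n div 2)) (pi / 2)"
proof -
  have "phase_alignment n (conn S False) (parity_fun (conn S True 0) (conn S True 1)) (pi / 2)"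
    by (rule pst_profile_imp_phase_alignment[OF n0 assms(1) conn_uminus[OF conj]])
  then have "phase_alignment n (conn S False) (conn S True) (pi / 2)"
    by (simp only: conn_reflection_eq_parity_fun[OF conj, symmetric])
  then show ?thesis
    unfolding pst_at_iff_phase_alignment[OF n3 conj] using assms by simp
qed

lemma admits_pst_iff_pst_profile:
  "admits_pst (Cay G S) \<longleftrightarrow> even n \<and> pst_profile n (conn S False) (conn S True 0) (conn S True 1)"
proof
  assume "admits_pst (Cay G S)"
  then obtain u v t where pst: "pst_at (Cay G S) u v t"
    unfolding admits_pst_def admits_pst_between_def by blast
  then have "even n" unfolding pst_at_iff_phase_alignment[OF n3 conj] by blast
  then show "even n \<and> pst_profile n (conn S False) (conn S True 0) (conn S True 1)"
    using pst_at_imp_pst_profile[OF pst] by blast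
next
  assume "even n \<and> pst_profile n (conn S False) (conn S True 0) (conn S True 1)"
  then have "pst_at (Cay G S) \<one> (\<one> \<otimes> a [^] (n div 2)) (pi / 2)"
    by (intro pst_profile_imp_pst_at) auto
  then show "admits_pst (Cay G S)"
    unfolding admits_pst_def admits_pst_between_def by blast
qed

lemma pst_at_earliest:
  assumes "pst_at (Cay G S) u v t"
  shows "v = u \<otimes> a [^] (n div 2) \<and> pst_at (Cay G S) u v (pi / 2) \<and> pi / 2 \<le> t"
proof -
  have "u \<in> carrier G" "even n" "v = u \<otimes> a [^] (n div 2)"
    using assms unfolding pst_at_iff_phase_alignment[OF n3 conj] by blast+
  then show ?thesis
    using pst_at_imp_pst_profile[OF assms] pst_profile_imp_pst_at by blast
qed

end
end
end
end

section \<open>The classification\<close>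

theorem theorem1p1:
  fixes G :: "('a, 'm) monoid_scheme" (structure)
    and n :: nat and a b :: 'a and S S0 S1 :: "'a set"
  assumes n_ge_3: "3 \<le> n"
    and dihedral: "dihedral G n a b"
    and S_subset: "S \<subseteq> carrier G - {\<one>}"
    and S_conj_closed: "conj_closed G S"
    and S0_def: "S0 = S \<inter> generate G {a}"
    and S1_def: "S1 = S \<inter> (b <# generate G {a})"
    and connected: "Digraph_Component.connected (with_proj (Cay G S))"
  shows
   "(admits_pst (Cay G S) \<longleftrightarrow>
      even n \<and>
      ((8 dvd n \<and> S1 \<noteq> {} \<and>
        (\<exists>E F \<xi>. E \<subseteq> val2_divisors n \<and>
           F \<subseteq> {d. d dvd n \<and> 3 \<le> multiplicity 2 (n div d)} \<and>
           \<xi> \<in> {n div 4, n div 2} \<and>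
           S0 = (\<Union>d \<in> F \<union> E \<union> (\<lambda>x. 2 * x) ` E \<union> (\<lambda>x. 4 * x) ` E \<union> {\<xi>}. gcd_powers G a n d)))
       \<or>
       (n mod 8 = 4 \<and>
        (\<exists>E. E \<subseteq> val2_divisors n \<and>
           ((S1 = b <# generate G {a} \<and>
             (\<exists>\<xi> \<in> {n div 4, n div 2}.
                S0 = (\<Union>d \<in> E \<union> (\<lambda>x. 2 * x) ` E \<union> (\<lambda>x. 4 * x) ` E \<union> {\<xi>}. gcd_powers G a n d)))
            \<or>
            (S1 \<in> {b <# generate G {a [^] (2::nat)}, (b \<otimes> a) <# generate G {a [^] (2::nat)}} \<and>
             (\<exists>\<rho> \<in> {0, 1::nat}. (E \<noteq> {} \<or> \<rho> = 1) \<and>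
                S0 = (\<Union>d \<in> E \<union> (\<lambda>x. 2 * x) ` (val2_divisors n - E)
                           \<union> (\<lambda>x. 4 * x) ` (val2_divisors n - E)
                           \<union> (if \<rho> = 1 then {n div 4, n div 2} else {}). gcd_powers G a n d))))))
       \<or>
       (n mod 4 = 2 \<and> S = carrier G - {\<one>, a [^] (n div 2)})))
    \<and>
    (\<forall>g g'. admits_pst_between (Cay G S) g g' \<longrightarrow>
       g' = g \<otimes> a [^] (n div 2) \<and>
       pst_at (Cay G S) g g' (pi / 2) \<and>
       (\<forall>t. pst_at (Cay G S) g g' t \<longrightarrow> pi / 2 \<le> t))"
  (is "(_ \<longleftrightarrow> even n \<and> (?C1 \<or> ?C2 \<or> ?C3)) \<and> _")
proof
  interpret dihedral G n a b by (rule dihedral)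
  note ctx = n_ge_3 S_subset S_conj_closed
  define c where "c = conn S False"
  define s0 where "s0 = conn S True 0"
  define s1 where "s1 = conn S True 1"
  have n0: "n > 0" using n_ge_3 by simp
  have c: "\<And>k. c k \<in> {0, 1}" "c 0 = 0"
    unfolding c_def using conn_01 conn_rotation_0[OF ctx] by auto
  have s01: "s0 \<in> {0, 1}" "s1 \<in> {0, 1}" unfolding s0_def s1_def using conn_01 by auto
  have pos: "s0 + s1 > 0"
    using reflections_nonempty[OF ctx connected] by (simp add: s0_def s1_def)
  have S0_iff: "S0 = (\<Union>d\<in>D. gcd_powers G a n d) \<longleftrightarrow> gcd_support n c D" for D
    unfolding S0_def c_def by (rule rotations_eq_gcd_powers_iff[OF ctx])
  have S1_ne: "S1 \<noteq> {}"
    unfolding S1_def reflections_empty_iff[OF ctx] using pos by (auto simp: s0_def s1_def)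
  have S1_full: "S1 = b <# generate G {a} \<longleftrightarrow> s0 = 1 \<and> s1 = 1"
    unfolding S1_def s0_def s1_def by (rule reflections_full_iff[OF ctx])
  have C_iff: "pst_profile n c s0 s1 \<longleftrightarrow> ?C1 \<or> ?C2 \<or> ?C3" if "even n"
  proof (cases "n mod 4 = 2")
    case True
    define m where "m = n div 2"
    have m: "odd m" "n = 2 * m" using True unfolding m_def by presburger+
    have eq: "n = 2 * k \<longleftrightarrow> k = m" for k unfolding m(2) by auto
    have neq: "n \<noteq> 2 ^ Suc (Suc r) * k" for r k
      using True by (auto simp: mult.assoc)
    have "pst_profile n c s0 s1 \<longleftrightarrow> gcd_invariant n c \<and> s0 = 1 \<and> s1 = 1 \<and>
        half_profile m (\<lambda>k. c k - parity_fun s0 s1 k)"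
      unfolding pst_profile_def using m(1) by (simp add: eq neq cong: conj_cong del: power_Suc)
    also have "\<dots> \<longleftrightarrow> S = carrier G - {\<one>, a [^] (n div 2)}"
      unfolding c_def s0_def s1_def by (rule half_profile_iff[OF ctx m])
    finally have half: "pst_profile n c s0 s1 \<longleftrightarrow> S = carrier G - {\<one>, a [^] (n div 2)}" .
    have "\<not> 8 dvd n" "n mod 8 \<noteq> 4" using True by presburger+
    then show ?thesis unfolding half by (simp only: True simp_thms)
  next
    case False
    then have "4 dvd n" using that by presburger
    define r where "r = multiplicity 2 n - 2"
    obtain m where m: "n = 2 ^ multiplicity 2 n * m" "odd m"
      using multiplicity_decompose'[of n 2] n0 by auto
    have "2 \<le> multiplicity 2 n"
      using \<open>4 dvd n\<close> n0 by (intro multiplicity_geI) auto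
    then have n: "n = 2 ^ Suc (Suc r) * m" using m(1) by (simp add: r_def numeral_2_eq_2 Suc_diff_Suc)
    interpret four_dvd r m n by (unfold_locales) (fact m(2), fact n)
    have neq: "n \<noteq> 2 * k" if "odd k" for k using \<open>4 dvd n\<close> that by presburger
    have eq: "n = 2 ^ Suc (Suc r') * m' \<longleftrightarrow> r' = r \<and> m' = m" if "odd m'" for r' m'
      by (subst n) (auto simp only: two_power_mult_eq_iff[OF m(2) that] nat.inject)
    have "pst_profile n c s0 s1 \<longleftrightarrow>
        gcd_invariant n c \<and> quarter_profile r m (\<lambda>k. c k - parity_fun s0 s1 k)"
      unfolding pst_profile_def using m(2) by (simp add: eq neq cong: conj_cong del: power_Suc)
    also have "\<dots> \<longleftrightarrow> gcd_invariant n c \<and>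
        (if r = 0 \<and> s0 \<noteq> s1 then twisted_profile m c else plain_profile r m c)"
      by (simp only: quarter_profile_iff[where c = c, OF c s01])
    finally have prof: "pst_profile n c s0 s1 \<longleftrightarrow> gcd_invariant n c \<and>
        (if r = 0 \<and> s0 \<noteq> s1 then twisted_profile m c else plain_profile r m c)" .
    have S1_half: "S1 \<in> {b <# generate G {a [^] (2::nat)}, (b \<otimes> a) <# generate G {a [^] (2::nat)}}
        \<longleftrightarrow> s0 \<noteq> s1"
      unfolding S1_def s0_def s1_def by (rule reflections_half_iff[OF ctx that])
    show ?thesis
    proof (cases "r = 0")
      case r0: True
      have n4: "n = 4 * m" using n r0 by simp
      then have mod: "n mod 8 = 4" "\<not> 8 dvd n" using m(2) by presburger+
      have high: "{d. d dvd n \<and> 3 \<le> multiplicity 2 (n div d)} = {}"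
        unfolding high_divisors_eq r0 by simp
      show ?thesis
      proof (cases "s0 = s1")
        case True
        then have "s0 = 1" "s1 = 1" using s01 pos by auto
        moreover have "gcd_invariant n c \<and> plain_profile r m c \<longleftrightarrow> (\<exists>E. E \<subseteq> val2_divisors n \<and>
            (\<exists>\<xi>\<in>{n div 4, n div 2}. gcd_support n c (E \<union> (\<lambda>x. 2 * x) ` E \<union> (\<lambda>x. 4 * x) ` E \<union> {\<xi>})))"
          unfolding plain_profile_iff_gcd_support[where c = c, OF c] high by (simp only: subset_empty) auto
        ultimately show ?thesis
          unfolding prof S0_iff S1_full S1_half using mod False by simp
      next
        case ne: False
        have "\<exists>k. odd k \<and> c k = 1"
          using odd_rotation_exists[OF ctx connected that] ne unfolding c_def s0_def s1_def by blast
        then have "gcd_invariant n c \<and> twisted_profile m c \<longleftrightarrow>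
            gcd_invariant n c \<and> twisted_profile m c \<and> (\<exists>k. odd k \<and> c k = 1)" by blast
        note twisted = trans[OF this twisted_profile_iff_gcd_support[where c = c, OF c r0]]
        have "\<not> (s0 = 1 \<and> s1 = 1)" using ne by auto
        then show ?thesis
          unfolding prof S0_iff S1_full S1_half
          by (simp only: mod False ne r0 twisted simp_thms if_True)
      qed
    next
      case False
      then obtain r' where "r = Suc r'" using not0_implies_Suc by blast
      then have "n = 8 * (2 ^ r' * m)" using n by simp
      then have mod: "8 dvd n" "n mod 8 \<noteq> 4" by auto
      then show ?thesis
        unfolding prof S0_iff using S1_ne \<open>n mod 4 \<noteq> 2\<close> \<open>r \<noteq> 0\<close>
        by (simp only: simp_thms if_False) (rule plain_profile_iff_gcd_support[where c = c, OF c])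
    qed
  qed
  show "admits_pst (Cay G S) \<longleftrightarrow> even n \<and> (?C1 \<or> ?C2 \<or> ?C3)"
    unfolding admits_pst_iff_pst_profile[OF ctx connected] c_def[symmetric] s0_def[symmetric] s1_def[symmetric]
    by (rule conj_cong[OF refl C_iff])
  show "\<forall>g g'. admits_pst_between (Cay G S) g g' \<longrightarrow>
       g' = g \<otimes> a [^] (n div 2) \<and>
       pst_at (Cay G S) g g' (pi / 2) \<and>
       (\<forall>t. pst_at (Cay G S) g g' t \<longrightarrow> pi / 2 \<le> t)"
    unfolding admits_pst_between_def using pst_at_earliest[OF ctx connected] by blast
qed

end
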